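(* Let $\mathfrak g$ be a finite-dimensional simple Lie algebra over a field $\mathbb F$ of characteristic $0$, let $k\in\mathbb F$ be nonzero, and let $\mathcal V^k_{\mathfrak g}$ be the affine PVA of level $k$ (defined by a nondegenerate symmetric invariant bilinear form $(\cdot|\cdot)$ on $\mathfrak g$). Then: (a) Every Casimir element of the PVA $\mathcal V^k_{\mathfrak g}$ is a scalar multiple of $\int1$. (b) Every derivation of the PVA $\mathcal V^k_{\mathfrak g}$ is inner. (c) Up to equivalence, any first-order deformation of $\mathcal V^k_{\mathfrak g}$ which preserves the product and the $\mathbb F[\partial]$-module structure corresponds to a scalar multiple of the $2$-cocycle given by $Y_{\lambda_1,\lambda_2}(a_1\otimes a_2)=\lambda_1(a_1|a_2)+\langle\partial+\lambda_1+\lambda_2\rangle$ for $a_1,a_2\in\mathfrak g$.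
   Context: $\mathbb F$ is a field of characteristic $0$. Everything here is purely even. $\int:\mathcal V\to\mathcal V/\partial\mathcal V$ is the quotient map. PVA: a Poisson vertex algebra is a commutative associative unital algebra $\mathcal V$ with a derivation $\partial$ and a bilinear map $\mathcal V\otimes\mathcal V\to\mathcal V[\lambda]$, $a\otimes b\mapsto[a_\lambda b]$, with $[\partial a_\lambda b]=-\lambda[a_\lambda b]$, $[a_\lambda\partial b]=(\lambda+\partial)[a_\lambda b]$, $[a_\lambda b]=-[b_{-\lambda-\partial}a]$ ($\partial$ acting from the left on coefficients), $[a_\lambda[b_\mu c]]-[b_\mu[a_\lambda c]]=[[a_\lambda b]_{\lambda+\mu}c]$, $[a_\lambda bc]=[a_\lambda b]c+[a_\lambda c]b$. A Casimir element of $\mathcal V$ is $\int a\in\mathcal V/\partial\mathcal V$ with $[a_\lambda\mathcal V]|_{\lambda=0}=0$. A derivation of $\mathcal V$ is a linear map $D:\mathcal V\to\mathcal V$ commuting with $\partial$ which is a derivation of the product and satisfies $D[a_\lambda b]=[(Da)_\lambda b]+[a_\lambda(Db)]$. It is inner if $D=[a_\lambda\,\cdot\,]|_{\lambda=0}$ for some $a\in\mathcal V$. A first-order deformation preserving the product and the $\mathbb F[\partial]$-module structure is a PVA structure over $\mathbb F[\epsilon]/(\epsilon^2)$ on $\mathcal V\otimes\mathbb F[\epsilon]/(\epsilon^2)$ with product and $\partial$ extended $\epsilon$-linearly and $\lambda$-bracket $[a_\lambda b]+\epsilon\{a_\lambda b\}$, $a,b\in\mathcal V$. Two such are equivalent if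 related by an automorphism $\mathrm{id}+\epsilon D$, $D$ a derivation of the product of $\mathcal V$ commuting with $\partial$. The deformation corresponds to the variational PVA $2$-cocycle $Y:\mathcal V^{\otimes2}\to\mathcal V[\lambda_1,\lambda_2]/\langle\partial+\lambda_1+\lambda_2\rangle$ ($\langle\Phi\rangle$ = image of $\Phi$) with $\{a_\lambda b\}=Y_{\lambda,-\lambda-\partial}(a\otimes b)$, which by sesquilinearity and the Leibniz rules is determined by its values on $\mathfrak g\otimes\mathfrak g$; thus the cocycle in (c) corresponds to $\{a_\lambda b\}=\lambda(a|b)1$ for $a,b\in\mathfrak g$. Affine PVA: $\mathcal V^k_{\mathfrak g}=S(\mathbb F[\partial]\otimes\mathfrak g)$ (symmetric algebra), with $\partial$ extended as a derivation and with the unique PVA $\lambda$-bracket such that $[a_\lambda b]=[a,b]+k\lambda(a|b)1$ for $a,b\in\mathfrak g$.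
   Formalization: Part (c) is stated only for g whose centroid consists of scalars (every linear T with T[x,y]=[x,Ty] is scalar); without this (c) fails, e.g. for sl_2(C) as a real Lie algebra, where λ(Ta|b) with T = multiplication by i is a deformation not equivalent to a multiple of λ(a|b). *)

theory Defs
  imports Complex_Main "HOL-Library.Poly_Mapping" "HOL-Computational_Algebra.Polynomial"
begin

section \<open>Lie algebras\<close>

locale lie_algebra = vector_space scale
  for scale :: "'f::field_char_0 \<Rightarrow> 'g::ab_group_add \<Rightarrow> 'g" +
  fixes lie :: "'g \<Rightarrow> 'g \<Rightarrow> 'g"
  assumes lie_linear_left: "Vector_Spaces.linear scale scale (\<lambda>x. lie x y)"
    and lie_linear_right: "Vector_Spaces.linear scale scale (lie x)"
    and lie_self: "lie x x = 0"
    and lie_jacobi: "lie x (lie y z) + lie y (lie z x) + lie z (lie x y) = 0"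

definition lie_ideal :: "('f::field_char_0 \<Rightarrow> 'g::ab_group_add \<Rightarrow> 'g) \<Rightarrow> ('g \<Rightarrow> 'g \<Rightarrow> 'g) \<Rightarrow> 'g set \<Rightarrow> bool" where
  "lie_ideal scale lie I \<longleftrightarrow> module.subspace scale I \<and> (\<forall>x. \<forall>y\<in>I. lie x y \<in> I)"

locale simple_lie_algebra = lie_algebra +
  assumes nonabelian: "\<exists>x y. lie x y \<noteq> 0"
    and ideal_trivial: "lie_ideal scale lie I \<Longrightarrow> I = {0} \<or> I = UNIV"

locale nondegenerate_invariant_form = lie_algebra +
  fixes form :: "'b \<Rightarrow> 'b \<Rightarrow> 'a"
  assumes form_linear: "Vector_Spaces.linear scale (*) (form x)"
    and form_symmetric: "form x y = form y x"
    and form_invariant: "form (lie x y) z = form x (lie y z)"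
    and form_nondegenerate: "(\<forall>y. form x y = 0) \<Longrightarrow> x = 0"

text \<open>The centroid consists of the scalars. For a simple Lie algebra of finite dimension over an
  algebraically closed field this is automatic (Schur's lemma). If \<open>T\<close> is in the centroid, then
  \<open>(Ta|b)\<close> is again a symmetric invariant form and \<open>\<lambda>(Ta|b)\<close> gives a deformation of the affine PVA,
  equivalent to one of the form \<open>c \<lambda>(a|b)\<close> only for scalar \<open>T\<close>; this is why the classification of
  deformations needs the condition.\<close>
definition scalar_centroid :: "('f::field_char_0 \<Rightarrow> 'g::ab_group_add \<Rightarrow> 'g) \<Rightarrow> ('g \<Rightarrow> 'g \<Rightarrow> 'g) \<Rightarrow> bool" where
  "scalar_centroid scale lie \<longleftrightarrow>
     (\<forall>T. Vector_Spaces.linear scale scale T \<and> (\<forall>x y. T (lie x y) = lie x (T y))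
          \<longrightarrow> (\<exists>c. \<forall>x. T x = scale c x))"


section \<open>Substitutions in \<open>V[\<lambda>]\<close> and \<open>V[\<lambda>, \<mu>]\<close>\<close>

text \<open>Elements of \<open>V[\<lambda>]\<close> have type \<open>'v poly\<close>. Elements of \<open>V[\<lambda>, \<mu>]\<close> (or
  \<open>V[\<lambda>\<^sub>1, \<lambda>\<^sub>2]\<close>) have type \<open>'v poly poly\<close>: the coefficients, of type \<open>'v poly\<close>, are polynomials in
  the first variable, and the outer polynomial variable is the second one.\<close>

definition in_second :: "'v::comm_ring_1 poly \<Rightarrow> 'v poly poly" where
  "in_second p = map_poly (\<lambda>v. [:v:]) p"

definition lambda_plus :: "('v::comm_ring_1 \<Rightarrow> 'v) \<Rightarrow> 'v poly \<Rightarrow> 'v poly" where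
  "lambda_plus D p = pCons 0 p + map_poly D p"

text \<open>\<open>P(\<lambda>, -\<lambda>-D)\<close>, with the powers of \<open>-\<lambda>-D\<close> standing on the left of the coefficients.\<close>
definition subst_second :: "('v::comm_ring_1 \<Rightarrow> 'v) \<Rightarrow> 'v poly poly \<Rightarrow> 'v poly" where
  "subst_second D P = (\<Sum>n\<le>degree P. ((\<lambda>q. - lambda_plus D q) ^^ n) (coeff P n))"

text \<open>The operator \<open>D + \<lambda>\<^sub>1 + \<lambda>\<^sub>2\<close>, whose image is divided out below.\<close>
definition total_op :: "('v::comm_ring_1 \<Rightarrow> 'v) \<Rightarrow> 'v poly poly \<Rightarrow> 'v poly poly" where
  "total_op D P = map_poly (map_poly D) P + smult [:0, 1:] P + pCons 0 P"

definition cong_total :: "('v::comm_ring_1 \<Rightarrow> 'v) \<Rightarrow> 'v poly poly \<Rightarrow> 'v poly poly \<Rightarrow> bool" where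
  "cong_total D P Q \<longleftrightarrow> P - Q \<in> range (total_op D)"


section \<open>Poisson vertex algebras\<close>

text \<open>The ground ring is an arbitrary commutative ring, in order to include the dual numbers.\<close>
locale comm_algebra = module scale
  for scale :: "'r::comm_ring_1 \<Rightarrow> 'v::comm_ring_1 \<Rightarrow> 'v" +
  assumes scale_mult_left: "scale r a * b = scale r (a * b)"

definition algebra_derivation :: "('r::comm_ring_1 \<Rightarrow> 'v::comm_ring_1 \<Rightarrow> 'v) \<Rightarrow> ('v \<Rightarrow> 'v) \<Rightarrow> bool" where
  "algebra_derivation scale E \<longleftrightarrow>
     module_hom scale scale E \<and> (\<forall>a b. E (a * b) = E a * b + a * E b)"

locale poisson_vertex_algebra = comm_algebra scale
  for scale :: "'r::comm_ring_1 \<Rightarrow> 'v::comm_ring_1 \<Rightarrow> 'v" +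
  fixes D :: "'v \<Rightarrow> 'v"
    and br :: "'v \<Rightarrow> 'v \<Rightarrow> 'v poly"
  assumes D_derivation: "algebra_derivation scale D"
    and br_linear_left: "module_hom scale (\<lambda>r. map_poly (scale r)) (\<lambda>a. br a b)"
    and br_linear_right: "module_hom scale (\<lambda>r. map_poly (scale r)) (br a)"
    and sesquilinear_left: "br (D a) b = - ([:0, 1:] * br a b)"
    and sesquilinear_right: "br a (D b) = lambda_plus D (br a b)"
    and skewsymmetry: "br a b = - subst_second D (in_second (br b a))"
    and jacobi:
      "map_poly (br a) (br b c)
         - (\<Sum>m\<le>degree (br a c). smult (monom 1 m) (in_second (br b (coeff (br a c) m))))
       = (\<Sum>m\<le>degree (br a b). smult (monom 1 m)
            (pcompose (in_second (br (coeff (br a b) m) c)) [:[:0, 1:], 1:]))"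
    and leibniz: "br a (b * c) = smult c (br a b) + smult b (br a c)"

text \<open>The class \<open>\<integral>a\<close> of \<open>a\<close> in \<open>V / D V\<close>.\<close>
definition lint :: "('v::comm_ring_1 \<Rightarrow> 'v) \<Rightarrow> 'v \<Rightarrow> 'v set" where
  "lint D a = {a + D v | v. True}"

definition casimir_elements :: "('v::comm_ring_1 \<Rightarrow> 'v) \<Rightarrow> ('v \<Rightarrow> 'v \<Rightarrow> 'v poly) \<Rightarrow> 'v set set" where
  "casimir_elements D br = {lint D a | a. \<forall>b. poly (br a b) 0 = 0}"

definition pva_derivation :: "('r::comm_ring_1 \<Rightarrow> 'v::comm_ring_1 \<Rightarrow> 'v) \<Rightarrow> ('v \<Rightarrow> 'v) \<Rightarrow>
    ('v \<Rightarrow> 'v \<Rightarrow> 'v poly) \<Rightarrow> ('v \<Rightarrow> 'v) \<Rightarrow> bool" where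
  "pva_derivation scale D br E \<longleftrightarrow>
     algebra_derivation scale E \<and> (\<forall>a. E (D a) = D (E a)) \<and>
     (\<forall>a b. map_poly E (br a b) = br (E a) b + br a (E b))"

definition inner_derivation :: "('v::comm_ring_1 \<Rightarrow> 'v \<Rightarrow> 'v poly) \<Rightarrow> ('v \<Rightarrow> 'v) \<Rightarrow> bool" where
  "inner_derivation br E \<longleftrightarrow> (\<exists>a. \<forall>b. E b = poly (br a b) 0)"


section \<open>Dual numbers and first-order deformations\<close>

text \<open>\<open>DN a b\<close> is \<open>a + \<epsilon> b\<close> with \<open>\<epsilon>\<^sup>2 = 0\<close>. For an algebra \<open>V\<close> over \<open>F\<close>, the type \<open>'v dual_number\<close>
  is \<open>V \<otimes> F[\<epsilon>]/(\<epsilon>\<^sup>2)\<close>.\<close>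
datatype 'a dual_number = DN (std: 'a) (eps: 'a)

instantiation dual_number :: (comm_ring_1) comm_ring_1
begin
definition "0 = DN 0 0"
definition "1 = DN 1 0"
definition "x + y = DN (std x + std y) (eps x + eps y)"
definition "x - y = DN (std x - std y) (eps x - eps y)"
definition "- x = DN (- std x) (- eps x)"
definition "x * y = DN (std x * std y) (std x * eps y + eps x * std y)"
instance
  by standard
    (simp_all add: zero_dual_number_def one_dual_number_def plus_dual_number_def
      minus_dual_number_def uminus_dual_number_def times_dual_number_def algebra_simps)
end

definition dual_scale :: "('f \<Rightarrow> 'v::comm_ring_1 \<Rightarrow> 'v) \<Rightarrow> 'f dual_number \<Rightarrow> 'v dual_number \<Rightarrow> 'v dual_number" where
  "dual_scale scale r x =
     DN (scale (std r) (std x)) (scale (std r) (eps x) + scale (eps r) (std x))"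

text \<open>The extension of \<open>br a b + \<epsilon> B a b\<close> (\<open>a, b \<in> V\<close>) that is bilinear over the dual numbers.\<close>
definition deformed_bracket :: "('v::comm_ring_1 \<Rightarrow> 'v \<Rightarrow> 'v poly) \<Rightarrow> ('v \<Rightarrow> 'v \<Rightarrow> 'v poly) \<Rightarrow>
    'v dual_number \<Rightarrow> 'v dual_number \<Rightarrow> 'v dual_number poly" where
  "deformed_bracket br B x y =
     map_poly (\<lambda>v. DN v 0) (br (std x) (std y)) +
     map_poly (\<lambda>v. DN 0 v) (br (std x) (eps y) + br (eps x) (std y) + B (std x) (std y))"

definition first_order_deformation :: "('r::comm_ring_1 \<Rightarrow> 'v::comm_ring_1 \<Rightarrow> 'v) \<Rightarrow> ('v \<Rightarrow> 'v) \<Rightarrow>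
    ('v \<Rightarrow> 'v \<Rightarrow> 'v poly) \<Rightarrow> ('v \<Rightarrow> 'v \<Rightarrow> 'v poly) \<Rightarrow> bool" where
  "first_order_deformation scale D br B \<longleftrightarrow>
     poisson_vertex_algebra (dual_scale scale) (map_dual_number D) (deformed_bracket br B)"

definition id_plus_eps :: "('v::comm_ring_1 \<Rightarrow> 'v) \<Rightarrow> 'v dual_number \<Rightarrow> 'v dual_number" where
  "id_plus_eps E x = DN (std x) (eps x + E (std x))"

definition equivalent_deformations :: "('r::comm_ring_1 \<Rightarrow> 'v::comm_ring_1 \<Rightarrow> 'v) \<Rightarrow> ('v \<Rightarrow> 'v) \<Rightarrow>
    ('v \<Rightarrow> 'v \<Rightarrow> 'v poly) \<Rightarrow> ('v \<Rightarrow> 'v \<Rightarrow> 'v poly) \<Rightarrow> ('v \<Rightarrow> 'v \<Rightarrow> 'v poly) \<Rightarrow> bool" where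
  "equivalent_deformations scale D br B B' \<longleftrightarrow>
     (\<exists>E. algebra_derivation scale E \<and> (\<forall>a. E (D a) = D (E a)) \<and>
        (\<forall>x y. map_poly (id_plus_eps E) (deformed_bracket br B x y)
               = deformed_bracket br B' (id_plus_eps E x) (id_plus_eps E y)))"

text \<open>A \<open>2\<close>-cochain \<open>Y\<close> takes values in the quotient of \<open>V[\<lambda>\<^sub>1, \<lambda>\<^sub>2]\<close> by the image of
  \<open>D + \<lambda>\<^sub>1 + \<lambda>\<^sub>2\<close>; it is given here by a choice of representatives of these values. The bracket
  \<open>Y\<^bsub>\<lambda>,-\<lambda>-D\<^esub>(a \<otimes> b)\<close> does not depend on the choice, by the lemma \<open>subst_second_cong_total\<close>.
  The \<open>2\<close>-cocycles preserving the product and \<open>D\<close> are those whose bracket is a first-order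
  deformation.\<close>
definition cochain_bracket :: "('v::comm_ring_1 \<Rightarrow> 'v) \<Rightarrow> ('v \<Rightarrow> 'v \<Rightarrow> 'v poly poly) \<Rightarrow> 'v \<Rightarrow> 'v \<Rightarrow> 'v poly" where
  "cochain_bracket D Y a b = subst_second D (Y a b)"

definition two_cocycle :: "('r::comm_ring_1 \<Rightarrow> 'v::comm_ring_1 \<Rightarrow> 'v) \<Rightarrow> ('v \<Rightarrow> 'v) \<Rightarrow>
    ('v \<Rightarrow> 'v \<Rightarrow> 'v poly) \<Rightarrow> ('v \<Rightarrow> 'v \<Rightarrow> 'v poly poly) \<Rightarrow> bool" where
  "two_cocycle scale D br Y \<longleftrightarrow> first_order_deformation scale D br (cochain_bracket D Y)"

lemma subst_second_bound:
  assumes D0: "D 0 = 0" and "degree P \<le> N"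
  shows "subst_second D P = (\<Sum>n\<le>N. ((\<lambda>q. - lambda_plus D q) ^^ n) (coeff P n))"
proof -
  have z: "((\<lambda>q. - lambda_plus D q) ^^ n) 0 = 0" for n
    by (induction n) (simp_all add: lambda_plus_def)
  show ?thesis
    unfolding subst_second_def
    by (rule sum.mono_neutral_left) (use assms(2) in \<open>auto simp: z coeff_eq_0\<close>)
qed

lemma subst_second_cong_total:
  assumes add: "\<And>a b. D (a + b) = D a + D b" and "cong_total D P Q"
  shows "subst_second D P = subst_second D Q"
proof -
  let ?N = "\<lambda>q. - lambda_plus D q"
  have D0: "D 0 = 0" using add[of 0 0] by simp
  have Nadd: "?N (p + q) = ?N p + ?N q" for p q
    by (simp add: lambda_plus_def poly_eq_iff coeff_map_poly D0 add coeff_pCons split: nat.split)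
  have pow_add: "(?N ^^ n) (p + q) = (?N ^^ n) p + (?N ^^ n) q" for n p q
    by (induction n) (simp_all add: Nadd del: minus_add_distrib)
  have pow_minus: "(?N ^^ n) (- p) = - (?N ^^ n) p" for n p
    using pow_add[of n p "- p"] pow_add[of n 0 0] by (simp add: add_eq_0_iff)
  obtain R where R: "P = Q + total_op D R"
    using assms(2) by (auto simp: cong_total_def algebra_simps)
  define M where "M = max (max (degree P) (degree Q)) (Suc (degree R))"
  have s: "subst_second D P = (\<Sum>n\<le>M. (?N ^^ n) (coeff P n))"
    "subst_second D Q = (\<Sum>n\<le>M. (?N ^^ n) (coeff Q n))"
    by (rule subst_second_bound, simp_all add: D0 M_def)+
  have c: "coeff (total_op D R) n = - ?N (coeff R n) + (case n of 0 \<Rightarrow> 0 | Suc m \<Rightarrow> coeff R m)" for n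
    by (simp add: total_op_def lambda_plus_def coeff_map_poly D0 coeff_pCons split: nat.split)
  have "(\<Sum>n\<le>M. (?N ^^ n) (coeff (total_op D R) n))
      = (\<Sum>n\<le>M. - (?N ^^ Suc n) (coeff R n))
        + (\<Sum>n\<le>M. case n of 0 \<Rightarrow> 0 | Suc m \<Rightarrow> (?N ^^ Suc m) (coeff R m))"
  proof -
    have "(?N ^^ n) (coeff (total_op D R) n)
        = - (?N ^^ Suc n) (coeff R n) + (case n of 0 \<Rightarrow> 0 | Suc m \<Rightarrow> (?N ^^ Suc m) (coeff R m))" for n
    proof -
      have "(?N ^^ n) (- ?N (coeff R n)) = - (?N ^^ Suc n) (coeff R n)"
        using pow_minus[of n "?N (coeff R n)"] by (simp only: funpow_Suc_right o_apply)
      moreover have "(?N ^^ n) (case n of 0 \<Rightarrow> 0 | Suc m \<Rightarrow> coeff R m)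
          = (case n of 0 \<Rightarrow> 0 | Suc m \<Rightarrow> (?N ^^ Suc m) (coeff R m))"
        by (cases n) simp_all
      ultimately show ?thesis unfolding c pow_add by (simp only:)
    qed
    then show ?thesis by (simp only: sum.distrib)
  qed
  also have "(\<Sum>n\<le>M. case n of 0 \<Rightarrow> 0 | Suc m \<Rightarrow> (?N ^^ Suc m) (coeff R m))
      = (\<Sum>n\<le>M - 1. (?N ^^ Suc n) (coeff R n))"
  proof -
    obtain L where "M = Suc L" by (cases M) (auto simp: M_def)
    then show ?thesis by (simp add: sum.atMost_Suc_shift del: funpow.simps sum.atMost_Suc)
  qed
  also have "(\<Sum>n\<le>M - 1. (?N ^^ Suc n) (coeff R n)) = (\<Sum>n\<le>M. (?N ^^ Suc n) (coeff R n))"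
  proof -
    have "(?N ^^ Suc M) 0 = 0" using pow_add[of "Suc M" 0 0] by simp
    moreover have "coeff R M = 0" by (rule coeff_eq_0) (simp add: M_def)
    moreover obtain L where "M = Suc L" by (cases M) (auto simp: M_def)
    ultimately show ?thesis by (simp del: funpow.simps)
  qed
  finally have "(\<Sum>n\<le>M. (?N ^^ n) (coeff (total_op D R) n)) = 0"
    by (simp add: sum_negf del: funpow.simps)
  then show ?thesis
    unfolding s unfolding R by (simp add: pow_add sum.distrib del: funpow.simps)
qed


section \<open>The affine Poisson vertex algebra\<close>

text \<open>\<open>S(F[\<partial>] \<otimes> g)\<close> for a Lie algebra with basis \<open>e\<close>, indexed by \<open>'i\<close>, is the polynomial algebra
  in the variables \<open>\<partial>\<^sup>n e\<^sub>i\<close>; the pair \<open>(i, n)\<close> names this variable.\<close>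
type_synonym ('i, 'f) diff_poly = "(('i \<times> nat) \<Rightarrow>\<^sub>0 nat) \<Rightarrow>\<^sub>0 'f"

definition dp_const :: "'f::field_char_0 \<Rightarrow> ('i, 'f) diff_poly" where
  "dp_const c = Poly_Mapping.single 0 c"

definition dp_var :: "'i \<Rightarrow> nat \<Rightarrow> ('i, 'f::field_char_0) diff_poly" where
  "dp_var i n = Poly_Mapping.single (Poly_Mapping.single (i, n) 1) 1"

definition dp_scale :: "'f::field_char_0 \<Rightarrow> ('i, 'f) diff_poly \<Rightarrow> ('i, 'f) diff_poly" where
  "dp_scale c p = dp_const c * p"

text \<open>The inclusion of \<open>g\<close> as the linear span of the variables \<open>e\<^sub>i = \<partial>\<^sup>0 e\<^sub>i\<close>.\<close>
definition dp_incl :: "('f::field_char_0 \<Rightarrow> 'g::ab_group_add \<Rightarrow> 'g) \<Rightarrow> ('i::finite \<Rightarrow> 'g) \<Rightarrow> 'g \<Rightarrow> ('i, 'f) diff_poly" where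
  "dp_incl scale e x =
     (\<Sum>i\<in>UNIV. dp_scale (module.representation scale (range e) x (e i)) (dp_var i 0))"

text \<open>\<open>D\<close> and \<open>br\<close> are determined by these axioms, since the variables generate the algebra.\<close>
locale affine_pva = poisson_vertex_algebra dp_scale D br
  for D :: "('i::finite, 'f::field_char_0) diff_poly \<Rightarrow> ('i, 'f) diff_poly"
    and br :: "('i, 'f) diff_poly \<Rightarrow> ('i, 'f) diff_poly \<Rightarrow> ('i, 'f) diff_poly poly" +
  fixes scale :: "'f \<Rightarrow> 'g::ab_group_add \<Rightarrow> 'g"
    and lie :: "'g \<Rightarrow> 'g \<Rightarrow> 'g"
    and form :: "'g \<Rightarrow> 'g \<Rightarrow> 'f"
    and k :: 'f
    and e :: "'i \<Rightarrow> 'g"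
  assumes D_var: "D (dp_var i n) = dp_var i (Suc n)"
    and br_generators:
      "br (dp_incl scale e a) (dp_incl scale e b)
         = [:dp_incl scale e (lie a b), dp_const (k * form a b):]"

end

theory Submission
  imports Defs "HOL-Algebra.Algebraic_Closure_Type" "HOL-Library.Function_Algebras"
begin

text \<open>The Sugawara element \<open>L = (1/2k) \<Sum> u\<^sub>i u\<^sup>i\<close> acts with \<open>[L \<^sub>\<lambda> \<cdot>] = \<partial> + \<lambda> \<Delta> + \<dots>\<close>, where \<open>\<Delta>\<close> is the
  conformal weight operator (\<open>\<partial>\<^sup>n a\<close> has weight \<open>n + 1\<close> for \<open>a\<close> in \<open>g\<close>). Inserting \<open>L\<close> into the defining
  identity of a Casimir element, a derivation or a 2-cocycle expresses \<open>(weight - 1)\<close> times the object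
  as something trivial, so only the component of weight one matters. There one is left with
  questions about \<open>g\<close> itself: its centre is zero, its derivations are inner, \<open>H\<^sup>2(g, g) = 0\<close>, and
  invariant forms are multiples of the given one. For these, the Casimir operator of the given form
  is invertible by Schur's lemma, unless it is zero. In that case the Killing form vanishes; then
  over the algebraic closure every \<open>ad x\<close> is nilpotent, which contradicts \<open>[g, g] = g\<close> by Engel's
  theorem. The standard cocycle exists because rescaling the generators turns a change of the level
  into a rescaling of the bracket.\<close>

text \<open>The bracket coefficient of order m lowers the weight by m + 1, so for a cocycle on
  generators the relevant operator at order m is weight + m - 1. Its kernel is weight one for m = 0,
  the constants for m = 1 and zero for m \<ge> 2: only a bracket on g and a bilinear form can
  survive. These operators are diagonal, so an element in both kernel and image is zero; this
  disposes of the weight-one error terms. The three parts feed each other: a derivation applied to L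
  gives a Casimir element, and a cocycle contracted with L at order zero gives a derivation, which
  must be inner before the contraction at order one can be made to commute with D. Over F the
  Casimir operator need not be a scalar, so its inverse is kept as an operator commuting with all ad
  x. Nilpotency of ad x comes from testing traces against a derivation that is a polynomial in ad x
  and whose eigenvalues are rational images of those of ad x: a vanishing trace becomes a vanishing
  sum of rational squares.\<close>

hide_const (open) UnivPoly.coeff UnivPoly.monom Module.smult Module.module Polynomials.degree

section \<open>Polynomials in a linear operator\<close>

locale linear_operator = vector_space scale
  for scale :: "'a::field \<Rightarrow> 'b::ab_group_add \<Rightarrow> 'b" (infixr "*s" 75) +
  fixes A :: "'b \<Rightarrow> 'b"
  assumes linear_A: "Vector_Spaces.linear scale scale A"
begin

sublocale A: Vector_Spaces.linear scale scale A by (rule linear_A)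

definition poly_op :: "'a poly \<Rightarrow> 'b \<Rightarrow> 'b" where
  "poly_op q v = (\<Sum>n\<le>degree q. coeff q n *s (A ^^ n) v)"

lemma poly_op_bound: "degree q \<le> N \<Longrightarrow> poly_op q v = (\<Sum>n\<le>N. coeff q n *s (A ^^ n) v)"
  unfolding poly_op_def by (rule sum.mono_neutral_left) (auto simp: coeff_eq_0)

lemma poly_op_0 [simp]: "poly_op 0 v = 0"
  by (simp add: poly_op_def)

lemma poly_op_pCons [simp]: "poly_op (pCons a p) v = a *s v + A (poly_op p v)"
proof -
  have "poly_op (pCons a p) v = (\<Sum>n\<le>Suc (degree p). coeff (pCons a p) n *s (A ^^ n) v)"
    by (rule poly_op_bound) (rule degree_pCons_le)
  also have "\<dots> = a *s v + (\<Sum>n\<le>degree p. coeff p n *s A ((A ^^ n) v))"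
    by (subst sum.atMost_Suc_shift) simp
  also have "\<dots> = a *s v + A (poly_op p v)"
    by (simp add: poly_op_def A.sum A.scale)
  finally show ?thesis .
qed

lemma poly_op_add [simp]: "poly_op (p + q) v = poly_op p v + poly_op q v"
proof -
  define N where "N = max (degree p) (degree q)"
  have "degree p \<le> N" "degree q \<le> N" "degree (p + q) \<le> N"
    by (simp_all add: N_def degree_add_le)
  then show ?thesis by (simp add: poly_op_bound sum.distrib scale_left_distrib)
qed

lemma poly_op_smult [simp]: "poly_op (smult c p) v = c *s poly_op p v"
  by (induction p) (simp_all add: scale_right_distrib A.scale)

lemma poly_op_minus [simp]: "poly_op (- p) v = - poly_op p v"
  using poly_op_smult[of "- 1" p v] by simp

lemma poly_op_diff [simp]: "poly_op (p - q) v = poly_op p v - poly_op q v"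
  using poly_op_add[of p "- q" v] by simp

lemma poly_op_mult [simp]: "poly_op (p * q) v = poly_op p (poly_op q v)"
  by (induction p) simp_all

lemma poly_op_1 [simp]: "poly_op 1 v = v"
  by (simp add: one_pCons)

lemma linear_poly_op: "Vector_Spaces.linear scale scale (poly_op p)"
  unfolding Vector_Spaces.linear_iff
  by (induction p) (simp_all add: vector_space_axioms A.add A.scale scale_right_distrib
      scale_left_distrib scale_left_commute mult.commute algebra_simps)

lemma poly_op_zero_right [simp]: "poly_op p 0 = 0"
  by (rule Vector_Spaces.linear.axioms(3)[OF linear_poly_op, THEN module_hom.zero])

lemma poly_op_dvd: "p dvd q \<Longrightarrow> poly_op p v = 0 \<Longrightarrow> poly_op q v = 0"
  by (auto elim!: dvdE simp: mult.commute[of p])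

lemma poly_op_monic_linear: "poly_op [:- a, 1:] v = A v - a *s v"
  by simp

text \<open>Modulo X - a the polynomial P is a nonzero constant with inverse c. Hence (1 - c P)^M is
  divisible by (X - a)^M, and its expansion differs from 1 by a multiple of P.\<close>

lemma coprime_linear_power:
  fixes P :: "'a poly"
  assumes "poly P a \<noteq> 0"
  shows "\<exists>r. [:- a, 1:] ^ M dvd 1 - r * P"
proof -
  define c where "c = inverse (poly P a)"
  have "poly (1 - smult c P) a = 0" using assms by (simp add: c_def)
  then have "[:- a, 1:] dvd 1 - smult c P" by (simp only: poly_eq_0_iff_dvd)
  then have "[:- a, 1:] ^ M dvd (1 - smult c P) ^ M" by (rule dvd_power_same)
  moreover have "P dvd 1 - (1 - smult c P) ^ M"
  proof -
    have "1 - (1 - smult c P) dvd 1 ^ M - (1 - smult c P) ^ M"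
      by (metis dvd_triv_left power_diff_sumr2)
    moreover have "P dvd 1 - (1 - smult c P)" by (simp add: dvd_smult)
    ultimately show ?thesis by (metis dvd_trans power_one)
  qed
  then obtain r where "1 - (1 - smult c P) ^ M = P * r" by (elim dvdE)
  then have "(1 - smult c P) ^ M = 1 - r * P" by (simp add: algebra_simps)
  ultimately show ?thesis by metis
qed

text \<open>Chinese remainder theorem with constant residues: the correction is a multiple of the
  product P of the earlier moduli, and r P = 1 modulo the new one. It yields polynomials in an
  operator that act on each generalized eigenspace by a prescribed scalar.\<close>

lemma interpolation:
  fixes c :: "'a \<Rightarrow> 'a"
  assumes "finite S"
  shows "\<exists>q. \<forall>a\<in>S. [:- a, 1:] ^ M dvd q - [:c a:]"
  using assms
proof induction
  case empty
  show ?case by simp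
next
  case (insert a S)
  then obtain q where q: "\<And>b. b \<in> S \<Longrightarrow> [:- b, 1:] ^ M dvd q - [:c b:]" by blast
  define P where "P = (\<Prod>b\<in>S. [:- b, 1:] ^ M)"
  have "poly P a \<noteq> 0"
    using insert by (auto simp: P_def poly_prod)
  then obtain r where r: "[:- a, 1:] ^ M dvd 1 - r * P"
    using coprime_linear_power by blast
  let ?q = "q + ([:c a:] - q) * (r * P)"
  have "?q - [:c a:] = (q - [:c a:]) * (1 - r * P)" by (simp add: algebra_simps)
  then have "[:- a, 1:] ^ M dvd ?q - [:c a:]" using r by (metis dvd_mult)
  moreover have "[:- b, 1:] ^ M dvd ?q - [:c b:]" if "b \<in> S" for b
  proof -
    have "[:- b, 1:] ^ M dvd P"
      unfolding P_def using that insert by (intro dvd_prodI) auto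
    then have "[:- b, 1:] ^ M dvd (q - [:c b:]) + ([:c a:] - q) * (r * P)"
      using q[OF that] by (intro dvd_add dvd_mult)
    then show ?thesis by (simp add: algebra_simps)
  qed
  ultimately show ?case by blast
qed

text \<open>The factors for distinct roots are comaximal, hence a vector killed by the product is the sum of
  two vectors killed by proper factors.\<close>
lemma in_span_generalized_eigenvectors:
  assumes "finite S" "poly_op (\<Prod>a\<in>S. [:- a, 1:] ^ M) v = 0"
  shows "v \<in> span {w. \<exists>a\<in>S. poly_op ([:- a, 1:] ^ M) w = 0}"
  using assms
proof (induction S arbitrary: v)
  case empty
  then show ?case by (simp add: span_zero)
next
  case (insert a S)
  define P where "P = (\<Prod>b\<in>S. [:- b, 1:] ^ M)"
  have P: "poly_op (P * [:- a, 1:] ^ M) v = 0"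
    using insert.prems insert.hyps by (simp add: P_def mult.commute)
  have "poly P a \<noteq> 0"
    using insert.hyps by (auto simp: P_def poly_prod)
  then obtain r h where r: "1 - r * P = [:- a, 1:] ^ M * h"
    using coprime_linear_power by (metis dvd_def)
  let ?G = "\<lambda>S. {w. \<exists>a\<in>S. poly_op ([:- a, 1:] ^ M) w = 0}"
  have "poly_op ([:- a, 1:] ^ M) (poly_op (r * P) v) = poly_op (r * (P * [:- a, 1:] ^ M)) v"
    by (simp only: poly_op_mult[symmetric] ac_simps)
  also have "\<dots> = 0" using P by simp
  finally have 1: "poly_op (r * P) v \<in> span (?G (insert a S))"
    by (intro span_base) blast
  have "poly_op P (poly_op ([:- a, 1:] ^ M * h) v) = poly_op (h * (P * [:- a, 1:] ^ M)) v"
    by (simp only: poly_op_mult[symmetric] ac_simps)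
  also have "\<dots> = 0" using P by simp
  finally have "poly_op ([:- a, 1:] ^ M * h) v \<in> span (?G S)"
    by (intro insert.IH) (simp add: P_def)
  then have 2: "poly_op ([:- a, 1:] ^ M * h) v \<in> span (?G (insert a S))"
    by (rule set_mp[OF span_mono, rotated]) blast
  have "v = poly_op (r * P + [:- a, 1:] ^ M * h) v"
    unfolding r[symmetric] by simp
  then have "v = poly_op (r * P) v + poly_op ([:- a, 1:] ^ M * h) v"
    by (simp only: poly_op_add)
  then show ?case using span_add[OF 1 2] by simp
qed

end

section \<open>Trace and triangular bases\<close>

context finite_dimensional_vector_space
begin

definition trace :: "('b \<Rightarrow> 'b) \<Rightarrow> 'a" where
  "trace T = (\<Sum>b\<in>Basis. representation Basis (T b) b)"

lemma sum_representation_finite: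
  assumes "finite B" "independent B" "span B = UNIV"
  shows "(\<Sum>b\<in>B. scale (representation B v b) b) = v"
  using sum_representation_eq[OF assms(2) _ assms(1), of v] assms(3) by simp

lemma linear_representation_coord:
  assumes "independent B" "span B = UNIV"
  shows "Vector_Spaces.linear scale (*) (\<lambda>v. representation B v b)"
proof -
  interpret f: vector_space "(*) :: 'a \<Rightarrow> 'a \<Rightarrow> 'a"
    by unfold_locales (simp_all add: algebra_simps)
  show ?thesis
    unfolding Vector_Spaces.linear_iff
    using assms by (auto simp: representation_add representation_scale vector_space_axioms
        f.vector_space_axioms)
qed

lemma representation_linear_sum:
  assumes "independent B" "span B = UNIV" "Vector_Spaces.linear scale scale T"
  shows "representation B (T (\<Sum>c\<in>C. scale (f c) c)) b = (\<Sum>c\<in>C. f c * representation B (T c) b)"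
proof -
  interpret T: Vector_Spaces.linear scale scale T by fact
  interpret r: Vector_Spaces.linear scale "(*)" "\<lambda>v. representation B v b"
    by (rule linear_representation_coord) fact+
  show ?thesis by (simp add: T.sum T.scale r.sum r.scale)
qed

lemma trace_basis:
  assumes B: "finite B" "independent B" "span B = UNIV"
    and T: "Vector_Spaces.linear scale scale T"
  shows "trace T = (\<Sum>b\<in>B. representation B (T b) b)"
proof -
  let ?r = "representation"
  interpret T: Vector_Spaces.linear scale scale T by (rule T)
  have "trace T = (\<Sum>c\<in>Basis. ?r Basis (T (\<Sum>b\<in>B. scale (?r B c b) b)) c)"
    by (simp add: trace_def sum_representation_finite[OF B])
  also have "\<dots> = (\<Sum>c\<in>Basis. \<Sum>b\<in>B. ?r B c b * ?r Basis (T b) c)"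
    by (simp add: representation_linear_sum[OF independent_Basis span_Basis T])
  also have "\<dots> = (\<Sum>b\<in>B. \<Sum>c\<in>Basis. ?r Basis (T b) c * ?r B c b)"
    by (subst sum.swap) (simp add: mult.commute)
  also have "\<dots> = (\<Sum>b\<in>B. ?r B (\<Sum>c\<in>Basis. scale (?r Basis (T b) c) c) b)"
    using representation_linear_sum[OF B(2,3) linear_id]
    by (simp add: id_def)
  also have "\<dots> = (\<Sum>b\<in>B. ?r B (T b) b)"
    by (simp add: sum_representation_finite[OF finite_Basis independent_Basis span_Basis])
  finally show ?thesis .
qed

lemma trace_comp_commute:
  assumes S: "Vector_Spaces.linear scale scale S" and T: "Vector_Spaces.linear scale scale T"
  shows "trace (\<lambda>v. S (T v)) = trace (\<lambda>v. T (S v))"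
proof -
  let ?r = "representation Basis"
  have *: "trace (\<lambda>v. S (T v)) = (\<Sum>b\<in>Basis. \<Sum>c\<in>Basis. ?r (T b) c * ?r (S c) b)"
    if S: "Vector_Spaces.linear scale scale S" for S T
  proof -
    have "?r (S (T b)) b = (\<Sum>c\<in>Basis. ?r (T b) c * ?r (S c) b)" for b
      using representation_linear_sum[OF independent_Basis span_Basis S, of "?r (T b)" Basis b]
      by (simp add: sum_representation_finite[OF finite_Basis independent_Basis span_Basis])
    then show ?thesis by (simp add: trace_def)
  qed
  show ?thesis
    unfolding *[OF S, of T] *[OF T, of S] by (subst sum.swap) (simp add: mult.commute)
qed

lemma trace_add: "trace (\<lambda>v. S v + T v) = trace S + trace T"
  by (simp add: trace_def representation_add independent_Basis span_Basis sum.distrib)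

lemma trace_diff: "trace (\<lambda>v. S v - T v) = trace S - trace T"
  by (simp add: trace_def representation_diff independent_Basis span_Basis sum_subtractf)

lemma trace_scale: "trace (\<lambda>v. scale c (S v)) = c * trace S"
  by (simp add: trace_def representation_scale independent_Basis span_Basis sum_distrib_left)

end

text \<open>Extend a to a basis of the field over the rationals and take the coordinate at a. The
  field carries no order; composing eigenvalues with such a functional makes positivity of squares
  available.\<close>

lemma rational_functional:
  fixes a :: "'a::field_char_0"
  assumes "a \<noteq> 0"
  shows "\<exists>f :: 'a \<Rightarrow> rat. (\<forall>x y. f (x + y) = f x + f y) \<and> (\<forall>r x. f (of_rat r * x) = r * f x) \<and> f a = 1"
proof -
  interpret V: vector_space "\<lambda>r (x::'a). of_rat r * x"
    by unfold_locales (simp_all add: algebra_simps of_rat_add of_rat_mult)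
  interpret P: vector_space_pair "\<lambda>r (x::'a). of_rat r * x" "(*) :: rat \<Rightarrow> rat \<Rightarrow> rat"
    by unfold_locales (simp_all add: algebra_simps)
  have "V.independent {a}" using assms by simp
  from P.linear_independent_extend[OF this, of "\<lambda>_. 1"]
  obtain g where g: "Vector_Spaces.linear (\<lambda>r x. of_rat r * x) (*) g" "g a = 1" by auto
  interpret g: Vector_Spaces.linear "\<lambda>r (x::'a). of_rat r * x" "(*) :: rat \<Rightarrow> rat \<Rightarrow> rat" g
    by (rule g)
  show ?thesis using g(2) g.add g.scale by blast
qed

section \<open>Triangular form and trace over an algebraically closed field\<close>

locale closed_field_operator = finite_dimensional_vector_space scale Basis + linear_operator scale A
  for scale :: "'a::{alg_closed_field, field_char_0} \<Rightarrow> 'b::ab_group_add \<Rightarrow> 'b" (infixr "*s" 75)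
    and Basis A
begin

lemma poly_op_monom: "poly_op (monom c n) v = c *s (A ^^ n) v"
  by (induction n) (simp_all add: monom_0 monom_Suc A.scale)

lemma poly_op_sum: "poly_op (sum p S) v = (\<Sum>x\<in>S. poly_op (p x) v)"
  by (induction S rule: infinite_finite_induct) simp_all

text \<open>Either two iterates of w coincide, which gives X^i - X^j, or they form an infinite set,
  which is dependent in finite dimension. The cases are separate because dependence is a property of
  sets, not of families.\<close>

lemma annihilating_poly: "\<exists>p. p \<noteq> 0 \<and> poly_op p w = 0"
proof -
  define f where "f n = (A ^^ n) w" for n
  show ?thesis
  proof (cases "inj f")
    case False
    then obtain i j where ij: "i \<noteq> j" "f i = f j" by (auto simp: inj_def)
    have "coeff (monom 1 i - monom (1::'a) j) i \<noteq> 0" using ij by simp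
    then have "monom 1 i - monom (1::'a) j \<noteq> 0" by (metis coeff_0)
    moreover have "poly_op (monom 1 i - monom 1 j) w = 0"
      using ij by (simp add: poly_op_monom f_def)
    ultimately show ?thesis by blast
  next
    case True
    then have "infinite (range f)" by (simp add: finite_image_iff)
    then have "dependent (range f)" using finiteI_independent by blast
    then obtain t u v where t: "finite t" "t \<subseteq> range f" "v \<in> t" "u v \<noteq> 0" "(\<Sum>v\<in>t. u v *s v) = 0"
      unfolding dependent_explicit by blast
    define S where "S = f -` t"
    have S: "finite S" "f ` S = t"
      unfolding S_def using t(1,2) True by (auto intro: finite_vimageI)
    define p where "p = (\<Sum>n\<in>S. monom (u (f n)) n)"
    obtain m where m: "f m = v" "m \<in> S" using S t by (metis imageE)
    have "coeff p m = (\<Sum>n\<in>S. if n = m then u (f n) else 0)" by (simp add: p_def coeff_sum)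
    also have "\<dots> = u v" using m S by simp
    finally have "p \<noteq> 0" using t(4) by auto
    moreover have "poly_op p w = (\<Sum>n\<in>S. u (f n) *s f n)"
      by (simp add: p_def poly_op_sum poly_op_monom f_def)
    moreover have "\<dots> = (\<Sum>v\<in>f ` S. u v *s v)"
      using True by (subst sum.reindex) (auto intro: inj_on_subset)
    ultimately show ?thesis using t(5) S(2) by auto
  qed
qed

text \<open>A flag grown at the head of the list: the tail spans an invariant subspace and the new
  vector is an eigenvector modulo it. The second list is the diagonal, with repetitions.\<close>

inductive triangular :: "'b list \<Rightarrow> 'a list \<Rightarrow> bool" where
  Nil: "triangular [] []"
| Cons: "triangular bs as \<Longrightarrow> b \<notin> span (set bs) \<Longrightarrow> A b - a *s b \<in> span (set bs)
    \<Longrightarrow> triangular (b # bs) (a # as)"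

lemma triangular_independent: "triangular bs as \<Longrightarrow> independent (set bs) \<and> distinct bs"
proof (induction rule: triangular.induct)
  case Nil
  show ?case using independent_empty by simp
next
  case (Cons bs as b a)
  then show ?case using independent_insertI[of b "set bs"] span_base[of b "set bs"] by auto
qed

text \<open>The factor of the head maps the span into the span of the tail, so the product over the
  diagonal descends the flag to zero, as in the Cayley-Hamilton theorem.\<close>

lemma triangular_annihilates:
  "triangular bs as \<Longrightarrow> v \<in> span (set bs) \<Longrightarrow>
     A v \<in> span (set bs) \<and> poly_op (\<Prod>a\<leftarrow>as. [:- a, 1:]) v = 0"
proof (induction arbitrary: v rule: triangular.induct)
  case Nil
  then show ?case by simp
next
  case (Cons bs as b a)
  obtain k where k: "v - k *s b \<in> span (set bs)"
    using Cons.prems by (auto simp: span_breakdown_eq)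
  have "A v - a *s v = (A (v - k *s b) - a *s (v - k *s b)) + k *s (A b - a *s b)"
    by (simp add: A.diff A.scale scale_right_diff_distrib scale_left_commute)
  also have "\<dots> \<in> span (set bs)"
    by (rule span_add[OF span_diff[OF _ span_scale[OF k]] span_scale[OF Cons.hyps(3)]])
      (simp add: Cons.IH[OF k])
  finally have 1: "A v - a *s v \<in> span (set bs)" .
  have "A v = (A v - a *s v) + a *s v" by simp
  also have "\<dots> \<in> span (set (b # bs))"
    using 1 Cons.prems span_mono[of "set bs" "set (b # bs)"]
    by (intro span_add[OF _ span_scale]) auto
  finally have "A v \<in> span (set (b # bs))" .
  moreover have "poly_op (\<Prod>a\<leftarrow>a # as. [:- a, 1:]) v
      = poly_op ((\<Prod>a\<leftarrow>as. [:- a, 1:]) * [:- a, 1:]) v"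
    by (simp only: list.map prod_list.Cons mult.commute)
  moreover have "\<dots> = poly_op (\<Prod>a\<leftarrow>as. [:- a, 1:]) (A v - a *s v)"
    by (simp only: poly_op_mult poly_op_monic_linear)
  ultimately show ?case using Cons.IH[OF 1] by simp
qed

text \<open>Among the nonzero polynomials p with p(A) w in the span take one of least degree. It has
  a root a, the field being closed; dividing by X - a yields a vector outside the span which A - a
  sends into it.\<close>

lemma triangular_extend:
  assumes "triangular bs as" "span (set bs) \<noteq> UNIV"
  shows "\<exists>b a. triangular (b # bs) (a # as)"
proof -
  obtain w where w: "w \<notin> span (set bs)" using assms(2) by auto
  let ?P = "\<lambda>p. p \<noteq> 0 \<and> poly_op p w \<in> span (set bs)"
  obtain p0 where "?P p0" using annihilating_poly[of w] by (metis span_zero)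
  then obtain p where p: "?P p" and min: "\<And>q. ?P q \<Longrightarrow> degree p \<le> degree q"
    using ex_has_least_nat[of ?P p0 degree] by blast
  have "degree p > 0"
  proof (rule ccontr)
    assume "\<not> degree p > 0"
    then obtain c where c: "p = [:c:]" by (auto elim: degree_eq_zeroE)
    then have "c \<noteq> 0" "c *s w \<in> span (set bs)" using p by auto
    then show False using w span_scale[of "c *s w" _ "inverse c"] by simp
  qed
  then obtain a where "poly p a = 0" using alg_closed_imp_poly_has_root by blast
  then obtain q where q: "p = [:- a, 1:] * q" by (metis poly_eq_0_iff_dvd dvdE)
  then have "q \<noteq> 0" using p by auto
  then have "degree p = Suc (degree q)" unfolding q by (subst degree_mult_eq) auto
  then have "poly_op q w \<notin> span (set bs)" using min[of q] \<open>q \<noteq> 0\<close> by auto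
  moreover have "A (poly_op q w) - a *s poly_op q w \<in> span (set bs)"
    using p unfolding q by (simp only: poly_op_mult poly_op_monic_linear)
  ultimately show ?thesis using Cons[OF assms(1)] by blast
qed

lemma triangular_exists: "\<exists>bs as. triangular bs as \<and> span (set bs) = UNIV"
proof (rule ccontr)
  assume no: "\<not> ?thesis"
  have "\<exists>bs as. triangular bs as \<and> length bs = n" for n
  proof (induction n)
    case 0
    show ?case using Nil by force
  next
    case (Suc n)
    then obtain bs as where "triangular bs as" "length bs = n" by blast
    with triangular_extend[of bs as] no show ?case by (metis length_Cons)
  qed
  then obtain bs as where bs: "triangular bs as" "length bs = Suc (card Basis)" by blast
  then have "card (set bs) = Suc (card Basis)" "independent (set bs)"
    using triangular_independent[of bs as] by (auto simp: distinct_card)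
  then show False
    using independent_card_le_dim[of "set bs" UNIV] by simp
qed

text \<open>Modulo the tail, A multiplies the head vector by a, hence q(A) multiplies it by q(a),
  which is the diagonal entry.\<close>

lemma trace_poly_op:
  assumes "triangular bs as" "span (set bs) = UNIV"
  shows "trace (poly_op q) = (\<Sum>a\<leftarrow>as. poly q a)"
proof -
  \<comment> \<open>The ambient basis \<open>B\<close> stays fixed while the list shrinks, so that
    the induction keeps computing coordinates in the full basis.\<close>
  have "(\<Sum>b\<in>set bs. representation B (poly_op q b) b) = (\<Sum>a\<leftarrow>as. poly q a)"
    if "triangular bs as" "independent B" "set bs \<subseteq> B" for B bs as
    using that
  proof (induction rule: triangular.induct)
    case Nil
    then show ?case by simp
  next
    case (Cons bs as b a)
    have bB: "b \<in> B" "b \<notin> set bs" using Cons span_base by auto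
    have "poly_op q b - poly q a *s b \<in> span (set bs)"
    proof (induction q)
      case 0
      then show ?case by (simp add: span_zero)
    next
      case (pCons c q)
      have "poly_op (pCons c q) b - poly (pCons c q) a *s b
          = A (poly_op q b - poly q a *s b) + poly q a *s (A b - a *s b)"
        by (simp add: A.diff A.scale scale_left_distrib scale_right_diff_distrib mult.commute)
      then show ?case
        using triangular_annihilates[OF Cons.hyps(1) pCons.IH]
          span_add[OF _ span_scale[OF Cons.hyps(3)]]
        by (simp only:)
    qed
    moreover have "representation B v b = 0" if "v \<in> span (set bs)" for v
      using representation_extend[OF Cons.prems(1) that] Cons.prems(2) bB
        representation_ne_zero[of "set bs" v b] by auto
    ultimately have "representation B (poly_op q b - poly q a *s b) b = 0" by blast
    moreover have "set bs \<subseteq> span B" using Cons.prems(2) span_superset[of B] by auto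
    moreover have "b \<in> span B" using bB by (simp add: span_base)
    moreover have "poly_op q b \<in> span B"
    proof -
      have "poly_op q b = (poly_op q b - poly q a *s b) + poly q a *s b" by simp
      moreover have "poly_op q b - poly q a *s b \<in> span B"
        using \<open>poly_op q b - poly q a *s b \<in> span (set bs)\<close> span_mono[of "set bs" B] Cons.prems(2)
        by auto
      ultimately show ?thesis by (metis span_add span_scale \<open>b \<in> span B\<close>)
    qed
    ultimately have "representation B (poly_op q b) b = poly q a"
      using Cons.prems(1) bB
      by (simp add: representation_diff representation_scale span_scale representation_basis)
    then show ?case using Cons bB by simp
  qed
  from this[OF assms(1), of "set bs"] show ?thesis
    using triangular_independent[OF assms(1)] assms(2)
    by (simp add: trace_basis[of "set bs" "poly_op q"] linear_poly_op)
qed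

text \<open>An operator \<open>A\<close> which is a derivation of a bilinear product acts on the product of generalized
  eigenvectors for \<open>a\<close> and \<open>b\<close> with the generalized eigenvalue \<open>a + b\<close>. So for additive \<open>f\<close> the
  operator acting by \<open>f a\<close> on the generalized eigenspace for \<open>a\<close> is a derivation as well.\<close>
lemma nilpotent_if_trace_derivation_zero:
  fixes prd :: "'b \<Rightarrow> 'b \<Rightarrow> 'b"
  assumes left: "\<And>y. Vector_Spaces.linear scale scale (\<lambda>x. prd x y)"
    and right: "\<And>x. Vector_Spaces.linear scale scale (prd x)"
    and der: "\<And>x y. A (prd x y) = prd (A x) y + prd x (A y)"
    and tr: "\<And>d. Vector_Spaces.linear scale scale d \<Longrightarrow>
      (\<And>x y. d (prd x y) = prd (d x) y + prd x (d y)) \<Longrightarrow> trace (\<lambda>v. A (d v)) = 0"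
  shows "\<exists>n. \<forall>v. (A ^^ n) v = 0"
proof -
  interpret l: Vector_Spaces.linear scale scale "\<lambda>x. prd x y" for y by (rule left)
  interpret r: Vector_Spaces.linear scale scale "prd x" for x by (rule right)
  \<comment> \<open>A - (a + b) on a product is A - a on the left factor plus A - b on the right
    one; both terms have a smaller m + n.\<close>
  have gen: "poly_op ([:- (a + b), 1:] ^ (m + n)) (prd u v) = 0"
    if "poly_op ([:- a, 1:] ^ m) u = 0" "poly_op ([:- b, 1:] ^ n) v = 0" for a b m n u v
    using that
  proof (induction "m + n" arbitrary: m n u v)
    case 0
    then show ?case by (simp add: l.zero)
  next
    case (Suc l)
    show ?case
    proof (cases "m = 0 \<or> n = 0")
      case True
      then have "prd u v = 0" using Suc.prems by (auto simp: l.zero r.zero)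
      then show ?thesis by simp
    next
      case False
      then obtain m' n' where mn: "m = Suc m'" "n = Suc n'" by (metis not0_implies_Suc)
      let ?u = "A u - a *s u" and ?v = "A v - b *s v"
      have u: "poly_op ([:- a, 1:] ^ m') ?u = 0"
        using Suc.prems(1) unfolding mn power_Suc2 poly_op_mult poly_op_monic_linear .
      have v: "poly_op ([:- b, 1:] ^ n') ?v = 0"
        using Suc.prems(2) unfolding mn power_Suc2 poly_op_mult poly_op_monic_linear .
      have "A (prd u v) - (a + b) *s prd u v = prd ?u v + prd u ?v"
        by (simp add: der l.diff r.diff l.scale r.scale scale_left_distrib)
      moreover have "poly_op ([:- (a + b), 1:] ^ (m' + n)) (prd ?u v) = 0"
        using Suc.hyps(2) mn by (intro Suc.hyps(1) u Suc.prems(2)) simp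
      moreover have "poly_op ([:- (a + b), 1:] ^ (m + n')) (prd u ?v) = 0"
        using Suc.hyps(2) mn by (intro Suc.hyps(1) v Suc.prems(1)) simp
      moreover have "m + n = Suc (m' + n)" "m' + n = m + n'" using mn by auto
      ultimately show ?thesis
        by (simp only: power_Suc2 poly_op_mult poly_op_monic_linear
            Vector_Spaces.linear.axioms(3)[OF linear_poly_op, THEN module_hom.add] add_0)
    qed
  qed
  obtain bs as where T: "triangular bs as" and span: "span (set bs) = UNIV"
    using triangular_exists by blast
  \<comment> \<open>No eigenvalue occurs more than \<open>length as\<close> times; the extra one
    makes the exponent positive, so that X - c divides its power further down.\<close>
  define M where "M = Suc (length as)"
  have count: "(\<Prod>a\<leftarrow>as. [:- a, 1:]) dvd (\<Prod>a\<in>set as. [:- a, 1:] ^ M)"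
  proof -
    have "(\<Prod>a\<leftarrow>as'. [:- a, 1:]) dvd (\<Prod>a\<in>set as. [:- a, 1:] ^ length as')"
      if "set as' \<subseteq> set as" for as'
      using that
    proof (induction as')
      case (Cons a as')
      have "[:- a, 1:] dvd (\<Prod>a\<in>set as. [:- a, 1:])"
        using Cons.prems by (intro dvd_prodI) auto
      moreover have "(\<Prod>a\<in>set as. [:- a, 1:] ^ Suc (length as'))
          = (\<Prod>a\<in>set as. [:- a, 1:]) * (\<Prod>a\<in>set as. [:- a, 1:] ^ length as')"
        by (simp only: power_Suc prod.distrib)
      moreover have "(\<Prod>a\<leftarrow>as'. [:- a, 1:]) dvd (\<Prod>a\<in>set as. [:- a, 1:] ^ length as')"
        using Cons by simp
      ultimately show ?case unfolding list.map prod_list.Cons length_Cons by (simp only: mult_dvd_mono)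
    qed simp
    from this[of as] have "(\<Prod>a\<leftarrow>as. [:- a, 1:]) dvd (\<Prod>a\<in>set as. [:- a, 1:] ^ length as)" by simp
    also have "\<dots> dvd (\<Prod>a\<in>set as. [:- a, 1:] ^ M)"
      unfolding M_def by (rule prod_dvd_prod) (intro le_imp_power_dvd, simp)
    finally show ?thesis .
  qed
  define G where "G = {w. \<exists>a\<in>set as. poly_op ([:- a, 1:] ^ M) w = 0}"
  have G: "span G = UNIV"
  proof -
    have "v \<in> span G" for v
      unfolding G_def
    proof (rule in_span_generalized_eigenvectors)
      show "poly_op (\<Prod>a\<in>set as. [:- a, 1:] ^ M) v = 0"
        by (rule poly_op_dvd[OF count]) (use triangular_annihilates[OF T, of v] span in simp)
    qed simp
    then show ?thesis by auto
  qed
  have zero: "a = 0" if "a \<in> set as" for a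
  proof (rule ccontr)
    assume "a \<noteq> 0"
    then obtain f :: "'a \<Rightarrow> rat" where f: "\<And>x y. f (x + y) = f x + f y"
      "\<And>r x. f (of_rat r * x) = r * f x" "f a = 1"
      using rational_functional[of a] by blast
    \<comment> \<open>Sums are included because a product of generalized eigenvectors belongs to the
      sum of their eigenvalues, with exponent \<open>M + M\<close>; that sum need not be an
      eigenvalue itself.\<close>
    define \<Gamma> where "\<Gamma> = set as \<union> (\<lambda>(a, b). a + b) ` (set as \<times> set as)"
    have "finite \<Gamma>" by (simp add: \<Gamma>_def)
    then obtain q where q: "\<And>c. c \<in> \<Gamma> \<Longrightarrow> [:- c, 1:] ^ (M + M) dvd q - [:of_rat (f c):]"
      using interpolation[of \<Gamma> "M + M" "\<lambda>c. of_rat (f c)"] by blast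
    have act: "poly_op q v = of_rat (f c) *s v"
      if "c \<in> \<Gamma>" "poly_op ([:- c, 1:] ^ (M + M)) v = 0" for c v
      using poly_op_dvd[OF q[OF that(1)] that(2)] by simp
    have act': "poly_op q v = of_rat (f c) *s v"
      if "c \<in> set as" "poly_op ([:- c, 1:] ^ M) v = 0" for c v
      using that by (intro act) (auto simp: \<Gamma>_def power_add)
    \<comment> \<open>The failure of q(A) to be a derivation. It vanishes on generalized
      eigenvectors, as f is additive on the eigenvalues, and these span.\<close>
    define E where "E x y = poly_op q (prd x y) - (prd (poly_op q x) y + prd x (poly_op q y))" for x y
    interpret q: Vector_Spaces.linear scale scale "poly_op q" by (rule linear_poly_op)
    have E0: "E u v = 0" if uv: "u \<in> G" "v \<in> G" for u v
    proof -
      obtain a b where ab: "a \<in> set as" "b \<in> set as" "poly_op ([:- a, 1:] ^ M) u = 0"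
        "poly_op ([:- b, 1:] ^ M) v = 0"
        using uv by (auto simp: G_def)
      have "poly_op q (prd u v) = of_rat (f (a + b)) *s prd u v"
        by (rule act[OF _ gen]) (use ab in \<open>auto simp: \<Gamma>_def\<close>)
      then show ?thesis
        using act'[OF ab(1,3)] act'[OF ab(2,4)]
        by (simp add: E_def f(1) l.scale r.scale of_rat_add scale_left_distrib)
    qed
    have E1: "E u v = 0" if "v \<in> G" for u v
    proof -
      have "subspace {u. E u v = 0}"
        by (rule subspaceI) (auto simp: E_def l.zero r.zero q.zero l.add r.add q.add l.scale r.scale q.scale
            simp flip: scale_right_distrib scale_right_diff_distrib)
      then have "span G \<subseteq> {u. E u v = 0}" using E0[OF _ that] by (intro span_minimal) auto
      then show ?thesis using G by auto
    qed
    have E2: "E u v = 0" for u v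
    proof -
      have "subspace {v. E u v = 0}"
        by (rule subspaceI) (auto simp: E_def l.zero r.zero q.zero l.add r.add q.add l.scale r.scale q.scale
            simp flip: scale_right_distrib scale_right_diff_distrib)
      then have "span G \<subseteq> {v. E u v = 0}" using E1 by (intro span_minimal) auto
      then show ?thesis using G by auto
    qed
    have "trace (\<lambda>v. A (poly_op q v)) = 0"
      by (rule tr[OF linear_poly_op]) (use E2 in \<open>simp add: E_def\<close>)
    moreover have "(\<lambda>v. A (poly_op q v)) = poly_op (pCons 0 q)" by auto
    ultimately have "(\<Sum>a\<leftarrow>as. a * poly q a) = 0"
      using trace_poly_op[OF T span, of "pCons 0 q"] by simp
    moreover have "poly q c = of_rat (f c)" if "c \<in> set as" for c
    proof -
      have "[:- c, 1:] dvd [:- c, 1:] ^ (M + M)" by (rule dvd_power) (simp add: M_def)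
      then have "[:- c, 1:] dvd q - [:of_rat (f c):]" using q[of c] that by (auto simp: \<Gamma>_def)
      then have "poly (q - [:of_rat (f c):]) c = 0" by (simp only: poly_eq_0_iff_dvd)
      then show ?thesis by simp
    qed
    ultimately have "(\<Sum>a\<leftarrow>as. of_rat (f a) * a) = 0"
      by (simp add: mult.commute cong: map_cong)
    \<comment> \<open>Such sums are sent by f to sums of squares of rationals. For the whole list
      the value is f 0 = 0, so each f a vanishes, against f a = 1.\<close>
    moreover have "f (\<Sum>a\<leftarrow>as'. of_rat (f a) * a) = (\<Sum>a\<leftarrow>as'. f a * f a)" for as'
      using f(1)[of 0 0] by (induction as') (simp_all add: f)
    ultimately have "(\<Sum>a\<leftarrow>as. f a * f a) = 0"
      using f(1)[of 0 0] by (metis add_cancel_right_right)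
    then have "f a * f a = 0"
      using that by (subst (asm) sum_list_nonneg_eq_0_iff) auto
    then show False using f(3) by simp
  qed
  have "(A ^^ length as) v = 0" for v
  proof -
    have "(\<Prod>a\<leftarrow>as. [:- a, 1:]) = monom 1 (length as)"
      using zero by (induction as) (simp_all add: monom_Suc)
    then show ?thesis
      using triangular_annihilates[OF T, of v] span by (simp add: poly_op_monom)
  qed
  then show ?thesis by blast
qed

end

section \<open>Lie algebras of finite dimension\<close>

context lie_algebra
begin

sublocale lie_l: Vector_Spaces.linear scale scale "\<lambda>x. lie x y" for y by (rule lie_linear_left)
sublocale lie_r: Vector_Spaces.linear scale scale "lie x" for x by (rule lie_linear_right)

lemma lie_skew: "lie x y = - lie y x"
proof -
  have "lie x x + lie x y + (lie y x + lie y y) = 0"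
    using lie_self[of "x + y"] unfolding lie_l.add lie_r.add by (simp only: ac_simps)
  then show ?thesis by (simp add: lie_self eq_neg_iff_add_eq_0)
qed

lemma lie_derivation: "lie x (lie y z) = lie (lie x y) z + lie y (lie x z)"
  using lie_jacobi[of x y z] lie_skew[of z "lie x y"] lie_skew[of z x]
  by (simp add: lie_r.neg eq_neg_iff_add_eq_0 algebra_simps)

definition perfect :: bool where
  "perfect \<longleftrightarrow> span {lie x y | x y. True} = UNIV"

end

text \<open>The basis is an injective family over a finite type instead of a set: its index type
  also names the variables of the differential polynomials, and sums run over all indices.\<close>

locale based_lie_algebra = lie_algebra scale lie
  for scale :: "'f::field_char_0 \<Rightarrow> 'g::ab_group_add \<Rightarrow> 'g" (infixr "*s" 75)
    and lie :: "'g \<Rightarrow> 'g \<Rightarrow> 'g" +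
  fixes e :: "'i::finite \<Rightarrow> 'g"
  assumes inj_e: "inj e"
    and fd: "finite_dimensional_vector_space scale (range e)"
begin

sublocale finite_dimensional_vector_space scale "range e" by (rule fd)

definition coord :: "'g \<Rightarrow> 'i \<Rightarrow> 'f" where
  "coord x i = representation (range e) x (e i)"

lemma coord_add: "coord (x + y) i = coord x i + coord y i"
  and coord_scale: "coord (c *s x) i = c * coord x i"
  and coord_zero [simp]: "coord 0 i = 0"
  by (simp_all add: coord_def representation_add representation_scale representation_zero
      independent_Basis span_Basis)

lemma coord_sum: "coord (sum f S) i = (\<Sum>x\<in>S. coord (f x) i)"
  by (induction S rule: infinite_finite_induct) (simp_all add: coord_add)

lemma coord_expand: "(\<Sum>i\<in>UNIV. coord x i *s e i) = x"
  using sum_representation_finite[OF finite_Basis independent_Basis span_Basis, of x]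
  by (simp add: coord_def sum.reindex inj_e)

lemma coord_e: "coord (e j) i = (if i = j then 1 else 0)"
  using inj_e by (auto simp: coord_def representation_basis independent_Basis inj_eq)

lemma coord_eqI: "(\<And>i. coord x i = coord y i) \<Longrightarrow> x = y"
  by (metis (no_types, lifting) coord_expand sum.cong)

lemma linear_expand:
  assumes "Vector_Spaces.linear scale scale T"
  shows "T x = (\<Sum>i\<in>UNIV. coord x i *s T (e i))"
proof -
  interpret T: Vector_Spaces.linear scale scale T by fact
  show ?thesis by (subst coord_expand[symmetric]) (simp add: T.sum T.scale)
qed

lemma trace_coord: "trace T = (\<Sum>i\<in>UNIV. coord (T (e i)) i)"
  by (simp add: trace_def coord_def sum.reindex inj_e)

end

section \<open>Extension of scalars in coordinates; algebras with vanishing Killing form\<close>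

definition vscale :: "'a::field \<Rightarrow> ('i \<Rightarrow> 'a) \<Rightarrow> 'i \<Rightarrow> 'a" where
  "vscale c v = (\<lambda>i. c * v i)"

definition unit_fun :: "'i \<Rightarrow> 'i \<Rightarrow> 'a::field" where
  "unit_fun i = (\<lambda>j. if i = j then 1 else 0)"

lemma inj_unit_fun: "inj (unit_fun :: 'i \<Rightarrow> 'i \<Rightarrow> 'a::field)"
  by (rule injI) (metis unit_fun_def zero_neq_one)

lemma sum_unit_fun: "(\<Sum>i\<in>UNIV. vscale (v i) (unit_fun i)) = (v :: 'i::finite \<Rightarrow> 'a::field)"
proof
  fix j
  have "(\<Sum>i\<in>S. vscale (v i) (unit_fun i)) j = (\<Sum>i\<in>S. vscale (v i) (unit_fun i) j)" for S
    by (induction S rule: infinite_finite_induct) simp_all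
  also have "(\<Sum>i\<in>UNIV. vscale (v i) (unit_fun i) j) = v j"
    by (simp add: vscale_def unit_fun_def if_distrib cong: if_cong)
  finally show "(\<Sum>i\<in>UNIV. vscale (v i) (unit_fun i)) j = v j" .
qed

lemma finite_dimensional_fun:
  "finite_dimensional_vector_space (vscale :: 'a::field \<Rightarrow> _) (range (unit_fun :: 'i::finite \<Rightarrow> _))"
proof -
  interpret V: vector_space "vscale :: 'a \<Rightarrow> ('i \<Rightarrow> 'a) \<Rightarrow> _"
    by unfold_locales (auto simp: vscale_def fun_eq_iff algebra_simps)
  show ?thesis
  proof unfold_locales
    show "V.independent (range (unit_fun :: 'i \<Rightarrow> _))"
    proof (rule V.independent_if_scalars_zero)
      fix f :: "('i \<Rightarrow> 'a) \<Rightarrow> 'a" and x :: "'i \<Rightarrow> 'a"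
      assume "(\<Sum>x\<in>range unit_fun. vscale (f x) x) = 0" and x: "x \<in> range unit_fun"
      then have "(\<Sum>i\<in>UNIV. vscale (f (unit_fun i)) (unit_fun i)) = (0 :: 'i \<Rightarrow> 'a)"
        by (simp add: sum.reindex inj_unit_fun)
      then have "f (unit_fun i) = 0" for i
        using sum_unit_fun[of "\<lambda>i. f (unit_fun i)"] by (metis zero_fun_apply)
      then show "f x = 0" using x by auto
    qed simp
    have "v \<in> V.span (range unit_fun)" for v :: "'i \<Rightarrow> 'a"
      by (subst sum_unit_fun[symmetric]) (intro V.span_sum V.span_scale V.span_base, simp)
    then show "V.span (range (unit_fun :: 'i \<Rightarrow> _)) = UNIV" by auto
  qed simp
qed

context based_lie_algebra
begin

text \<open>The bracket is transported to coordinate vectors over the algebraic closure, with the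
  same structure constants. By the nilpotency criterion it remains to see that tr(ad x d) = 0 for
  all derivations d of the extended bracket; as brackets span the algebra, x may be taken to be
  [y, z].\<close>

lemma ad_nilpotent_if_killing_zero:
  assumes perf: "perfect" and killing: "\<And>x y. trace (\<lambda>v. lie x (lie y v)) = 0"
  shows "\<exists>n. \<forall>v. (lie x ^^ n) v = 0"
proof -
  interpret L: finite_dimensional_vector_space
    "vscale :: 'f alg_closure \<Rightarrow> ('i \<Rightarrow> 'f alg_closure) \<Rightarrow> _" "range unit_fun"
    by (rule finite_dimensional_fun)
  have repr: "L.representation (range unit_fun) v (unit_fun i) = v i" for v i
  proof -
    have "(\<Sum>b\<in>range unit_fun. vscale (L.representation (range unit_fun) v b) b) = v"
      by (rule L.sum_representation_finite[OF L.finite_Basis L.independent_Basis L.span_Basis])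
    then have "(\<Sum>i\<in>UNIV. vscale (L.representation (range unit_fun) v (unit_fun i)) (unit_fun i)) = v"
      by (simp add: sum.reindex inj_unit_fun)
    then show ?thesis
      using sum_unit_fun[of "\<lambda>i. L.representation (range unit_fun) v (unit_fun i)"] by metis
  qed
  have traceL: "L.trace T = (\<Sum>i\<in>UNIV. T (unit_fun i) i)" for T
    by (simp add: L.trace_def sum.reindex inj_unit_fun repr)
  define emb :: "'g \<Rightarrow> 'i \<Rightarrow> 'f alg_closure" where "emb x = (\<lambda>i. to_ac (coord x i))" for x
  define brL where "brL v w = (\<lambda>l. \<Sum>i\<in>UNIV. \<Sum>j\<in>UNIV. to_ac (coord (lie (e i) (e j)) l) * v i * w j)"
    for v w :: "'i \<Rightarrow> 'f alg_closure"
  have emb_add: "emb (x + y) = emb x + emb y" for x y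
    by (simp add: emb_def coord_add plus_fun_def)
  have emb_scale: "emb (c *s x) = vscale (to_ac c) (emb x)" for c x
    by (simp add: emb_def coord_scale vscale_def)
  have emb_eq_0: "x = 0" if "emb x = 0" for x
    using that by (intro coord_eqI) (simp add: emb_def fun_eq_iff)
  have emb_e: "emb (e i) = unit_fun i" for i
    by (auto simp: emb_def coord_e unit_fun_def fun_eq_iff)
  have emb_lie: "brL (emb x) (emb y) = emb (lie x y)" for x y
  proof
    fix l
    have "lie x y = (\<Sum>i\<in>UNIV. \<Sum>j\<in>UNIV. (coord x i * coord y j) *s lie (e i) (e j))"
      by (subst linear_expand[OF lie_linear_left], subst linear_expand[OF lie_linear_right])
        (simp add: scale_sum_right)
    then have "coord (lie x y) l = (\<Sum>i\<in>UNIV. \<Sum>j\<in>UNIV. coord (lie (e i) (e j)) l * coord x i * coord y j)"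
      by (simp add: coord_sum coord_scale mult_ac)
    then show "brL (emb x) (emb y) l = emb (lie x y) l"
      by (simp add: brL_def emb_def to_ac_sum)
  qed
  have lin_left: "Vector_Spaces.linear vscale vscale (\<lambda>v. brL v w)" for w
    unfolding Vector_Spaces.linear_iff
    by (simp add: L.vector_space_axioms brL_def vscale_def fun_eq_iff algebra_simps sum.distrib sum_distrib_left)
  have lin_right: "Vector_Spaces.linear vscale vscale (brL v)" for v
    unfolding Vector_Spaces.linear_iff
    by (simp add: L.vector_space_axioms brL_def vscale_def fun_eq_iff algebra_simps sum.distrib sum_distrib_left)
  interpret l: Vector_Spaces.linear vscale vscale "\<lambda>v. brL v w" for w by (rule lin_left)
  interpret r: Vector_Spaces.linear vscale vscale "brL v" for v by (rule lin_right)
  have span_ind: "P v" if "\<And>i. P (unit_fun i)" "P 0" "\<And>v w. P v \<Longrightarrow> P w \<Longrightarrow> P (v + w)"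
    "\<And>c v. P v \<Longrightarrow> P (vscale c v)" for P and v :: "'i \<Rightarrow> 'f alg_closure"
  proof -
    have "L.span (range unit_fun) \<subseteq> Collect P"
      by (rule L.span_minimal) (use that in \<open>auto intro!: L.subspaceI\<close>)
    then show ?thesis using L.span_Basis by auto
  qed
  have der: "brL (emb x) (brL v w) = brL (brL (emb x) v) w + brL v (brL (emb x) w)" for x v w
  proof (rule span_ind[of "\<lambda>v. brL (emb x) (brL v w) = brL (brL (emb x) v) w + brL v (brL (emb x) w)"])
    fix i
    show "brL (emb x) (brL (unit_fun i) w) = brL (brL (emb x) (unit_fun i)) w + brL (unit_fun i) (brL (emb x) w)"
    proof (rule span_ind[of "\<lambda>w. brL (emb x) (brL (unit_fun i) w)
        = brL (brL (emb x) (unit_fun i)) w + brL (unit_fun i) (brL (emb x) w)"])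
      fix j
      have "brL (emb x) (brL (emb (e i)) (emb (e j)))
          = brL (brL (emb x) (emb (e i))) (emb (e j)) + brL (emb (e i)) (brL (emb x) (emb (e j)))"
        unfolding emb_lie by (simp add: lie_derivation[of x] emb_add)
      then show "brL (emb x) (brL (unit_fun i) (unit_fun j)) = brL (brL (emb x) (unit_fun i)) (unit_fun j)
          + brL (unit_fun i) (brL (emb x) (unit_fun j))"
        unfolding emb_e .
    next
      fix c v
      assume "brL (emb x) (brL (unit_fun i) v) = brL (brL (emb x) (unit_fun i)) v + brL (unit_fun i) (brL (emb x) v)"
      then show "brL (emb x) (brL (unit_fun i) (vscale c v))
          = brL (brL (emb x) (unit_fun i)) (vscale c v) + brL (unit_fun i) (brL (emb x) (vscale c v))"
        unfolding r.scale by (simp add: L.scale_right_distrib)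
    qed (simp_all add: r.zero r.add)
  next
    fix c v
    assume "brL (emb x) (brL v w) = brL (brL (emb x) v) w + brL v (brL (emb x) w)"
    then show "brL (emb x) (brL (vscale c v) w) = brL (brL (emb x) (vscale c v)) w + brL (vscale c v) (brL (emb x) w)"
      unfolding r.scale l.scale by (simp add: L.scale_right_distrib)
  qed (simp_all add: r.zero r.add l.zero l.add)
  \<comment> \<open>Only one of the two arguments comes from the original algebra: the other will be
    d z, which lies in the extension.\<close>
  have killL: "L.trace (\<lambda>v. brL (emb x) (brL w v)) = 0" for x w
  proof (rule span_ind[of "\<lambda>w. L.trace (\<lambda>v. brL (emb x) (brL w v)) = 0"])
    fix i
    have "L.trace (\<lambda>v. brL (emb x) (brL (emb (e i)) v)) = to_ac (trace (\<lambda>v. lie x (lie (e i) v)))"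
      unfolding traceL trace_coord emb_e[symmetric] emb_lie by (simp add: emb_def to_ac_sum)
    then show "L.trace (\<lambda>v. brL (emb x) (brL (unit_fun i) v)) = 0"
      by (simp add: killing emb_e)
  next
    show "L.trace (\<lambda>v. brL (emb x) (brL 0 v)) = 0"
      by (simp add: l.zero r.zero traceL)
  next
    fix c w
    assume "L.trace (\<lambda>v. brL (emb x) (brL w v)) = 0"
    then show "L.trace (\<lambda>v. brL (emb x) (brL (vscale c w) v)) = 0"
      unfolding l.scale r.scale L.trace_scale by simp
  qed (simp add: l.add r.add L.trace_add)
  have tr: "L.trace (\<lambda>v. brL (emb x) (d v)) = 0"
    if d: "Vector_Spaces.linear vscale vscale d" "\<And>v w. d (brL v w) = brL (d v) w + brL v (d w)" for d x
  proof -
    \<comment> \<open>By cyclicity of the trace, tr([ad y, ad z] d) = tr(ad y [ad z, d]) = - tr(ad y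
      ad(d z)).\<close>
    have bracket: "L.trace (\<lambda>v. brL (emb (lie y z)) (d v)) = 0" for y z
    proof -
      let ?Y = "emb y" and ?Z = "emb z"
      have Yd: "Vector_Spaces.linear vscale vscale (\<lambda>v. brL ?Y (d v))"
        using Vector_Spaces.linear_compose[OF d(1) lin_right[of ?Y]] by (simp add: o_def)
      have "L.trace (\<lambda>v. brL (emb (lie y z)) (d v))
          = L.trace (\<lambda>v. brL ?Y (brL ?Z (d v)) - brL ?Z (brL ?Y (d v)))"
        using der[of y ?Z] by (simp add: emb_lie)
      also have "\<dots> = L.trace (\<lambda>v. brL ?Y (brL ?Z (d v))) - L.trace (\<lambda>v. brL ?Z (brL ?Y (d v)))"
        by (rule L.trace_diff)
      also have "L.trace (\<lambda>v. brL ?Z (brL ?Y (d v))) = L.trace (\<lambda>v. brL ?Y (d (brL ?Z v)))"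
        using L.trace_comp_commute[OF lin_right[of ?Z] Yd] .
      also have "\<dots> = L.trace (\<lambda>v. brL ?Y (brL (d ?Z) v)) + L.trace (\<lambda>v. brL ?Y (brL ?Z (d v)))"
        by (simp add: d(2) r.add L.trace_add)
      finally show ?thesis by (simp add: killL)
    qed
    have "subspace {x. L.trace (\<lambda>v. brL (emb x) (d v)) = 0}"
    proof (rule subspaceI)
      have "emb 0 = 0" by (simp add: emb_def fun_eq_iff)
      then show "0 \<in> {x. L.trace (\<lambda>v. brL (emb x) (d v)) = 0}"
        by (simp add: l.zero traceL)
    next
      fix c x
      assume "x \<in> {x. L.trace (\<lambda>v. brL (emb x) (d v)) = 0}"
      then show "c *s x \<in> {x. L.trace (\<lambda>v. brL (emb x) (d v)) = 0}"
        unfolding emb_scale l.scale mem_Collect_eq L.trace_scale by simp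
    qed (simp add: emb_add l.add L.trace_add)
    then have "span {lie x y | x y. True} \<subseteq> {x. L.trace (\<lambda>v. brL (emb x) (d v)) = 0}"
      by (intro span_minimal) (use bracket in auto)
    then show ?thesis using perf by (auto simp: perfect_def)
  qed
  interpret op: closed_field_operator vscale "range unit_fun" "brL (emb x)"
    by unfold_locales
  obtain n where n: "\<And>v. (brL (emb x) ^^ n) v = 0"
    using op.nilpotent_if_trace_derivation_zero[OF lin_left lin_right der tr] by blast
  have "(brL (emb x) ^^ n) (emb v) = emb ((lie x ^^ n) v)" for v n
    by (induction n) (simp_all add: emb_lie)
  then have "(lie x ^^ n) v = 0" for v using n emb_eq_0 by metis
  then show ?thesis by blast
qed

end

section \<open>Engel's theorem\<close>

context based_lie_algebra
begin

definition subalgebra :: "'g set \<Rightarrow> bool" where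
  "subalgebra h \<longleftrightarrow> subspace h \<and> (\<forall>x\<in>h. \<forall>y\<in>h. lie x y \<in> h)"

text \<open>The conclusion of Engel's theorem for the module \<open>U/W\<close>; pairs \<open>W \<subset> U\<close> avoid quotient types.\<close>
definition engel :: "'g set \<Rightarrow> bool" where
  "engel h \<longleftrightarrow> (\<forall>W U. subspace W \<and> subspace U \<and> W \<subset> U \<and> (\<forall>x\<in>h. \<forall>v\<in>W. lie x v \<in> W) \<and>
     (\<forall>x\<in>h. \<forall>v\<in>U. lie x v \<in> U) \<longrightarrow> (\<exists>v\<in>U - W. \<forall>x\<in>h. lie x v \<in> W))"

text \<open>Take a proper subalgebra k of largest dimension. Engel's conclusion for k acting on h/k
  provides x outside k with [k, x] in k; then k + F x is a larger subalgebra and by maximality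
  equals h.\<close>

lemma codimension_one_subalgebra:
  assumes h: "subalgebra h" "h \<noteq> {0}" and engel: "\<And>k. subalgebra k \<Longrightarrow> k \<subset> h \<Longrightarrow> engel k"
  shows "\<exists>k x. subalgebra k \<and> k \<subset> h \<and> x \<in> h - k \<and> (\<forall>y\<in>k. lie y x \<in> k) \<and> (\<forall>z\<in>h. \<exists>c. z - c *s x \<in> k)"
proof -
  let ?P = "\<lambda>k. subalgebra k \<and> k \<subset> h"
  have "0 \<in> h" using h(1) subspace_0 by (auto simp: subalgebra_def)
  then have "?P {0}" using h by (auto simp: subalgebra_def lie_self)
  moreover have "dim k < Suc (dim h)" if "?P k" for k
    using dim_subset[of k h] that by auto
  ultimately obtain k where k: "?P k" and max: "\<And>k'. ?P k' \<Longrightarrow> dim k' \<le> dim k"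
    using ex_has_greatest_nat[of ?P "{0}" dim "Suc (dim h)"] by blast
  have k_sub: "subspace k" and h_sub: "subspace h" using k h by (auto simp: subalgebra_def)
  have k_lie: "lie y z \<in> k" if "y \<in> k" "z \<in> k" for y z
    using k that by (auto simp: subalgebra_def)
  have h_lie: "lie y z \<in> h" if "y \<in> h" "z \<in> h" for y z
    using h that by (auto simp: subalgebra_def)
  have "\<exists>v\<in>h - k. \<forall>x\<in>k. lie x v \<in> k"
    using engel[of k] k k_sub h_sub k_lie h_lie unfolding engel_def by blast
  then obtain x where x: "x \<in> h - k" "\<And>y. y \<in> k \<Longrightarrow> lie y x \<in> k" by blast
  define k' where "k' = span (insert x k)"
  have span_k: "span k = k" using k_sub by simp
  have k': "z \<in> k' \<longleftrightarrow> (\<exists>c. z - c *s x \<in> k)" for z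
    unfolding k'_def span_breakdown_eq span_k ..
  have "lie y z \<in> k'" if yz: "y \<in> k'" "z \<in> k'" for y z
  proof -
    obtain c d where cd: "y - c *s x \<in> k" "z - d *s x \<in> k" using yz k' by blast
    have "lie y z = lie (y - c *s x) (z - d *s x) + d *s lie (y - c *s x) x - c *s lie (z - d *s x) x"
      using lie_skew[of x z] by (simp add: lie_l.diff lie_r.diff lie_l.scale lie_r.scale lie_self algebra_simps)
    also have "\<dots> \<in> k"
      using k_lie[OF cd] x(2)[OF cd(1)] x(2)[OF cd(2)] k_sub
      by (intro subspace_diff subspace_add subspace_scale)
    finally show ?thesis unfolding k'_def using span_superset[of "insert x k"] by auto
  qed
  then have "subalgebra k'" by (auto simp: subalgebra_def k'_def)
  moreover have "k' \<subseteq> h"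
    unfolding k'_def using x k h_sub by (intro span_minimal) auto
  moreover have "\<not> k' \<subset> h"
  proof
    assume "k' \<subset> h"
    then have "dim k' \<le> dim k" using max \<open>subalgebra k'\<close> by blast
    moreover have "k \<subseteq> k'" "x \<in> k'" using span_superset[of "insert x k"] by (auto simp: k'_def)
    ultimately have "k = k'"
      using subspace_dim_equal[OF k_sub, of k'] by (simp add: k'_def)
    then show False using \<open>x \<in> k'\<close> x by auto
  qed
  ultimately have "k' = h" by blast
  then show ?thesis using k x k' by blast
qed

text \<open>Induction on the dimension, with h = k + F x. The vectors of U that k sends into W are
  preserved by ad x, since [k, x] lies in k. One of them is outside W by induction, and its last
  iterate under ad x before W is reached is sent into W by all of h.\<close>

lemma engel_theorem:
  assumes nil: "\<And>x. \<exists>n. \<forall>v. (lie x ^^ n) v = 0"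
  shows "subalgebra h \<Longrightarrow> engel h"
proof (induction "dim h" arbitrary: h rule: less_induct)
  case less
  show ?case
  proof (cases "h = {0}")
    case True
    then show ?thesis
      unfolding engel_def by (auto simp: lie_l.zero dest: subspace_0)
  next
    case False
    have h_sub: "subspace h" using less.prems by (auto simp: subalgebra_def)
    have IH: "engel k" if "subalgebra k" "k \<subset> h" for k
    proof -
      have "subspace k" using that by (auto simp: subalgebra_def)
      then have "span k = k" "span h = h" using h_sub span_eq_iff by blast+
      then have "span k \<subset> span h" using that(2) by (simp only:)
      then have "dim k < dim h" by (rule dim_psubset)
      then show ?thesis using less.hyps that by blast
    qed
    obtain k x where k: "subalgebra k" "k \<subset> h" "x \<in> h - k" "\<And>y. y \<in> k \<Longrightarrow> lie y x \<in> k"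
      "\<And>z. z \<in> h \<Longrightarrow> \<exists>c. z - c *s x \<in> k"
      using codimension_one_subalgebra[OF less.prems False IH] by blast
    show ?thesis
      unfolding engel_def
    proof (intro allI impI, elim conjE)
      fix W U
      assume W: "subspace W" and U: "subspace U" and WU: "W \<subset> U"
        and hW: "\<forall>x\<in>h. \<forall>v\<in>W. lie x v \<in> W" and hU: "\<forall>x\<in>h. \<forall>v\<in>U. lie x v \<in> U"
      have "(\<forall>x\<in>k. \<forall>v\<in>W. lie x v \<in> W) \<and> (\<forall>x\<in>k. \<forall>v\<in>U. lie x v \<in> U)"
        using hW hU k(2) by blast
      then have "\<exists>v\<in>U - W. \<forall>y\<in>k. lie y v \<in> W"
        using IH[OF k(1,2)] W U WU unfolding engel_def by (simp only: simp_thms)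
      then obtain v where v: "v \<in> U - W" "\<forall>y\<in>k. lie y v \<in> W" by blast
      have inv: "(lie x ^^ n) v \<in> U \<and> (\<forall>y\<in>k. lie y ((lie x ^^ n) v) \<in> W)" for n
      proof (induction n)
        case 0
        then show ?case using v by simp
      next
        case (Suc n)
        let ?v = "(lie x ^^ n) v"
        have "lie y (lie x ?v) \<in> W" if "y \<in> k" for y
        proof -
          have "lie (lie y x) ?v \<in> W" using Suc k(4)[OF that] by blast
          moreover have "lie x (lie y ?v) \<in> W" using Suc that hW k(3) by blast
          ultimately show ?thesis
            unfolding lie_derivation[of y x] by (rule subspace_add[OF W])
        qed
        then show ?case using Suc hU k(3) by auto
      qed
      obtain n where "(lie x ^^ n) v = 0" using nil by blast
      then have "(lie x ^^ n) v \<in> W" using W by (simp add: subspace_0)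
      then obtain m where m: "(lie x ^^ m) v \<in> W" "\<And>l. l < m \<Longrightarrow> (lie x ^^ l) v \<notin> W"
        using exists_least_iff[of "\<lambda>n. (lie x ^^ n) v \<in> W"] by blast
      then obtain l where l: "m = Suc l" using v by (cases m) auto
      let ?v = "(lie x ^^ l) v"
      have "lie z ?v \<in> W" if "z \<in> h" for z
      proof -
        obtain c where c: "z - c *s x \<in> k" using k(5)[OF \<open>z \<in> h\<close>] by blast
        have "lie z ?v = lie (z - c *s x) ?v + c *s lie x ?v"
          by (simp add: lie_l.diff lie_l.scale)
        also have "\<dots> \<in> W"
          using inv[of l] c m(1) W unfolding l by (intro subspace_add subspace_scale) auto
        finally show ?thesis .
      qed
      moreover have "?v \<in> U - W" using inv[of l] m(2)[of l] l by auto
      ultimately show "\<exists>v\<in>U - W. \<forall>x\<in>h. lie x v \<in> W" by blast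
    qed
  qed
qed

text \<open>With g = k + F x, all brackets fall into k because [k, k] and [k, x] do and [x, x] = 0.
  So the derived algebra is proper.\<close>

lemma not_perfect_if_ad_nilpotent:
  assumes "\<And>x. \<exists>n. \<forall>v. (lie x ^^ n) v = 0" and "UNIV \<noteq> {0 :: 'g}"
  shows "\<not> perfect"
proof -
  have "subalgebra UNIV" by (simp add: subalgebra_def)
  then obtain k x where k: "subalgebra k" "k \<subset> UNIV" "\<And>y. y \<in> k \<Longrightarrow> lie y x \<in> k"
    "\<And>z. \<exists>c. z - c *s x \<in> k"
    using codimension_one_subalgebra[OF _ assms(2)] engel_theorem[OF assms(1)] by blast
  have k_sub: "subspace k" using k(1) by (simp add: subalgebra_def)
  have "lie y z \<in> k" for y z
  proof -
    obtain c d where cd: "y - c *s x \<in> k" "z - d *s x \<in> k" using k(4) by blast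
    then have "lie (y - c *s x) (z - d *s x) \<in> k" using k(1) by (auto simp: subalgebra_def)
    moreover have "lie y z = lie (y - c *s x) (z - d *s x) + d *s lie (y - c *s x) x - c *s lie (z - d *s x) x"
      using lie_skew[of x z] by (simp add: lie_l.diff lie_r.diff lie_l.scale lie_r.scale lie_self algebra_simps)
    ultimately show ?thesis
      using k(3)[OF cd(1)] k(3)[OF cd(2)] k_sub
      by (simp add: subspace_diff subspace_add subspace_scale)
  qed
  then have "span {lie x y | x y. True} \<subseteq> k" by (intro span_minimal k_sub) auto
  then show ?thesis using k(2) by (auto simp: perfect_def)
qed

end

section \<open>The Casimir operator and Whitehead's lemmas\<close>

locale simple_lie_algebra_with_form =
  based_lie_algebra scale lie e + simple_lie_algebra scale lie + nondegenerate_invariant_form scale lie form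
  for scale :: "'f::field_char_0 \<Rightarrow> 'g::ab_group_add \<Rightarrow> 'g" (infixr "*s" 75)
    and lie and e :: "'i::finite \<Rightarrow> 'g" and form
begin

sublocale form_r: Vector_Spaces.linear scale "(*)" "form x" for x by (rule form_linear)

lemma form_add_left: "form (x + y) z = form x z + form y z"
  and form_scale_left: "form (c *s x) z = c * form x z"
  and form_minus_left: "form (- x) z = - form x z"
  by (simp_all add: form_symmetric[of _ z] form_r.add form_r.scale form_r.neg)

lemma form_diff_left: "form (x - y) z = form x z - form y z"
  by (simp add: form_symmetric[of _ z] form_r.diff)

lemma form_sum_left: "form (sum f S) z = (\<Sum>x\<in>S. form (f x) z)"
  by (simp add: form_symmetric[of _ z] form_r.sum)

lemma form_lie_swap: "form (lie x y) z = - form y (lie x z)"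
  using form_invariant[of y x z] lie_skew[of x y] by (simp add: form_minus_left)

text \<open>Nondegeneracy makes x \<mapsto> \<Sum> (x | e_i) e_i injective, hence surjective;
  preimages of the basis vectors form the dual basis.\<close>

lemma dual_basis_exists: "\<exists>ed. \<forall>i j. form (ed j) (e i) = (if i = j then 1 else 0)"
proof -
  define T where "T x = (\<Sum>i\<in>UNIV. form x (e i) *s e i)" for x
  have T: "Vector_Spaces.linear scale scale T"
    unfolding Vector_Spaces.linear_iff
    by (simp add: vector_space_axioms T_def form_add_left form_scale_left scale_left_distrib
        sum.distrib scale_sum_right)
  interpret T: Vector_Spaces.linear scale scale T by (rule T)
  have coord_T: "coord (T x) i = form x (e i)" for x i
    by (simp add: T_def coord_sum coord_scale coord_e if_distrib cong: if_cong)
  have "inj T"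
    unfolding T.inj_iff_eq_0
  proof (intro allI impI)
    fix x
    assume "T x = 0"
    then have 0: "form x (e i) = 0" for i using coord_T[of x i] by simp
    have "form x y = 0" for y
      by (subst coord_expand[symmetric]) (simp add: form_r.sum form_r.scale 0)
    then show "x = 0" using form_nondegenerate by blast
  qed
  then have "surj T" by (rule linear_inj_imp_surj[OF T])
  then have "\<exists>x. T x = e j" for j by (metis surjD)
  then obtain ed where "\<And>j. T (ed j) = e j" by metis
  then have "form (ed j) (e i) = (if i = j then 1 else 0)" for i j
    using coord_T[of "ed j" i] coord_e[of j i] by simp
  then show ?thesis by blast
qed

definition ed :: "'i \<Rightarrow> 'g" where
  "ed = (SOME ed. \<forall>i j. form (ed j) (e i) = (if i = j then 1 else 0))"

lemma form_ed_e: "form (ed j) (e i) = (if i = j then 1 else 0)"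
  using someI_ex[OF dual_basis_exists] unfolding ed_def by blast

lemma coord_form: "coord x i = form x (ed i)"
proof -
  have "form x (ed i) = (\<Sum>j\<in>UNIV. coord x j * form (ed i) (e j))"
    by (subst coord_expand[of x, symmetric])
      (simp add: form_symmetric[of _ "ed i"] form_r.sum form_r.scale)
  then show ?thesis by (simp add: form_ed_e if_distrib cong: if_cong)
qed

lemma dual_expand: "(\<Sum>i\<in>UNIV. form x (ed i) *s e i) = x"
  using coord_expand[of x] by (simp add: coord_form)

lemma dual_expand': "(\<Sum>i\<in>UNIV. form x (e i) *s ed i) = x"
proof -
  let ?z = "(\<Sum>i\<in>UNIV. form x (e i) *s ed i) - x"
  have 0: "form ?z (e j) = 0" for j
    by (simp add: form_diff_left form_sum_left form_scale_left form_ed_e if_distrib cong: if_cong)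
  have "form ?z y = 0" for y
    by (subst dual_expand[symmetric]) (simp only: form_r.sum form_r.scale 0, simp)
  then show ?thesis using form_nondegenerate by (metis eq_iff_diff_eq_0)
qed

text \<open>The element \<Sum> e_i \<otimes> e^i is annihilated by g. An arbitrary bilinear map
  \<open>\<Phi>\<close> takes the place of the tensor product.\<close>

lemma dual_basis_invariant:
  fixes \<Phi> :: "'g \<Rightarrow> 'g \<Rightarrow> 'v::ab_group_add" and x :: 'g
  assumes l: "\<And>y. Vector_Spaces.linear scale s (\<lambda>x. \<Phi> x y)" and r: "\<And>x. Vector_Spaces.linear scale s (\<Phi> x)"
  shows "(\<Sum>i\<in>UNIV. \<Phi> (lie x (e i)) (ed i)) = - (\<Sum>i\<in>UNIV. \<Phi> (e i) (lie x (ed i)))"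
proof -
  interpret l: Vector_Spaces.linear scale s "\<lambda>x. \<Phi> x b" for b by (rule l)
  interpret r: Vector_Spaces.linear scale s "\<Phi> a" for a by (rule r)
  have "(\<Sum>i\<in>UNIV. \<Phi> (lie x (e i)) (ed i))
      = (\<Sum>i\<in>UNIV. \<Sum>j\<in>UNIV. s (form (lie x (e i)) (ed j)) (\<Phi> (e j) (ed i)))"
    by (subst dual_expand[symmetric]) (simp add: l.sum l.scale)
  also have "\<dots> = (\<Sum>j\<in>UNIV. \<Sum>i\<in>UNIV. s (form (lie x (e i)) (ed j)) (\<Phi> (e j) (ed i)))"
    by (rule sum.swap)
  also have "\<dots> = (\<Sum>j\<in>UNIV. \<Sum>i\<in>UNIV. s (- form (lie x (ed j)) (e i)) (\<Phi> (e j) (ed i)))"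
    by (simp add: form_lie_swap[of x "e _"] form_symmetric[of "e _" "lie x (ed _)"])
  also have "\<dots> = - (\<Sum>j\<in>UNIV. \<Sum>i\<in>UNIV. s (form (lie x (ed j)) (e i)) (\<Phi> (e j) (ed i)))"
    by (simp add: sum_negf)
  also have "\<dots> = - (\<Sum>j\<in>UNIV. \<Phi> (e j) (lie x (ed j)))"
    by (subst (3) dual_expand'[symmetric]) (simp add: r.sum r.scale)
  finally show ?thesis .
qed

definition casimir :: "'g \<Rightarrow> 'g" where
  "casimir y = (\<Sum>i\<in>UNIV. lie (e i) (lie (ed i) y))"

lemma linear_casimir: "Vector_Spaces.linear scale scale casimir"
  unfolding Vector_Spaces.linear_iff casimir_def
  by (simp add: vector_space_axioms lie_r.add lie_r.scale sum.distrib scale_sum_right)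

sublocale casimir: Vector_Spaces.linear scale scale casimir by (rule linear_casimir)

text \<open>When x is moved inside the sum, the terms in which it hits \<open>e i\<close> and those
  in which it hits \<open>ed i\<close> cancel by invariance of the dual bases.\<close>

lemma casimir_lie: "casimir (lie x y) = lie x (casimir y)"
proof -
  have "lie x (lie (e i) (lie (ed i) y)) = lie (lie x (e i)) (lie (ed i) y)
      + (lie (e i) (lie (lie x (ed i)) y) + lie (e i) (lie (ed i) (lie x y)))" for i
    by (simp add: lie_derivation[of x] lie_r.add)
  then have "lie x (casimir y) = (\<Sum>i\<in>UNIV. lie (lie x (e i)) (lie (ed i) y))
      + (\<Sum>i\<in>UNIV. lie (e i) (lie (lie x (ed i)) y)) + casimir (lie x y)"
    by (simp add: casimir_def lie_r.sum sum.distrib)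
  moreover have "(\<Sum>i\<in>UNIV. lie (lie x (e i)) (lie (ed i) y)) = - (\<Sum>i\<in>UNIV. lie (e i) (lie (lie x (ed i)) y))"
    by (rule dual_basis_invariant[of scale "\<lambda>a b. lie a (lie b y)"])
      (simp_all add: Vector_Spaces.linear_iff vector_space_axioms lie_l.add lie_r.add lie_l.scale lie_r.scale)
  ultimately show ?thesis by simp
qed

lemma perfect: perfect
proof -
  let ?S = "span {lie x y | x y. True}"
  have "lie_ideal scale lie ?S"
    unfolding lie_ideal_def by (auto intro: span_base)
  then have "?S = {0} \<or> ?S = UNIV" by (rule ideal_trivial)
  moreover obtain x y where "lie x y \<noteq> 0" using nonabelian by blast
  then have "?S \<noteq> {0}" using span_base[of "lie x y" "{lie x y | x y. True}"] by auto
  ultimately show ?thesis by (simp add: perfect_def)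
qed

text \<open>The Killing form is the given form twisted by the Casimir operator; this is how a zero
  Casimir operator turns into a zero Killing form.\<close>

lemma trace_lie_lie: "trace (\<lambda>v. lie x (lie y v)) = form y (casimir x)"
proof -
  have "form (lie x (lie y (e i))) (ed i) = form y (lie (e i) (lie (ed i) x))" for i
  proof -
    have "form (lie x (lie y (e i))) (ed i) = - form (lie y (e i)) (lie x (ed i))"
      by (rule form_lie_swap)
    also have "\<dots> = form (lie (e i) y) (lie x (ed i))"
      by (simp add: lie_skew[of y] form_minus_left)
    also have "\<dots> = form y (lie (e i) (lie (ed i) x))"
      by (simp add: form_lie_swap lie_skew[of x] lie_r.neg form_r.neg)
    finally show ?thesis .
  qed
  then show ?thesis
    by (simp add: trace_coord coord_form casimir_def form_r.sum)
qed

lemma casimir_nonzero: "\<exists>x. casimir x \<noteq> 0"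
proof (rule ccontr)
  assume "\<not> ?thesis"
  then have "trace (\<lambda>v. lie x (lie y v)) = 0" for x y by (simp add: trace_lie_lie form_r.zero)
  then have "\<exists>n. \<forall>v. (lie x ^^ n) v = 0" for x
    by (rule ad_nilpotent_if_killing_zero[OF perfect])
  moreover have "UNIV \<noteq> {0 :: 'g}" using nonabelian by auto
  ultimately show False using not_perfect_if_ad_nilpotent perfect by blast
qed

text \<open>The kernel is an ideal and not everything, hence zero. Over a field that is not closed
  the operator may fail to be a scalar, so later arguments apply the inverse itself, which commutes
  with all ad x.\<close>

lemma casimir_inverse:
  obtains R where "Vector_Spaces.linear scale scale R" "\<And>x. R (casimir x) = x"
    "\<And>x y. R (lie x y) = lie x (R y)"
proof -
  have "lie_ideal scale lie {x. casimir x = 0}"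
    unfolding lie_ideal_def
    by (auto intro: casimir.subspace_kernel simp: casimir_lie lie_r.zero)
  then have "{x. casimir x = 0} = {0}"
    using ideal_trivial casimir_nonzero by blast
  then have inj: "inj casimir" unfolding casimir.inj_iff_eq_0 by blast
  define R where "R = inv_into UNIV casimir"
  have R1: "R (casimir x) = x" for x using inj by (simp add: R_def)
  have "surj casimir" by (rule linear_inj_imp_surj[OF linear_casimir inj])
  then have R2: "casimir (R x) = x" for x by (simp add: R_def surj_f_inv_f)
  have "Vector_Spaces.linear scale scale R"
    unfolding Vector_Spaces.linear_iff
    by (metis R1 R2 casimir.add casimir.scale vector_space_axioms)
  moreover have "R (lie x y) = lie x (R y)" for x y
    by (metis R1 R2 casimir_lie)
  ultimately show ?thesis using R1 that by blast
qed

text \<open>Whitehead's first lemma with an explicit solution: contracting the derivation with the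
  dual bases gives d with \<open>casimir (\<phi> y) = lie y d\<close>, since invariance lets y be
  collected from both factors of the sum. Then \<open>R\<close> cancels \<open>casimir\<close>, and
  - R d is the inner element.\<close>

lemma derivation_inner:
  assumes \<phi>: "Vector_Spaces.linear scale scale \<phi>" and der: "\<And>x y. \<phi> (lie x y) = lie (\<phi> x) y + lie x (\<phi> y)"
  shows "\<exists>d. \<forall>y. \<phi> y = lie d y"
proof -
  interpret \<phi>: Vector_Spaces.linear scale scale \<phi> by (rule \<phi>)
  obtain R where R: "Vector_Spaces.linear scale scale R" "\<And>x. R (casimir x) = x"
    "\<And>x y. R (lie x y) = lie x (R y)"
    using casimir_inverse by blast
  interpret R: Vector_Spaces.linear scale scale R by (rule R)
  define d where "d = (\<Sum>i\<in>UNIV. lie (e i) (\<phi> (ed i)))"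
  have "casimir (\<phi> y) = lie y d" for y
  proof -
    have "casimir (\<phi> y) = (\<Sum>i\<in>UNIV. lie (e i) (\<phi> (lie (ed i) y)) - lie (e i) (lie (\<phi> (ed i)) y))"
      by (simp add: casimir_def der lie_r.add)
    also have "\<dots> = - (\<Sum>i\<in>UNIV. lie (e i) (\<phi> (lie y (ed i)))) + (\<Sum>i\<in>UNIV. lie (e i) (lie y (\<phi> (ed i))))"
      by (simp add: lie_skew[of "ed _" y] lie_skew[of "\<phi> (ed _)" y] \<phi>.neg lie_r.neg sum_subtractf)
    also have "- (\<Sum>i\<in>UNIV. lie (e i) (\<phi> (lie y (ed i)))) = (\<Sum>i\<in>UNIV. lie (lie y (e i)) (\<phi> (ed i)))"
      by (rule dual_basis_invariant[of scale "\<lambda>a b. lie a (\<phi> b)", symmetric])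
        (simp_all add: Vector_Spaces.linear_iff vector_space_axioms lie_l.add lie_r.add lie_l.scale
          lie_r.scale \<phi>.add \<phi>.scale)
    also have "(\<Sum>i\<in>UNIV. lie (lie y (e i)) (\<phi> (ed i))) + (\<Sum>i\<in>UNIV. lie (e i) (lie y (\<phi> (ed i)))) = lie y d"
      by (simp add: d_def lie_r.sum lie_derivation[of y] sum.distrib)
    finally show ?thesis .
  qed
  then have "\<phi> y = lie (- R d) y" for y
    by (metis R(2,3) lie_skew lie_r.neg)
  then show ?thesis by blast
qed

text \<open>Whitehead's second lemma by the same contraction: putting \<open>ed i\<close> into the
  cocycle identity, bracketing with \<open>e i\<close> and summing exhibits
  \<open>casimir (\<omega> y z)\<close> as the coboundary of \<open>\<psi>\<close>. As
  \<open>R\<close> commutes with ad, \<open>\<omega>\<close> is the coboundary of R \<psi>.\<close>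

lemma two_cocycle_trivial:
  assumes l: "\<And>y. Vector_Spaces.linear scale scale (\<lambda>x. \<omega> x y)"
    and r: "\<And>x. Vector_Spaces.linear scale scale (\<omega> x)"
    and skew: "\<And>x y. \<omega> x y = - \<omega> y x"
    and cocycle: "\<And>x y z. lie x (\<omega> y z) + \<omega> x (lie y z) - lie y (\<omega> x z) - \<omega> y (lie x z)
      = \<omega> (lie x y) z + lie (\<omega> x y) z"
  shows "\<exists>\<phi>. Vector_Spaces.linear scale scale \<phi> \<and>
    (\<forall>x y. \<omega> x y = lie (\<phi> x) y + lie x (\<phi> y) - \<phi> (lie x y))"
proof -
  interpret l: Vector_Spaces.linear scale scale "\<lambda>x. \<omega> x y" for y by (rule l)
  interpret r: Vector_Spaces.linear scale scale "\<omega> x" for x by (rule r)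
  obtain R where R: "Vector_Spaces.linear scale scale R" "\<And>x. R (casimir x) = x"
    "\<And>x y. R (lie x y) = lie x (R y)"
    using casimir_inverse by blast
  interpret R: Vector_Spaces.linear scale scale R by (rule R)
  define \<psi> where "\<psi> y = (\<Sum>i\<in>UNIV. lie (e i) (\<omega> (ed i) y))" for y
  have \<psi>: "Vector_Spaces.linear scale scale \<psi>"
    unfolding Vector_Spaces.linear_iff \<psi>_def
    by (simp add: vector_space_axioms lie_r.add lie_r.scale r.add r.scale sum.distrib scale_sum_right)
  have inv: "(\<Sum>i\<in>UNIV. lie (lie y (e i)) (\<omega> (ed i) z)) = - (\<Sum>i\<in>UNIV. lie (e i) (\<omega> (lie y (ed i)) z))" for y z
    by (rule dual_basis_invariant[of scale "\<lambda>a b. lie a (\<omega> b z)"])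
      (simp_all add: Vector_Spaces.linear_iff vector_space_axioms lie_l.add lie_r.add lie_l.scale
        lie_r.scale l.add l.scale)
  have move: "lie y (\<psi> z) = (\<Sum>i\<in>UNIV. lie (e i) (lie y (\<omega> (ed i) z))) - (\<Sum>i\<in>UNIV. lie (e i) (\<omega> (lie y (ed i)) z))" for y z
    using inv[of y z] by (simp add: \<psi>_def lie_r.sum lie_derivation[of y] sum.distrib)
  have "casimir (\<omega> y z) = lie y (\<psi> z) - lie z (\<psi> y) - \<psi> (lie y z)" for y z
  proof -
    have "lie (ed i) (\<omega> y z) = lie y (\<omega> (ed i) z) - lie z (\<omega> (ed i) y)
        - \<omega> (lie y (ed i)) z + \<omega> (lie z (ed i)) y - \<omega> (ed i) (lie y z)" for i
    proof -
      have "\<omega> (lie (ed i) y) z = - \<omega> (lie y (ed i)) z"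
        by (simp add: lie_skew[of "ed i" y] l.neg)
      moreover have "\<omega> y (lie (ed i) z) = \<omega> (lie z (ed i)) y"
        by (simp add: lie_skew[of "ed i" z] r.neg skew[of y])
      moreover have "lie (\<omega> (ed i) y) z = - lie z (\<omega> (ed i) y)" by (rule lie_skew)
      ultimately show ?thesis
        using cocycle[of "ed i" y z] by (simp add: algebra_simps)
    qed
    then show ?thesis
      by (simp add: casimir_def move \<psi>_def[of "lie y z"] lie_r.add lie_r.diff sum.distrib sum_subtractf)
  qed
  then have "\<omega> y z = lie y (R (\<psi> z)) - lie z (R (\<psi> y)) - R (\<psi> (lie y z))" for y z
    by (metis R(2,3) R.diff)
  then have "\<omega> y z = lie (R (\<psi> y)) z + lie y (R (\<psi> z)) - R (\<psi> (lie y z))" for y z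
    using lie_skew[of z "R (\<psi> y)"] by simp
  moreover have "Vector_Spaces.linear scale scale (\<lambda>x. R (\<psi> x))"
    using Vector_Spaces.linear_compose[OF \<psi> R(1)] by (simp add: o_def)
  ultimately show ?thesis by blast
qed

end

section \<open>Differential polynomials\<close>

abbreviation dp_mono :: "(('i \<times> nat) \<Rightarrow>\<^sub>0 nat) \<Rightarrow> ('i, 'f::field_char_0) diff_poly" where
  "dp_mono m \<equiv> Poly_Mapping.single m 1"

abbreviation lookup :: "('a \<Rightarrow>\<^sub>0 'b::zero) \<Rightarrow> 'a \<Rightarrow> 'b" where
  "lookup \<equiv> Poly_Mapping.lookup"

lemma dp_scale_map: "dp_scale c p = Poly_Mapping.map ((*) c) p"
  by (simp add: dp_scale_def dp_const_def mult_map_scale_conv_mult)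

lemma lookup_dp_scale [simp]: "lookup (dp_scale c p) m = c * lookup p m"
  by (simp add: dp_scale_map Poly_Mapping.map.rep_eq when_def)

interpretation dp: comm_algebra "dp_scale :: 'f::field_char_0 \<Rightarrow> ('i, 'f) diff_poly \<Rightarrow> _"
  by unfold_locales
    (simp_all add: dp_scale_def dp_const_def algebra_simps single_add mult_single flip: mult.assoc)

interpretation dp: vector_space "dp_scale :: 'f::field_char_0 \<Rightarrow> ('i, 'f) diff_poly \<Rightarrow> _"
  by unfold_locales (simp_all add: dp.scale_right_distrib dp.scale_left_distrib)

lemma dp_scale_mult_right: "a * dp_scale c b = dp_scale c (a * b)"
  using dp.scale_mult_left[of c b a] by (simp add: mult.commute)

lemma dp_const_eq: "dp_const c = dp_scale c 1"
  by (simp add: dp_scale_def)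

text \<open>Brings m - 1 into the form produced by the Jacobi identity of first order, whose right
  side carries the factor m + 1.\<close>

lemma dp_scale_of_nat_minus_one: "dp_scale (of_nat m - 1) p = of_nat (Suc m) * p - p - p"
proof -
  have "dp_scale (of_nat m) p = of_nat m * p"
    by (induction m) (simp_all add: dp.scale_left_distrib distrib_right)
  then show ?thesis by (simp add: dp.scale_left_diff_distrib distrib_right)
qed

lemma dp_mono_expand: "p = (\<Sum>m\<in>Poly_Mapping.keys p. dp_scale (lookup p m) (dp_mono m))"
proof (rule poly_mapping_eqI)
  fix k
  have "lookup (\<Sum>m\<in>Poly_Mapping.keys p. dp_scale (lookup p m) (dp_mono m)) k
      = (\<Sum>m\<in>Poly_Mapping.keys p. if m = k then lookup p m else 0)"
    by (simp add: lookup_sum lookup_single when_def if_distrib cong: if_cong)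
  also have "\<dots> = lookup p k" by (simp add: in_keys_iff)
  finally show "lookup p k = lookup (\<Sum>m\<in>Poly_Mapping.keys p. dp_scale (lookup p m) (dp_mono m)) k" ..
qed

lemma dp_linear_induct:
  assumes "\<And>m. P (dp_mono m)" "\<And>p q. P p \<Longrightarrow> P q \<Longrightarrow> P (p + q)" "\<And>c p. P p \<Longrightarrow> P (dp_scale c p)"
  shows "P p"
proof -
  have "P (dp_scale 0 (dp_mono 0))" by (intro assms)
  then have "P 0" by simp
  then have "P (\<Sum>m\<in>S. dp_scale (lookup p m) (dp_mono m))" for S
    by (induction S rule: infinite_finite_induct) (simp_all add: assms)
  then show ?thesis by (subst dp_mono_expand)
qed

lemma dp_mono_induct:
  fixes m :: "('i \<times> nat) \<Rightarrow>\<^sub>0 nat"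
  assumes "P 0" "\<And>i n m. P m \<Longrightarrow> P (Poly_Mapping.single (i, n) 1 + m)"
  shows "P m"
proof (induction "\<Sum>v\<in>Poly_Mapping.keys m. lookup m v" arbitrary: m)
  case 0
  then have "m = 0" by (intro poly_mapping_eqI) (auto simp: in_keys_iff)
  then show ?case using assms(1) by simp
next
  case (Suc k)
  have "Poly_Mapping.keys m \<noteq> {}" using Suc.hyps(2) by (metis nat.distinct(1) sum.empty)
  then obtain v where v: "v \<in> Poly_Mapping.keys m" "lookup m v \<noteq> 0"
    by (meson all_not_in_conv in_keys_iff)
  define m' where "m' = m - Poly_Mapping.single v 1"
  have m: "m = Poly_Mapping.single v 1 + m'"
    unfolding m'_def using v
    by (intro poly_mapping_eqI) (auto simp: lookup_add lookup_minus lookup_single when_def)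
  have sub: "Poly_Mapping.keys m' \<subseteq> Poly_Mapping.keys m"
    by (auto simp: m'_def in_keys_iff lookup_minus)
  have "(\<Sum>v\<in>Poly_Mapping.keys m'. lookup m' v) = (\<Sum>v\<in>Poly_Mapping.keys m. lookup m' v)"
    by (rule sum.mono_neutral_left) (use sub in \<open>auto simp: in_keys_iff\<close>)
  moreover have "(\<Sum>v\<in>Poly_Mapping.keys m. lookup m v)
      = (\<Sum>w\<in>Poly_Mapping.keys m. (if w = v then 1 else 0) + lookup m' w)"
    by (subst m) (simp add: lookup_add lookup_single when_def eq_commute del: One_nat_def)
  ultimately have "Suc k = 1 + (\<Sum>v\<in>Poly_Mapping.keys m'. lookup m' v)"
    using Suc.hyps(2) v(1) by (simp add: sum.distrib)
  then have "P m'" by (intro Suc.hyps(1)) simp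
  then show ?case using assms(2)[of m' "fst v" "snd v"] m by simp
qed

lemma dp_mono_add: "dp_mono (m + m') = dp_mono m * dp_mono m'"
  by (simp add: mult_single)

lemma dp_induct [case_names const var add mult]:
  assumes const: "\<And>c. P (dp_const c)" and var: "\<And>i n. P (dp_var i n)"
    and add: "\<And>p q. P p \<Longrightarrow> P q \<Longrightarrow> P (p + q)" and mult: "\<And>p q. P p \<Longrightarrow> P q \<Longrightarrow> P (p * q)"
  shows "P p"
proof (rule dp_linear_induct)
  fix m
  show "P (dp_mono m)"
  proof (rule dp_mono_induct)
    show "P (dp_mono 0)" using const[of 1] by (simp add: dp_const_def)
  next
    fix i n m
    assume "P (dp_mono m)"
    then show "P (dp_mono (Poly_Mapping.single (i, n) 1 + m))"
      unfolding dp_mono_add using mult var unfolding dp_var_def by blast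
  qed
next
  fix c p
  assume "P p"
  then show "P (dp_scale c p)" unfolding dp_scale_def by (intro mult const)
qed (rule add)

section \<open>Linear maps and derivations of the differential polynomials\<close>

definition dp_extend :: "((('i \<times> nat) \<Rightarrow>\<^sub>0 nat) \<Rightarrow> ('i, 'f::field_char_0) diff_poly) \<Rightarrow> ('i, 'f) diff_poly \<Rightarrow> ('i, 'f) diff_poly" where
  "dp_extend g p = (\<Sum>m\<in>Poly_Mapping.keys p. dp_scale (lookup p m) (g m))"

lemma dp_extend_superset:
  "finite S \<Longrightarrow> Poly_Mapping.keys p \<subseteq> S \<Longrightarrow> dp_extend g p = (\<Sum>m\<in>S. dp_scale (lookup p m) (g m))"
  unfolding dp_extend_def by (rule sum.mono_neutral_left) (auto simp: in_keys_iff)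

lemma dp_extend_add: "dp_extend g (p + q) = dp_extend g p + dp_extend g q"
proof -
  let ?S = "Poly_Mapping.keys p \<union> Poly_Mapping.keys q"
  have "Poly_Mapping.keys (p + q) \<subseteq> ?S" by (rule keys_add)
  then show ?thesis
    by (simp add: dp_extend_superset[of ?S] lookup_add dp.scale_left_distrib sum.distrib)
qed

lemma dp_extend_scale: "dp_extend g (dp_scale c p) = dp_scale c (dp_extend g p)"
proof -
  have "Poly_Mapping.keys (dp_scale c p) \<subseteq> Poly_Mapping.keys p" by (auto simp: in_keys_iff)
  then show ?thesis
    by (simp add: dp_extend_superset[of "Poly_Mapping.keys p"] dp.scale_sum_right)
qed

lemma dp_extend_mono [simp]: "dp_extend g (dp_mono m) = g m"
  by (simp add: dp_extend_def)

lemma dp_module_hom_iff: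
  fixes E :: "('i, 'f::field_char_0) diff_poly \<Rightarrow> ('i, 'f) diff_poly"
  shows
  "module_hom dp_scale dp_scale E \<longleftrightarrow>
     (\<forall>p q. E (p + q) = E p + E q) \<and> (\<forall>c p. E (dp_scale c p) = dp_scale c (E p))"
  using dp.module_axioms by (auto simp: module_hom_iff)

lemma algebra_derivation_dpI:
  assumes "\<And>p q. E (p + q) = E p + E q" "\<And>c p. E (dp_scale c p) = dp_scale c (E p)"
    and "\<And>m m'. E (dp_mono (m + m')) = E (dp_mono m) * dp_mono m' + dp_mono m * E (dp_mono m')"
  shows "algebra_derivation dp_scale E"
proof -
  have "E (p * q) = E p * q + p * E q" for p q
  proof (induction p rule: dp_linear_induct)
    case (1 m)
    show ?case
    proof (induction q rule: dp_linear_induct)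
      case (1 m')
      then show ?case using assms(3)[of m m'] by (simp add: mult_single)
    next
      case (2 p q)
      then show ?case by (simp add: assms distrib_left)
    next
      case (3 c p)
      then show ?case by (simp only: assms dp_scale_mult_right dp.scale_right_distrib)
    qed
  next
    case (2 p q)
    then show ?case by (simp add: assms distrib_right)
  next
    case (3 c p)
    then show ?case by (simp only: assms dp.scale_mult_left dp.scale_right_distrib)
  qed
  then show ?thesis using assms by (simp add: algebra_derivation_def dp_module_hom_iff)
qed

lemma algebra_derivation_dpD:
  assumes "algebra_derivation dp_scale E"
  shows "E (p + q) = E p + E q" "E (dp_scale c p) = dp_scale c (E p)" "E (p * q) = E p * q + p * E q"
    "E 0 = 0" "E 1 = 0" "E (dp_const c) = 0" "E (- p) = - E p" "E (p - q) = E p - E q"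
proof -
  interpret E: module_hom dp_scale dp_scale E using assms by (simp add: algebra_derivation_def)
  show "E (p + q) = E p + E q" "E (dp_scale c p) = dp_scale c (E p)" "E 0 = 0"
    "E (- p) = - E p" "E (p - q) = E p - E q"
    by (rule E.add E.scale E.zero E.neg E.diff)+
  show "E (p * q) = E p * q + p * E q" for p q using assms by (simp add: algebra_derivation_def)
  from this[of 1 1] show "E 1 = 0" by simp
  then show "E (dp_const c) = 0" unfolding dp_const_eq E.scale by simp
qed

lemma algebra_derivation_eqI:
  assumes "algebra_derivation dp_scale E" "algebra_derivation dp_scale E'"
    and "\<And>i n. E (dp_var i n) = E' (dp_var i n)"
  shows "E p = E' p"
  by (induction p rule: dp_induct)
    (simp_all add: algebra_derivation_dpD[OF assms(1)] algebra_derivation_dpD[OF assms(2)] assms(3))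

text \<open>In the proof, \<open>t m v\<close> is the partial derivative of the monomial m along v
  times the prescribed value at v. The exponent in front is zero exactly when the truncated
  subtraction of exponents would be wrong.\<close>

lemma algebra_derivation_exists:
  fixes P :: "'i \<times> nat \<Rightarrow> ('i, 'f::field_char_0) diff_poly"
  shows "\<exists>E. algebra_derivation dp_scale E \<and> (\<forall>i n. E (dp_var i n) = P (i, n))"
proof -
  define t where "t m v = dp_scale (of_nat (lookup m v)) (dp_mono (m - Poly_Mapping.single v 1) * P v)"
    for m v
  define g where "g m = (\<Sum>v\<in>Poly_Mapping.keys m. t m v)" for m
  have g: "g m = (\<Sum>v\<in>S. t m v)" if "finite S" "Poly_Mapping.keys m \<subseteq> S" for m S
    unfolding g_def by (rule sum.mono_neutral_left) (use that in \<open>auto simp: in_keys_iff t_def\<close>)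
  have t: "t (m + m') v = t m v * dp_mono m' + dp_mono m * t m' v" for m m' v
  proof -
    have shift: "dp_scale (of_nat (lookup m v)) (dp_mono (m + m' - Poly_Mapping.single v 1) * P v)
        = t m v * dp_mono m'" for m m'
    proof (cases "lookup m v = 0")
      case False
      then have "m + m' - Poly_Mapping.single v 1 = (m - Poly_Mapping.single v 1) + m'"
        by (intro poly_mapping_eqI) (auto simp: lookup_add lookup_minus lookup_single when_def)
      then show ?thesis by (simp only: t_def dp_mono_add dp.scale_mult_left dp_scale_mult_right ac_simps)
    qed (simp add: t_def)
    have "t (m + m') v = t m v * dp_mono m' + t m' v * dp_mono m"
      using shift[of m m'] shift[of m' m]
      by (simp add: t_def lookup_add dp.scale_left_distrib add.commute[of m' m])
    then show ?thesis by (simp add: mult.commute)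
  qed
  have "g (m + m') = g m * dp_mono m' + dp_mono m * g m'" for m m'
  proof -
    let ?S = "Poly_Mapping.keys m \<union> Poly_Mapping.keys m'"
    have "g (m + m') = (\<Sum>v\<in>?S. t (m + m') v)" "g m = (\<Sum>v\<in>?S. t m v)" "g m' = (\<Sum>v\<in>?S. t m' v)"
      by (rule g; use keys_add[of m m'] in simp)+
    then show ?thesis
      by (simp only: t sum.distrib sum_distrib_left sum_distrib_right)
  qed
  then have "algebra_derivation dp_scale (dp_extend g)"
    by (intro algebra_derivation_dpI) (simp_all add: dp_extend_add dp_extend_scale)
  moreover have "dp_extend g (dp_var i n) = P (i, n)" for i n
    by (simp add: dp_var_def g_def t_def)
  ultimately show ?thesis by blast
qed

subsection \<open>Conformal weight\<close>

definition wt :: "(('i \<times> nat) \<Rightarrow>\<^sub>0 nat) \<Rightarrow> nat" where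
  "wt m = (\<Sum>v\<in>Poly_Mapping.keys m. lookup m v * Suc (snd v))"

lemma wt_superset: "finite S \<Longrightarrow> Poly_Mapping.keys m \<subseteq> S \<Longrightarrow> wt m = (\<Sum>v\<in>S. lookup m v * Suc (snd v))"
  unfolding wt_def by (rule sum.mono_neutral_left) (auto simp: in_keys_iff)

lemma wt_add: "wt (m + m') = wt m + wt m'"
proof -
  let ?S = "Poly_Mapping.keys m \<union> Poly_Mapping.keys m'"
  have "Poly_Mapping.keys (m + m') \<subseteq> ?S" by (rule keys_add)
  then show ?thesis
    by (simp add: wt_superset[of ?S] lookup_add sum.distrib distrib_right del: mult_Suc_right)
qed

lemma wt_0_iff: "wt m = 0 \<longleftrightarrow> m = 0"
  by (auto simp: wt_def in_keys_iff intro: poly_mapping_eqI)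

lemma wt_single [simp]: "wt (Poly_Mapping.single (i, n) 1) = Suc n"
  by (simp add: wt_def)

lemma wt_1D:
  assumes "wt m = 1"
  shows "\<exists>i. m = Poly_Mapping.single (i, 0) 1"
proof (cases "m = 0")
  case True
  then show ?thesis using assms by (simp add: wt_def)
next
  case False
  then obtain v where v: "lookup m v \<noteq> 0" by (metis lookup_zero poly_mapping_eqI)
  define m' where "m' = m - Poly_Mapping.single v 1"
  have m: "m = Poly_Mapping.single v 1 + m'"
    unfolding m'_def using v
    by (intro poly_mapping_eqI) (auto simp: lookup_add lookup_minus lookup_single when_def)
  have "Suc (snd v) + wt m' = 1"
    using assms wt_single[of "fst v" "snd v"] unfolding m wt_add by simp
  then have "m' = 0" "v = (fst v, 0)" by (auto simp: wt_0_iff intro: prod_eqI)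
  then show ?thesis using m by (metis add.right_neutral)
qed

text \<open>Scales the component of weight w by h w. The grading operator, the projection to one
  weight and the partial inverse of weight - 1 are all of this kind.\<close>

definition wt_op :: "(nat \<Rightarrow> 'f) \<Rightarrow> ('i, 'f::field_char_0) diff_poly \<Rightarrow> ('i, 'f) diff_poly" where
  "wt_op h = dp_extend (\<lambda>m. dp_scale (h (wt m)) (dp_mono m))"

lemma lookup_wt_op [simp]: "lookup (wt_op h p) m = h (wt m) * lookup p m"
proof (induction p rule: dp_linear_induct)
  case (1 m')
  show ?case by (simp add: wt_op_def lookup_single when_def)
qed (simp_all add: wt_op_def dp_extend_add dp_extend_scale lookup_add algebra_simps)

lemma wt_op_add: "wt_op h (p + q) = wt_op h p + wt_op h q"
  and wt_op_scale: "wt_op h (dp_scale c p) = dp_scale c (wt_op h p)"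
  by (simp_all add: wt_op_def dp_extend_add dp_extend_scale)

lemma wt_op_mono: "wt_op h (dp_mono m) = dp_scale (h (wt m)) (dp_mono m)"
  by (simp add: wt_op_def)

abbreviation weight_op :: "('i, 'f::field_char_0) diff_poly \<Rightarrow> ('i, 'f) diff_poly" where
  "weight_op \<equiv> wt_op of_nat"

lemma weight_op_derivation:
  "algebra_derivation dp_scale (weight_op :: ('i, 'f::field_char_0) diff_poly \<Rightarrow> _)"
proof (rule algebra_derivation_dpI)
  fix m m' :: "('i \<times> nat) \<Rightarrow>\<^sub>0 nat"
  show "weight_op (dp_mono (m + m') :: ('i, 'f) diff_poly)
      = weight_op (dp_mono m) * dp_mono m' + dp_mono m * weight_op (dp_mono m')"
    unfolding wt_op_mono wt_add of_nat_add dp.scale_left_distrib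
    unfolding dp_mono_add dp.scale_mult_left dp_scale_mult_right ..
qed (rule wt_op_add wt_op_scale)+

lemma weight_op_var: "weight_op (dp_var i n) = dp_scale (of_nat (Suc n)) (dp_var i n)"
  unfolding dp_var_def wt_op_mono wt_single ..

lemma wt_op_eigenvector:
  assumes "weight_op p = dp_scale (of_nat w) p"
  shows "wt_op h p = dp_scale (h w) p"
proof (rule poly_mapping_eqI)
  fix m
  have "lookup (weight_op p) m = lookup (dp_scale (of_nat w) p) m" using assms by simp
  then have "(of_nat (wt m) - of_nat w) * lookup p m = 0" by (simp add: algebra_simps)
  then show "lookup (wt_op h p) m = lookup (dp_scale (h w) p) m" by auto
qed

lemma weight_op_eq_0D: "weight_op p = 0 \<Longrightarrow> p = dp_const (lookup p 0)"
proof (rule poly_mapping_eqI)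
  fix m
  assume "weight_op p = 0"
  then have "lookup (weight_op p) m = 0" by simp
  then show "lookup p m = lookup (dp_const (lookup p 0)) m"
    by (auto simp: dp_const_def lookup_single when_def wt_0_iff)
qed

text \<open>Every variable has weight at least one, with equality only for the underived ones, so
  weight one is a copy of g.\<close>

lemma weight_op_eq_selfD:
  fixes p :: "('i::finite, 'f::field_char_0) diff_poly"
  assumes "weight_op p = p"
  shows "p = (\<Sum>i\<in>UNIV. dp_scale (lookup p (Poly_Mapping.single (i, 0) 1)) (dp_var i 0))"
proof (rule poly_mapping_eqI)
  fix m
  have "lookup (weight_op p) m = lookup p m" using assms by simp
  then have m: "lookup p m = 0 \<or> wt m = 1" by (auto simp: algebra_simps)
  have "lookup (\<Sum>i\<in>UNIV. dp_scale (lookup p (Poly_Mapping.single (i, 0) 1)) (dp_var i 0)) m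
      = (\<Sum>i\<in>UNIV. if Poly_Mapping.single (i, 0) 1 = m then lookup p m else 0)"
    by (auto simp: lookup_sum dp_var_def lookup_single when_def intro!: sum.cong)
  also have "\<dots> = lookup p m"
  proof (cases "wt m = 1")
    case True
    then obtain j where j: "m = Poly_Mapping.single (j, 0) 1" using wt_1D by blast
    have "(Poly_Mapping.single (i, 0::nat) (1::nat) = m) = (i = j)" for i
      unfolding j by (metis Pair_inject lookup_single_eq lookup_single_not_eq one_neq_zero)
    then show ?thesis by simp
  next
    case False
    then have "(Poly_Mapping.single (i, 0::nat) (1::nat) = m) = False" for i
      using wt_single[of i 0] by auto
    then show ?thesis using m False by simp
  qed
  finally show "lookup p m
      = lookup (\<Sum>i\<in>UNIV. dp_scale (lookup p (Poly_Mapping.single (i, 0) 1)) (dp_var i 0)) m" ..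
qed

section \<open>Poisson vertex algebras in terms of the coefficients of the bracket\<close>

lemma coeff_in_second [simp]: "coeff (in_second p) n = [:coeff p n:]"
  by (simp add: in_second_def coeff_map_poly)

lemma coeff_lambda_plus: "D 0 = 0 \<Longrightarrow>
    coeff (lambda_plus D p) n = (case n of 0 \<Rightarrow> 0 | Suc k \<Rightarrow> coeff p k) + D (coeff p n)"
  by (simp add: lambda_plus_def coeff_pCons coeff_map_poly)

text \<open>\<open>p(-\<lambda>-D)\<close>, with \<open>D\<close> acting on the coefficients\<close>
definition flip :: "('v::comm_ring_1 \<Rightarrow> 'v) \<Rightarrow> 'v poly \<Rightarrow> 'v poly" where
  "flip D p = subst_second D (in_second p)"

lemma lambda_plus_add:
  assumes "\<And>a b. D (a + b) = D a + D b"
  shows "lambda_plus D (p + q) = lambda_plus D p + lambda_plus D q"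
proof -
  have "D 0 = 0" using assms[of 0 0] by simp
  then show ?thesis
    by (intro poly_eqI) (simp add: coeff_lambda_plus assms split: nat.split)
qed

lemma flip_0 [simp]: "flip D 0 = 0"
  by (simp add: flip_def in_second_def subst_second_def)

text \<open>Horner's scheme for the substitution of -\<lambda>-D. Inductions use this recursion in
  place of the sum of iterates in the definition.\<close>

lemma flip_pCons:
  assumes "\<And>a b. D (a + b) = D a + D b"
  shows "flip D (pCons a p) = [:a:] - lambda_plus D (flip D p)"
proof -
  let ?N = "\<lambda>q. - lambda_plus D q"
  have D0: "D 0 = 0" using assms[of 0 0] by simp
  have N0: "?N 0 = 0" using D0 by (simp add: lambda_plus_def)
  have Nadd: "?N (p + q) = ?N p + ?N q" for p q by (simp add: lambda_plus_add assms)
  have Nsum: "?N (sum f S) = (\<Sum>x\<in>S. ?N (f x))" for f :: "nat \<Rightarrow> 'a poly" and S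
    by (induction S rule: infinite_finite_induct) (simp_all only: sum.infinite sum.empty sum.insert N0 Nadd simp_thms)
  have deg: "degree (in_second p) \<le> degree p" for p :: "'a poly"
    by (simp add: in_second_def map_poly_degree_leq)
  have f: "flip D p = (\<Sum>n\<le>N. (?N ^^ n) [:coeff p n:])" if "degree p \<le> N" for p N
    unfolding flip_def using deg[of p] that by (subst subst_second_bound[where D = D and N = N, OF D0]) auto
  have "flip D (pCons a p) = (\<Sum>n\<le>Suc (degree p). (?N ^^ n) [:coeff (pCons a p) n:])"
    by (rule f) (rule degree_pCons_le)
  also have "\<dots> = [:a:] + (\<Sum>n\<le>degree p. ?N ((?N ^^ n) [:coeff p n:]))"
    by (subst sum.atMost_Suc_shift) simp
  also have "\<dots> = [:a:] + ?N (flip D p)"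
    by (simp only: f[OF order_refl] Nsum)
  finally show ?thesis by simp
qed

lemma flip_map:
  assumes D: "\<And>a b. D (a + b) = D a + D b" and D': "\<And>a b. D' (a + b) = D' a + D' b"
    and E: "\<And>a b. E (a + b) = E a + E b" and ED: "\<And>a. E (D a) = D' (E a)"
  shows "map_poly E (flip D p) = flip D' (map_poly E p)"
proof -
  have 0: "E 0 = 0" "D 0 = 0" "D' 0 = 0" using E[of 0 0] D[of 0 0] D'[of 0 0] by simp_all
  have Em: "E (- a) = - E a" for a using E[of a "- a"] 0 by (simp add: eq_neg_iff_add_eq_0 add.commute)
  have Ed: "E (a - b) = E a - E b" for a b using E[of a "- b"] Em by simp
  show ?thesis
  proof (induction p)
    case 0
    then show ?case by simp
  next
    case (pCons a p)
    have "map_poly E (flip D (pCons a p)) = [:E a:] - lambda_plus D' (map_poly E (flip D p))"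
      unfolding flip_pCons[OF D]
      by (intro poly_eqI) (simp add: coeff_map_poly coeff_lambda_plus coeff_pCons 0 Ed E ED split: nat.split)
    also have "map_poly E (pCons a p) = pCons (E a) (map_poly E p)"
      by (intro poly_eqI) (simp add: coeff_map_poly coeff_pCons 0 split: nat.split)
    ultimately show ?case by (simp add: flip_pCons[OF D'] pCons.IH)
  qed
qed

lemma flip_add:
  assumes "\<And>a b. D (a + b) = D a + D b"
  shows "flip D (p + q) = flip D p + flip D q"
  by (induction p q rule: poly_induct2) (simp_all add: flip_pCons lambda_plus_add assms)

text \<open>The binomial theorem for p(\<lambda> + \<mu>), by Pascal's rule: the outer index m
  counts powers of \<mu>, the inner index n powers of \<lambda>.\<close>

lemma coeff_pcompose_in_second:
  "coeff (coeff (pcompose (in_second p) [:[:0, 1:], 1:]) m) n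
     = of_nat ((n + m) choose m) * coeff (p :: 'v::comm_ring_1 poly) (n + m)"
proof (induction p arbitrary: m n)
  case 0
  then show ?case by (simp add: in_second_def)
next
  case (pCons a p)
  let ?R = "pcompose (in_second p) [:[:0, 1:], 1:]"
  have "in_second (pCons a p) = pCons [:a:] (in_second p)"
    by (intro poly_eqI) (simp add: coeff_pCons split: nat.split)
  then have *: "pcompose (in_second (pCons a p)) [:[:0, 1:], 1:] = [:[:a:]:] + (smult [:0, 1:] ?R + pCons 0 ?R)"
    by (simp add: pcompose_pCons)
  have "coeff (coeff (pcompose (in_second (pCons a p)) [:[:0, 1:], 1:]) m) n
     = (if m = 0 \<and> n = 0 then a else 0) + (case n of 0 \<Rightarrow> 0 | Suc n' \<Rightarrow> coeff (coeff ?R m) n')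
       + (case m of 0 \<Rightarrow> 0 | Suc m' \<Rightarrow> coeff (coeff ?R m') n)"
    unfolding * by (simp add: coeff_pCons split: nat.split)
  then show ?case
    unfolding pCons.IH
    by (cases m; cases n) (simp_all add: coeff_pCons algebra_simps)
qed

text \<open>The coefficient of \<open>\<lambda>\<^sup>n\<close>; the usual \<open>n\<close>-th product is \<open>n!\<close> times this.\<close>
definition np :: "('v \<Rightarrow> 'v \<Rightarrow> 'v::comm_ring_1 poly) \<Rightarrow> nat \<Rightarrow> 'v \<Rightarrow> 'v \<Rightarrow> 'v" where
  "np br n a b = coeff (br a b) n"

text \<open>Compares coefficients of \<open>\<lambda>\<^sup>n \<mu>\<^sup>m\<close>. On the right, l
  powers of \<lambda> come from the inner bracket and the other n - l, with all powers of \<mu>,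
  from a power of \<lambda> + \<mu>, whence the binomial coefficient. The degree bounds drop out
  because a bracket with a zero argument is zero.\<close>

lemma jacobi_coeff_iff:
  assumes l0: "\<And>b. br 0 b = 0" and r0: "\<And>a. br a 0 = 0"
  shows "map_poly (br a) (br b c)
         - (\<Sum>m\<le>degree (br a c). smult (monom 1 m) (in_second (br b (coeff (br a c) m))))
       = (\<Sum>m\<le>degree (br a b). smult (monom 1 m)
            (pcompose (in_second (br (coeff (br a b) m) c)) [:[:0, 1:], 1:]))
     \<longleftrightarrow> (\<forall>m n. np br n a (np br m b c) - np br m b (np br n a c)
       = (\<Sum>l\<le>n. of_nat ((n - l + m) choose m) * np br (n - l + m) (np br l a b) c))"
    (is "?L - ?M = ?R \<longleftrightarrow> _")
proof -
  have L: "coeff (coeff ?L m) n = np br n a (np br m b c)" for m n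
    by (simp add: coeff_map_poly r0 np_def)
  have M: "coeff (coeff ?M m) n = np br m b (np br n a c)" for m n
  proof -
    have "coeff (coeff ?M m) n = (\<Sum>l\<le>degree (br a c). if l = n then np br m b (np br l a c) else 0)"
      by (auto simp: coeff_sum np_def mult_monom smult_monom coeff_monom_mult coeff_pCons
          intro!: sum.cong split: nat.split)
    also have "\<dots> = (if n \<le> degree (br a c) then np br m b (np br n a c) else 0)" by simp
    also have "\<dots> = np br m b (np br n a c)"
      by (auto simp: np_def coeff_eq_0 r0)
    finally show ?thesis .
  qed
  have R: "coeff (coeff ?R m) n
      = (\<Sum>l\<le>n. of_nat ((n - l + m) choose m) * np br (n - l + m) (np br l a b) c)" for m n
  proof -
    have "coeff (coeff ?R m) n = (\<Sum>l\<le>degree (br a b). if l \<le> n then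
        of_nat ((n - l + m) choose m) * np br (n - l + m) (np br l a b) c else 0)"
      by (auto simp: coeff_sum np_def coeff_monom_mult coeff_pcompose_in_second intro!: sum.cong)
    also have "\<dots> = (\<Sum>l\<in>{..degree (br a b)} \<inter> {..n}. of_nat ((n - l + m) choose m) * np br (n - l + m) (np br l a b) c)"
      by (subst sum.inter_restrict) (auto intro!: sum.cong)
    also have "\<dots> = (\<Sum>l\<le>n. of_nat ((n - l + m) choose m) * np br (n - l + m) (np br l a b) c)"
    proof (rule sum.mono_neutral_left)
      have "np br j (np br i a b) c = 0" if "\<not> i \<le> degree (br a b)" for i j
        using that by (simp add: np_def coeff_eq_0 l0)
      then show "\<forall>i\<in>{..n} - {..degree (br a b)} \<inter> {..n}.
          of_nat ((n - i + m) choose m) * np br (n - i + m) (np br i a b) c = 0"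
        by (metis DiffE IntI atMost_iff mult_zero_right)
    qed auto
    finally show ?thesis .
  qed
  have "?L - ?M = ?R \<longleftrightarrow> (\<forall>m n. coeff (coeff (?L - ?M) m) n = coeff (coeff ?R m) n)"
    by (simp add: poly_eq_iff)
  then show ?thesis by (simp only: coeff_diff L M R)
qed

lemma module_map_poly:
  assumes "module scale"
  shows "module (\<lambda>r. map_poly (scale r))"
proof -
  interpret Modules.module scale by fact
  show ?thesis
    by unfold_locales (auto intro!: poly_eqI simp: coeff_map_poly scale_right_distrib scale_left_distrib)
qed

context poisson_vertex_algebra
begin

sublocale Dh: module_hom scale scale D
  using D_derivation by (simp add: algebra_derivation_def)

sublocale brl: module_hom scale "\<lambda>r. map_poly (scale r)" "\<lambda>a. br a b" for b by (rule br_linear_left)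
sublocale brr: module_hom scale "\<lambda>r. map_poly (scale r)" "br a" for a by (rule br_linear_right)

lemma D_mult: "D (a * b) = D a * b + a * D b"
  using D_derivation by (simp add: algebra_derivation_def)

lemma D_1 [simp]: "D 1 = 0"
  using D_mult[of 1 1] by simp

lemma np_add_left: "np br n (a + b) c = np br n a c + np br n b c"
  and np_add_right: "np br n a (b + c) = np br n a b + np br n a c"
  and np_diff_left: "np br n (a - b) c = np br n a c - np br n b c"
  and np_diff_right: "np br n a (b - c) = np br n a b - np br n a c"
  and np_zero_left [simp]: "np br n 0 c = 0"
  and np_zero_right [simp]: "np br n a 0 = 0"
  and np_scale_left: "np br n (scale r a) c = scale r (np br n a c)"
  and np_scale_right: "np br n a (scale r c) = scale r (np br n a c)"
  by (simp_all add: np_def brl.add brr.add brl.diff brr.diff brl.zero brr.zero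
      brl.scale brr.scale coeff_map_poly)

lemma np_sum_right: "np br n a (sum f S) = (\<Sum>x\<in>S. np br n a (f x))"
  by (induction S rule: infinite_finite_induct) (simp_all add: np_add_right)

lemma np_D_left: "np br n (D a) b = - (case n of 0 \<Rightarrow> 0 | Suc k \<Rightarrow> np br k a b)"
  by (simp add: np_def sesquilinear_left coeff_pCons split: nat.split)

lemma np_D_right: "np br n a (D b) = (case n of 0 \<Rightarrow> 0 | Suc k \<Rightarrow> np br k a b) + D (np br n a b)"
  by (simp add: np_def sesquilinear_right coeff_lambda_plus Dh.zero split: nat.split)

lemma np_leibniz: "np br n a (b * c) = np br n a b * c + b * np br n a c"
  by (simp add: np_def leibniz mult.commute)

lemma np_jacobi: "np br n a (np br m b c) - np br m b (np br n a c)
    = (\<Sum>l\<le>n. of_nat ((n - l + m) choose m) * np br (n - l + m) (np br l a b) c)"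
  using jacobi_coeff_iff[of br a b c] jacobi[of a b c] by (simp add: brl.zero brr.zero)

lemma np_jacobi_0: "np br 0 a (np br m b c) - np br m b (np br 0 a c) = np br m (np br 0 a b) c"
  using np_jacobi[of 0 a m b c] by simp

text \<open>For a = L, where the product of order 0 is D and that of order 1 is the weight, this
  identity computes the weight of all other products.\<close>

lemma np_jacobi_1: "np br 1 a (np br m b c) - np br m b (np br 1 a c)
    = of_nat (Suc m) * np br (Suc m) (np br 0 a b) c + np br m (np br 1 a b) c"
  using np_jacobi[of 1 a m b c] by simp

lemma br_skew: "br a b = - flip D (br b a)"
  unfolding flip_def by (rule skewsymmetry)

lemma flip_D_pCons: "flip D (pCons a p) = [:a:] - lambda_plus D (flip D p)"
  by (rule flip_pCons) (rule Dh.add)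

lemma np_one_right [simp]: "np br n a 1 = 0"
  using np_leibniz[of n a 1 1] by simp

lemma np_one_left [simp]: "np br n 1 a = 0"
proof -
  have "br a 1 = 0" using np_one_right[of _ a] by (simp add: np_def poly_eq_iff)
  then have "br 1 a = 0" by (simp add: br_skew[of 1 a])
  then show ?thesis by (simp add: np_def)
qed

end

section \<open>Cocycles\<close>

text \<open>The terms of order \<epsilon> in the axioms for br + \<epsilon> B. They are linear in B,
  so cocycles can be added and corrected without returning to the dual numbers.\<close>

locale pva_cocycle = poisson_vertex_algebra scale D br
  for scale :: "'r::comm_ring_1 \<Rightarrow> 'v::comm_ring_1 \<Rightarrow> 'v" and D br +
  fixes B :: "'v \<Rightarrow> 'v \<Rightarrow> 'v poly"
  assumes B_add_left: "B (a + b) c = B a c + B b c"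
    and B_add_right: "B a (b + c) = B a b + B a c"
    and B_scale_left: "B (scale r a) c = map_poly (scale r) (B a c)"
    and B_scale_right: "B a (scale r c) = map_poly (scale r) (B a c)"
    and B_D_left: "B (D a) b = - ([:0, 1:] * B a b)"
    and B_D_right: "B a (D b) = lambda_plus D (B a b)"
    and B_skew: "B a b = - flip D (B b a)"
    and B_leibniz: "B a (b * c) = smult c (B a b) + smult b (B a c)"
    and B_jacobi: "np br n a (np B m b c) + np B n a (np br m b c)
        - (np br m b (np B n a c) + np B m b (np br n a c))
      = (\<Sum>l\<le>n. of_nat ((n - l + m) choose m) *
           (np br (n - l + m) (np B l a b) c + np B (n - l + m) (np br l a b) c))"
begin

lemma np_B_add_left: "np B n (a + b) c = np B n a c + np B n b c"
  and np_B_add_right: "np B n a (b + c) = np B n a b + np B n a c"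
  and np_B_scale_left: "np B n (scale r a) c = scale r (np B n a c)"
  and np_B_scale_right: "np B n a (scale r c) = scale r (np B n a c)"
  and np_B_leibniz: "np B n a (b * c) = np B n a b * c + b * np B n a c"
  by (simp_all add: np_def B_add_left B_add_right B_scale_left B_scale_right coeff_map_poly
      B_leibniz mult.commute)

lemma np_B_zero [simp]: "np B n 0 c = 0" "np B n a 0 = 0"
  using np_B_add_left[of n 0 0 c] np_B_add_right[of n a 0 0] by simp_all

lemma np_B_D_left: "np B n (D a) b = - (case n of 0 \<Rightarrow> 0 | Suc k \<Rightarrow> np B k a b)"
  by (simp add: np_def B_D_left coeff_pCons split: nat.split)

lemma np_B_D_right: "np B n a (D b) = (case n of 0 \<Rightarrow> 0 | Suc k \<Rightarrow> np B k a b) + D (np B n a b)"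
  by (simp add: np_def B_D_right coeff_lambda_plus Dh.zero split: nat.split)

lemma B_jacobi_0: "np br 0 a (np B m b c) + np B 0 a (np br m b c)
    - (np br m b (np B 0 a c) + np B m b (np br 0 a c)) = np br m (np B 0 a b) c + np B m (np br 0 a b) c"
  using B_jacobi[of 0 a m b c] by simp

lemma B_jacobi_1: "np br 1 a (np B m b c) + np B 1 a (np br m b c)
    - (np br m b (np B 1 a c) + np B m b (np br 1 a c))
  = of_nat (Suc m) * (np br (Suc m) (np B 0 a b) c + np B (Suc m) (np br 0 a b) c)
    + (np br m (np B 1 a b) c + np B m (np br 1 a b) c)"
  using B_jacobi[of 1 a m b c] by simp

end

lemma flip_uminus:
  assumes "\<And>a b. D (a + b) = D a + D b"
  shows "flip D (- p) = - flip D p"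
  using flip_add[of D p "- p"] assms by (simp add: eq_neg_iff_add_eq_0 add.commute)

lemma poisson_vertex_algebra_npI:
  fixes scale :: "'r::comm_ring_1 \<Rightarrow> 'v::comm_ring_1 \<Rightarrow> 'v"
  assumes "comm_algebra scale" and D: "algebra_derivation scale D"
    and add_left: "\<And>n a b c. np br n (a + b) c = np br n a c + np br n b c"
    and add_right: "\<And>n a b c. np br n a (b + c) = np br n a b + np br n a c"
    and scale_left: "\<And>n r a c. np br n (scale r a) c = scale r (np br n a c)"
    and scale_right: "\<And>n r a c. np br n a (scale r c) = scale r (np br n a c)"
    and D_left: "\<And>n a b. np br n (D a) b = - (case n of 0 \<Rightarrow> 0 | Suc k \<Rightarrow> np br k a b)"
    and D_right: "\<And>n a b. np br n a (D b) = (case n of 0 \<Rightarrow> 0 | Suc k \<Rightarrow> np br k a b) + D (np br n a b)"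
    and skew: "\<And>a b. br a b = - flip D (br b a)"
    and leibniz: "\<And>n a b c. np br n a (b * c) = np br n a b * c + b * np br n a c"
    and jacobi: "\<And>n m a b c. np br n a (np br m b c) - np br m b (np br n a c)
       = (\<Sum>l\<le>n. of_nat ((n - l + m) choose m) * np br (n - l + m) (np br l a b) c)"
  shows "poisson_vertex_algebra scale D br"
proof -
  interpret comm_algebra scale by fact
  have mp: "Modules.module (\<lambda>r. map_poly (scale r))" by (rule module_map_poly) unfold_locales
  have D0: "D 0 = 0"
  proof -
    interpret D: module_hom scale scale D using D by (simp add: algebra_derivation_def)
    show ?thesis by (rule D.zero)
  qed
  have l0: "br 0 a = 0" and r0: "br a 0 = 0" for a
    using add_left[of _ 0 0 a] add_right[of _ a 0 0] by (simp_all add: np_def poly_eq_iff)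
  show ?thesis
  proof unfold_locales
    show "algebra_derivation scale D" by (rule D)
    show "br (a + b) c = br a c + br b c" "br a (b + c) = br a b + br a c"
      "br (scale r a) c = map_poly (scale r) (br a c)" "br a (scale r c) = map_poly (scale r) (br a c)"
      "br (D a) b = - ([:0, 1:] * br a b)" "br a (D b) = lambda_plus D (br a b)"
      "br a (b * c) = smult c (br a b) + smult b (br a c)" for a b c r
      using add_left add_right scale_left scale_right D_left D_right leibniz
      by (simp_all add: poly_eq_iff np_def coeff_map_poly coeff_pCons coeff_lambda_plus D0 mult.commute
          split: nat.split)
    show "br a b = - subst_second D (in_second (br b a))" for a b
      using skew unfolding flip_def .
    show "map_poly (br a) (br b c)
         - (\<Sum>m\<le>degree (br a c). smult (monom 1 m) (in_second (br b (coeff (br a c) m))))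
       = (\<Sum>m\<le>degree (br a b). smult (monom 1 m)
            (pcompose (in_second (br (coeff (br a b) m) c)) [:[:0, 1:], 1:]))" for a b c
      unfolding jacobi_coeff_iff[of br, OF l0 r0] using jacobi by blast
  qed (use mp in \<open>simp_all add: Modules.module_def\<close>)
qed

section \<open>Cocycles: linear combinations, the bracket itself, coboundaries\<close>

context poisson_vertex_algebra
begin

lemma pva_cocycle_npI:
  assumes add_left: "\<And>n a b c. np B n (a + b) c = np B n a c + np B n b c"
    and add_right: "\<And>n a b c. np B n a (b + c) = np B n a b + np B n a c"
    and scale_left: "\<And>n r a c. np B n (scale r a) c = scale r (np B n a c)"
    and scale_right: "\<And>n r a c. np B n a (scale r c) = scale r (np B n a c)"
    and D_left: "\<And>n a b. np B n (D a) b = - (case n of 0 \<Rightarrow> 0 | Suc k \<Rightarrow> np B k a b)"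
    and D_right: "\<And>n a b. np B n a (D b) = (case n of 0 \<Rightarrow> 0 | Suc k \<Rightarrow> np B k a b) + D (np B n a b)"
    and skew: "\<And>a b. B a b = - flip D (B b a)"
    and leibniz: "\<And>n a b c. np B n a (b * c) = np B n a b * c + b * np B n a c"
    and jacobi: "\<And>n m a b c. np br n a (np B m b c) + np B n a (np br m b c)
        - (np br m b (np B n a c) + np B m b (np br n a c))
      = (\<Sum>l\<le>n. of_nat ((n - l + m) choose m) *
           (np br (n - l + m) (np B l a b) c + np B (n - l + m) (np br l a b) c))"
  shows "pva_cocycle scale D br B"
proof unfold_locales
  show "B (a + b) c = B a c + B b c" "B a (b + c) = B a b + B a c"
    "B (scale r a) c = map_poly (scale r) (B a c)" "B a (scale r c) = map_poly (scale r) (B a c)"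
    "B (D a) b = - ([:0, 1:] * B a b)" "B a (D b) = lambda_plus D (B a b)"
    "B a (b * c) = smult c (B a b) + smult b (B a c)" for a b c r
    using add_left add_right scale_left scale_right D_left D_right leibniz
    by (simp_all add: poly_eq_iff np_def coeff_map_poly coeff_pCons coeff_lambda_plus Dh.zero
        mult.commute split: nat.split)
qed (fact skew jacobi)+

text \<open>The derivative at t = 1 of the family of brackets t br. It is one ingredient of the
  cocycle that changes the level.\<close>

lemma pva_cocycle_bracket: "pva_cocycle scale D br br"
proof (rule pva_cocycle_npI)
  fix n m a b c
  show "np br n a (np br m b c) + np br n a (np br m b c)
        - (np br m b (np br n a c) + np br m b (np br n a c))
      = (\<Sum>l\<le>n. of_nat ((n - l + m) choose m) *
           (np br (n - l + m) (np br l a b) c + np br (n - l + m) (np br l a b) c))"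
    using np_jacobi[of n a m b c] by (simp add: distrib_left sum.distrib sum_distrib_left algebra_simps)
qed (fact np_add_left np_add_right np_scale_left np_scale_right np_D_left np_D_right br_skew np_leibniz)+

lemma pva_cocycle_diff:
  assumes "pva_cocycle scale D br B" "pva_cocycle scale D br B'"
  shows "pva_cocycle scale D br (\<lambda>a b. B a b - B' a b)"
proof -
  interpret B: pva_cocycle scale D br B by fact
  interpret B': pva_cocycle scale D br B' by fact
  have np: "np (\<lambda>a b. B a b - B' a b) n a b = np B n a b - np B' n a b" for n a b
    by (simp add: np_def)
  show ?thesis
  proof (rule pva_cocycle_npI)
    fix a b
    have "B a b - B' a b = - flip D (B b a) - - flip D (B' b a)"
      using B.B_skew[of a b] B'.B_skew[of a b] by (simp only:)
    then show "B a b - B' a b = - flip D (B b a - B' b a)"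
      using flip_add[of D "B b a" "- B' b a"] flip_uminus[of D "B' b a"] by (simp add: Dh.add)
  next
    fix n m a b c
    show "np br n a (np (\<lambda>a b. B a b - B' a b) m b c) + np (\<lambda>a b. B a b - B' a b) n a (np br m b c)
        - (np br m b (np (\<lambda>a b. B a b - B' a b) n a c) + np (\<lambda>a b. B a b - B' a b) m b (np br n a c))
      = (\<Sum>l\<le>n. of_nat ((n - l + m) choose m) * (np br (n - l + m) (np (\<lambda>a b. B a b - B' a b) l a b) c
          + np (\<lambda>a b. B a b - B' a b) (n - l + m) (np br l a b) c))"
      unfolding np np_diff_left np_diff_right
      using arg_cong2[of _ _ _ _ minus, OF B.B_jacobi[of n a m b c] B'.B_jacobi[of n a m b c]]
      by (simp add: algebra_simps sum_subtractf sum.distrib)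
  qed (simp_all add: np B.np_B_add_left B.np_B_add_right B.np_B_scale_left B.np_B_scale_right
      B.np_B_D_left B.np_B_D_right B.np_B_leibniz B'.np_B_add_left B'.np_B_add_right
      B'.np_B_scale_left B'.np_B_scale_right B'.np_B_D_left B'.np_B_D_right B'.np_B_leibniz
      scale_right_diff_distrib algebra_simps Dh.diff split: nat.split)
qed

lemma scale_mult_right: "a * scale r b = scale r (a * b)"
  using scale_mult_left[of r b a] by (simp add: mult.commute)

lemma D_scale_map: "map_poly (scale r) (flip D p) = flip D (map_poly (scale r) p)"
  by (rule flip_map) (simp_all add: Dh.add Dh.scale scale_right_distrib)

lemma pva_cocycle_scale:
  assumes "pva_cocycle scale D br B"
  shows "pva_cocycle scale D br (\<lambda>a b. map_poly (scale r) (B a b))"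
proof -
  interpret B: pva_cocycle scale D br B by fact
  have np: "np (\<lambda>a b. map_poly (scale r) (B a b)) n a b = scale r (np B n a b)" for n a b
    by (simp add: np_def coeff_map_poly)
  show ?thesis
  proof (rule pva_cocycle_npI)
    fix a b
    have "map_poly (scale r) (- p) = - map_poly (scale r) p" for p
      by (intro poly_eqI) (simp add: coeff_map_poly)
    then show "map_poly (scale r) (B a b) = - flip D (map_poly (scale r) (B b a))"
      by (subst B.B_skew) (simp add: D_scale_map)
  next
    fix n m a b c
    show "np br n a (np (\<lambda>a b. map_poly (scale r) (B a b)) m b c)
        + np (\<lambda>a b. map_poly (scale r) (B a b)) n a (np br m b c)
        - (np br m b (np (\<lambda>a b. map_poly (scale r) (B a b)) n a c)
          + np (\<lambda>a b. map_poly (scale r) (B a b)) m b (np br n a c))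
      = (\<Sum>l\<le>n. of_nat ((n - l + m) choose m) *
          (np br (n - l + m) (np (\<lambda>a b. map_poly (scale r) (B a b)) l a b) c
          + np (\<lambda>a b. map_poly (scale r) (B a b)) (n - l + m) (np br l a b) c))"
      unfolding np np_scale_left np_scale_right
      using arg_cong[of _ _ "scale r", OF B.B_jacobi[of n a m b c]]
      by (simp only: scale_right_diff_distrib scale_right_distrib scale_sum_right scale_mult_right
          distrib_left)
  qed (simp_all add: np B.np_B_add_left B.np_B_add_right B.np_B_scale_left B.np_B_scale_right
      B.np_B_D_left B.np_B_D_right B.np_B_leibniz scale_right_distrib mult.commute
      scale_mult_left scale_mult_right Dh.scale split: nat.split)
qed

text \<open>The defect of \<open>E\<close> from being a derivation of the bracket. The sign is such
  that id + \<epsilon> E carries the deformation by B' + \<open>coboundary E\<close> to the one by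
  B'.\<close>

definition coboundary :: "('v \<Rightarrow> 'v) \<Rightarrow> 'v \<Rightarrow> 'v \<Rightarrow> 'v poly" where
  "coboundary E a b = br (E a) b + br a (E b) - map_poly E (br a b)"

text \<open>The cocycle identity is the sum of the Jacobi identities for (E a, b, c), (a, E b, c)
  and (a, b, E c) minus E applied to the one for (a, b, c).\<close>

lemma pva_cocycle_coboundary:
  assumes E: "algebra_derivation scale E" and ED: "\<And>a. E (D a) = D (E a)"
  shows "pva_cocycle scale D br (coboundary E)"
proof -
  interpret E: module_hom scale scale E using E by (simp add: algebra_derivation_def)
  have E_mult: "E (a * b) = E a * b + a * E b" for a b using E by (simp add: algebra_derivation_def)
  have E_of_nat: "E (of_nat k * a) = of_nat k * E a" for k a
    by (induction k) (simp_all add: E.zero E.add distrib_right)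
  have np: "np (coboundary E) n a b = np br n (E a) b + np br n a (E b) - E (np br n a b)" for n a b
    by (simp add: np_def coboundary_def coeff_map_poly E.zero)
  show ?thesis
  proof (rule pva_cocycle_npI)
    fix a b
    have "map_poly E (- p) = - map_poly E p" for p
      by (intro poly_eqI) (simp add: coeff_map_poly E.neg E.zero)
    then have "map_poly E (br a b) = - flip D (map_poly E (br b a))"
      by (subst br_skew) (simp add: flip_map[of D D E] E.add Dh.add ED)
    moreover have "br (E a) b = - flip D (br b (E a))" "br a (E b) = - flip D (br (E b) a)"
      by (rule br_skew)+
    moreover have "flip D (coboundary E b a)
        = flip D (br (E b) a) + flip D (br b (E a)) - flip D (map_poly E (br b a))"
      using flip_add[of D "br (E b) a + br b (E a)" "- map_poly E (br b a)"]
      by (simp add: coboundary_def flip_add flip_uminus Dh.add)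
    ultimately show "coboundary E a b = - flip D (coboundary E b a)"
      unfolding coboundary_def[of E a b] by simp
  next
    fix n m a b c
    let ?J = "\<lambda>a b c. np br n a (np br m b c) - np br m b (np br n a c)"
    have E_J: "E (?J a b c) = (\<Sum>l\<le>n. of_nat ((n - l + m) choose m) * E (np br (n - l + m) (np br l a b) c))"
      unfolding np_jacobi by (simp only: E.sum E_of_nat)
    have "np br n a (np (coboundary E) m b c) + np (coboundary E) n a (np br m b c)
        - (np br m b (np (coboundary E) n a c) + np (coboundary E) m b (np br n a c))
      = ?J (E a) b c + ?J a (E b) c + ?J a b (E c) - E (?J a b c)"
      by (simp add: np np_add_right np_diff_right E.diff)
    also have "\<dots> = (\<Sum>l\<le>n. of_nat ((n - l + m) choose m) *
        (np br (n - l + m) (np (coboundary E) l a b) c + np (coboundary E) (n - l + m) (np br l a b) c))"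
      unfolding E_J unfolding np_jacobi np np_add_left np_diff_left
      by (simp add: algebra_simps sum.distrib sum_subtractf)
    finally show "np br n a (np (coboundary E) m b c) + np (coboundary E) n a (np br m b c)
        - (np br m b (np (coboundary E) n a c) + np (coboundary E) m b (np br n a c)) = \<dots>" .
  qed (simp_all add: np E.add E.scale E.neg E_mult np_add_left np_add_right np_scale_left np_scale_right
      np_leibniz np_D_left np_D_right ED scale_right_distrib scale_right_diff_distrib Dh.add Dh.diff E.zero
      algebra_simps split: nat.split)
qed

end

section \<open>Deformations and cocycles\<close>

lemma dual_number_eqI: "std x = std y \<Longrightarrow> eps x = eps y \<Longrightarrow> x = y"
  by (cases x; cases y) simp

lemma dual_sel [simp]:
  "std 0 = 0" "eps 0 = 0" "std 1 = 1" "eps 1 = 0" "std (x + y) = std x + std y" "eps (x + y) = eps x + eps y"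
  "std (x - y) = std x - std y" "eps (x - y) = eps x - eps y" "std (- x) = - std x" "eps (- x) = - eps x"
  "std (x * y) = std x * std y" "eps (x * y) = std x * eps y + eps x * std y"
  "std (dual_scale s r z) = s (std r) (std z)"
  "eps (dual_scale s r z) = s (std r) (eps z) + s (eps r) (std z)"
  by (simp_all add: zero_dual_number_def one_dual_number_def plus_dual_number_def
      minus_dual_number_def uminus_dual_number_def times_dual_number_def dual_scale_def)

lemma dual_sum [simp]:
  "std (sum f S) = (\<Sum>x\<in>S. std (f x))" "eps (sum f S) = (\<Sum>x\<in>S. eps (f x))"
  by (induction S rule: infinite_finite_induct) simp_all

lemma dual_of_nat [simp]: "std (of_nat n) = of_nat n" "eps (of_nat n) = 0"
  by (induction n) simp_all

lemma dual_poly_eqI: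
  assumes "map_poly std p = map_poly std q" "map_poly eps p = map_poly eps q"
  shows "p = q"
proof (rule poly_eqI)
  fix n
  have "coeff (map_poly std p) n = coeff (map_poly std q) n"
    "coeff (map_poly eps p) n = coeff (map_poly eps q) n" using assms by simp_all
  then show "coeff p n = coeff q n" by (intro dual_number_eqI) (simp_all add: coeff_map_poly)
qed

context poisson_vertex_algebra
begin

lemma std_np_deformed: "std (np (deformed_bracket br B) n x y) = np br n (std x) (std y)"
  and eps_np_deformed: "eps (np (deformed_bracket br B) n x y)
    = np br n (std x) (eps y) + np br n (eps x) (std y) + np B n (std x) (std y)"
  by (simp_all add: np_def deformed_bracket_def coeff_map_poly zero_dual_number_def[symmetric])

lemma map_std_deformed: "map_poly std (deformed_bracket br B x y) = br (std x) (std y)"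
  and map_eps_deformed: "map_poly eps (deformed_bracket br B x y)
    = br (std x) (eps y) + br (eps x) (std y) + B (std x) (std y)"
  using std_np_deformed[of B _ x y] eps_np_deformed[of B _ x y]
  by (simp_all add: poly_eq_iff coeff_map_poly np_def)

lemma flip_dual:
  "map_poly std (flip (map_dual_number D) p) = flip D (map_poly std p)"
  "map_poly eps (flip (map_dual_number D) p) = flip D (map_poly eps p)"
  by (rule flip_map; auto intro!: dual_number_eqI simp: Dh.add dual_number.map_sel)+

lemma dual_comm_algebra: "comm_algebra (dual_scale scale)"
  by unfold_locales
    (auto intro!: dual_number_eqI simp: scale_right_distrib scale_left_distrib scale_mult_left
      scale_mult_right algebra_simps)

lemma dual_D_derivation: "algebra_derivation (dual_scale scale) (map_dual_number D)"
  unfolding algebra_derivation_def module_hom_iff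
  using dual_comm_algebra
  by (auto intro!: dual_number_eqI
      simp: comm_algebra_def dual_number.map_sel Dh.add Dh.scale D_mult algebra_simps)

text \<open>In the Jacobi identity the part without \<epsilon> is that of br. The \<epsilon> part
  consists of the identity of br with one argument replaced by its \<epsilon> component, once for
  each argument, and of the cocycle identity.\<close>

lemma first_order_deformation_if_cocycle:
  assumes "pva_cocycle scale D br B"
  shows "first_order_deformation scale D br B"
proof -
  interpret B: pva_cocycle scale D br B by fact
  note sels = std_np_deformed eps_np_deformed dual_number.map_sel
  show ?thesis
    unfolding first_order_deformation_def
  proof (rule poisson_vertex_algebra_npI[OF dual_comm_algebra dual_D_derivation])
    fix x y
    have "- br (std y) (std x) = flip D (br (std x) (std y))"
      using br_skew[of "std y" "std x"] by simp
    show "deformed_bracket br B x y = - flip (map_dual_number D) (deformed_bracket br B y x)"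
    proof (rule dual_poly_eqI)
      have neg: "map_poly f (- p) = - map_poly f p" if "f 0 = 0" "\<And>x. f (- x) = - f x"
        for f :: "'v dual_number \<Rightarrow> 'v" and p
        using that by (intro poly_eqI) (simp add: coeff_map_poly)
      show "map_poly std (deformed_bracket br B x y)
          = map_poly std (- flip (map_dual_number D) (deformed_bracket br B y x))"
        by (simp add: neg flip_dual map_std_deformed) (rule br_skew)
      have "br (std x) (eps y) + br (eps x) (std y) + B (std x) (std y)
          = - flip D (br (eps y) (std x)) + - flip D (br (std y) (eps x)) + - flip D (B (std y) (std x))"
        using br_skew[of "std x" "eps y"] br_skew[of "eps x" "std y"] B.B_skew[of "std x" "std y"]
        by (simp only:)
      then show "map_poly eps (deformed_bracket br B x y)
          = map_poly eps (- flip (map_dual_number D) (deformed_bracket br B y x))"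
        by (simp add: neg flip_dual map_eps_deformed flip_add Dh.add)
    qed
  next
    fix n m x y z
    show "np (deformed_bracket br B) n x (np (deformed_bracket br B) m y z)
        - np (deformed_bracket br B) m y (np (deformed_bracket br B) n x z)
      = (\<Sum>l\<le>n. of_nat ((n - l + m) choose m) *
          np (deformed_bracket br B) (n - l + m) (np (deformed_bracket br B) l x y) z)"
    proof (rule dual_number_eqI)
      let ?J = "\<lambda>a b c. np br n a (np br m b c) - np br m b (np br n a c)"
      have "eps (np (deformed_bracket br B) n x (np (deformed_bracket br B) m y z)
          - np (deformed_bracket br B) m y (np (deformed_bracket br B) n x z))
        = ?J (std x) (std y) (eps z) + ?J (std x) (eps y) (std z) + ?J (eps x) (std y) (std z)
          + (np br n (std x) (np B m (std y) (std z)) + np B n (std x) (np br m (std y) (std z))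
        - (np br m (std y) (np B n (std x) (std z)) + np B m (std y) (np br n (std x) (std z))))"
        by (simp add: sels np_add_left np_add_right)
      also have "\<dots> = eps (\<Sum>l\<le>n. of_nat ((n - l + m) choose m) *
          np (deformed_bracket br B) (n - l + m) (np (deformed_bracket br B) l x y) z)"
        unfolding np_jacobi B.B_jacobi by (simp add: sels np_add_left sum.distrib algebra_simps)
      finally show "eps (np (deformed_bracket br B) n x (np (deformed_bracket br B) m y z)
          - np (deformed_bracket br B) m y (np (deformed_bracket br B) n x z)) = \<dots>" .
    qed (simp add: sels np_jacobi)
  qed (auto intro!: dual_number_eqI simp: sels np_add_left np_add_right np_scale_left np_scale_right
      np_leibniz np_D_left np_D_right B.np_B_add_left B.np_B_add_right B.np_B_scale_left
      B.np_B_scale_right B.np_B_leibniz B.np_B_D_left B.np_B_D_right scale_right_distrib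
      Dh.add algebra_simps split: nat.split)
qed

lemma cocycle_if_first_order_deformation:
  assumes "first_order_deformation scale D br B"
  shows "pva_cocycle scale D br B"
proof -
  interpret P: poisson_vertex_algebra "dual_scale scale" "map_dual_number D" "deformed_bracket br B"
    using assms by (simp add: first_order_deformation_def)
  note sels = std_np_deformed eps_np_deformed dual_number.map_sel
  show ?thesis
  proof (rule pva_cocycle_npI)
    show "np B n (a + b) c = np B n a c + np B n b c" for n a b c
      using arg_cong[of _ _ eps, OF P.np_add_left[of n "DN a 0" "DN b 0" "DN c 0"]] by (simp add: sels)
    show "np B n a (b + c) = np B n a b + np B n a c" for n a b c
      using arg_cong[of _ _ eps, OF P.np_add_right[of n "DN a 0" "DN b 0" "DN c 0"]] by (simp add: sels)
    show "np B n (scale r a) c = scale r (np B n a c)" for n r a c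
      using arg_cong[of _ _ eps, OF P.np_scale_left[of n "DN r 0" "DN a 0" "DN c 0"]] by (simp add: sels)
    show "np B n a (scale r c) = scale r (np B n a c)" for n r a c
      using arg_cong[of _ _ eps, OF P.np_scale_right[of n "DN a 0" "DN r 0" "DN c 0"]] by (simp add: sels)
    show "np B n (D a) b = - (case n of 0 \<Rightarrow> 0 | Suc k \<Rightarrow> np B k a b)" for n a b
      using arg_cong[of _ _ eps, OF P.np_D_left[of n "DN a 0" "DN b 0"]]
      by (simp add: sels split: nat.splits)
    show "np B n a (D b) = (case n of 0 \<Rightarrow> 0 | Suc k \<Rightarrow> np B k a b) + D (np B n a b)" for n a b
      using arg_cong[of _ _ eps, OF P.np_D_right[of n "DN a 0" "DN b 0"]]
      by (simp add: sels split: nat.splits)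
    show "B a b = - flip D (B b a)" for a b
    proof -
      have "map_poly eps (deformed_bracket br B (DN a 0) (DN b 0))
          = map_poly eps (- flip (map_dual_number D) (deformed_bracket br B (DN b 0) (DN a 0)))"
        using P.br_skew[of "DN a 0" "DN b 0"] by (rule arg_cong)
      also have "\<dots> = - map_poly eps (flip (map_dual_number D) (deformed_bracket br B (DN b 0) (DN a 0)))"
        by (intro poly_eqI) (simp add: coeff_map_poly)
      finally show ?thesis by (simp add: flip_dual map_eps_deformed brl.zero brr.zero)
    qed
    show "np B n a (b * c) = np B n a b * c + b * np B n a c" for n a b c
      using arg_cong[of _ _ eps, OF P.np_leibniz[of n "DN a 0" "DN b 0" "DN c 0"]]
      by (simp add: sels algebra_simps)
    show "np br n a (np B m b c) + np B n a (np br m b c)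
        - (np br m b (np B n a c) + np B m b (np br n a c))
      = (\<Sum>l\<le>n. of_nat ((n - l + m) choose m) *
           (np br (n - l + m) (np B l a b) c + np B (n - l + m) (np br l a b) c))" for n m a b c
      using arg_cong[of _ _ eps, OF P.np_jacobi[of n "DN a 0" m "DN b 0" "DN c 0"]]
      by (simp add: sels)
  qed
qed

lemma equivalent_if_coboundary:
  assumes E: "algebra_derivation scale E" "\<And>a. E (D a) = D (E a)"
    and B: "\<And>a b. B a b = B' a b + coboundary E a b"
  shows "equivalent_deformations scale D br B B'"
  unfolding equivalent_deformations_def
proof (intro exI[of _ E] conjI allI)
  fix x y
  interpret E: module_hom scale scale E using E by (simp add: algebra_derivation_def)
  show "map_poly (id_plus_eps E) (deformed_bracket br B x y)
      = deformed_bracket br B' (id_plus_eps E x) (id_plus_eps E y)"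
  proof (rule poly_eqI)
    fix n
    have "id_plus_eps E 0 = 0" by (simp add: id_plus_eps_def zero_dual_number_def E.zero)
    moreover have "id_plus_eps E (np (deformed_bracket br B) n x y)
        = np (deformed_bracket br B') n (id_plus_eps E x) (id_plus_eps E y)"
      by (rule dual_number_eqI)
        (simp_all add: id_plus_eps_def std_np_deformed eps_np_deformed np_add_left np_add_right,
         simp add: np_def B coboundary_def coeff_map_poly E.zero)
    ultimately show "coeff (map_poly (id_plus_eps E) (deformed_bracket br B x y)) n
        = coeff (deformed_bracket br B' (id_plus_eps E x) (id_plus_eps E y)) n"
      by (simp add: coeff_map_poly np_def)
  qed
qed (use E in auto)

end

section \<open>The affine Poisson vertex algebra\<close>

locale affine_pva_simple =
  V: affine_pva D br scale lie form k e + simple_lie_algebra_with_form scale lie e form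
  for D :: "('i::finite, 'f::field_char_0) diff_poly \<Rightarrow> ('i, 'f) diff_poly"
    and br :: "('i, 'f) diff_poly \<Rightarrow> ('i, 'f) diff_poly \<Rightarrow> ('i, 'f) diff_poly poly"
    and scale :: "'f \<Rightarrow> 'g::ab_group_add \<Rightarrow> 'g" (infixr "*s" 75)
    and lie form k e +
  assumes k_nonzero: "k \<noteq> 0"
begin

abbreviation u :: "'g \<Rightarrow> ('i, 'f) diff_poly" where
  "u \<equiv> dp_incl scale e"

lemma u_coord: "u x = (\<Sum>i\<in>UNIV. dp_scale (coord x i) (dp_var i 0))"
  by (simp add: dp_incl_def coord_def)

lemma u_add: "u (x + y) = u x + u y"
  by (simp add: u_coord coord_add dp.scale_left_distrib sum.distrib)

lemma u_scale: "u (c *s x) = dp_scale c (u x)"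
  by (simp add: u_coord coord_scale dp.scale_sum_right)

lemma linear_u: "Vector_Spaces.linear scale dp_scale u"
  unfolding Vector_Spaces.linear_iff
  by (simp add: vector_space_axioms dp.vector_space_axioms u_add u_scale)

sublocale u: Vector_Spaces.linear scale dp_scale u by (rule linear_u)

lemma u_e: "u (e i) = dp_var i 0"
proof -
  have "u (e i) = (\<Sum>j\<in>UNIV. if j = i then dp_var j 0 else 0)"
    unfolding u_coord coord_e by (intro sum.cong) auto
  then show ?thesis by simp
qed

definition lin_part :: "('i, 'f) diff_poly \<Rightarrow> 'g" where
  "lin_part p = (\<Sum>i\<in>UNIV. lookup p (Poly_Mapping.single (i, 0) 1) *s e i)"

lemma u_lin_part: "weight_op p = p \<Longrightarrow> u (lin_part p) = p"
  by (subst (2) weight_op_eq_selfD, assumption) (simp add: lin_part_def u.sum u.scale u_e)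

lemma lin_part_u: "lin_part (u x) = x"
proof -
  have eq: "(Poly_Mapping.single (j, 0::nat) (1::nat) = Poly_Mapping.single (i, 0) 1) = (j = i)" for i j :: 'i
    by (metis Pair_inject lookup_single_eq lookup_single_not_eq one_neq_zero)
  have "lookup (u x) (Poly_Mapping.single (i, 0) 1) = coord x i" for i
    by (simp add: u_coord lookup_sum dp_var_def lookup_single when_def eq if_distrib del: One_nat_def cong: if_cong)
  then show ?thesis by (simp add: lin_part_def coord_expand)
qed

lemma u_inject: "u x = u y \<longleftrightarrow> x = y"
  by (metis lin_part_u)

lemma weight_op_u: "weight_op (u x) = u x"
proof -
  have "weight_op (sum f S) = (\<Sum>x\<in>S. weight_op (f x))" for f :: "'i \<Rightarrow> ('i, 'f) diff_poly" and S
    by (induction S rule: infinite_finite_induct)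
      (simp_all add: algebra_derivation_dpD[OF weight_op_derivation])
  then show ?thesis
    by (simp add: u_coord wt_op_scale weight_op_var)
qed

lemma np_u_u: "np br n (u x) (u y) = (if n = 0 then u (lie x y) else if n = 1 then dp_const (k * form x y) else 0)"
  unfolding np_def V.br_generators by (simp add: coeff_pCons split: nat.split)

lemma np_const_left [simp]: "np br n (dp_const c) b = 0"
  by (simp add: dp_const_eq V.np_scale_left)

lemma D_const [simp]: "D (dp_const c) = 0"
  by (simp add: dp_const_eq V.Dh.scale)

lemma np_const_right [simp]: "np br n b (dp_const c) = 0"
  by (simp add: dp_const_eq V.np_scale_right)

lemma np_derivation: "algebra_derivation dp_scale (np br n a)"
  unfolding algebra_derivation_def dp_module_hom_iff
  by (simp add: V.np_add_right V.np_scale_right V.np_leibniz)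

lemma derivation_eq_if_eq_on_generators:
  assumes "algebra_derivation dp_scale E" "algebra_derivation dp_scale E'"
    and "\<And>a. E (D a) = D (E a)" "\<And>a. E' (D a) = D (E' a)" "\<And>x. E (u x) = E' (u x)"
  shows "E p = E' p"
proof (rule algebra_derivation_eqI[OF assms(1,2)])
  fix i n
  show "E (dp_var i n) = E' (dp_var i n)"
  proof (induction n)
    case 0
    then show ?case using assms(5)[of "e i"] by (simp add: u_e)
  next
    case (Suc n)
    then show ?case using assms(3,4) by (simp flip: V.D_var)
  qed
qed

text \<open>Compatibility with D dictates the value \<open>(D ^^ n) (P (e i))\<close> on
  \<open>\<partial>\<^sup>n e\<^sub>i\<close>. The commutator of the resulting derivation with D is
  a derivation that kills all variables.\<close>

lemma derivation_with_values:
  assumes P: "Vector_Spaces.linear scale dp_scale P"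
  shows "\<exists>E. algebra_derivation dp_scale E \<and> (\<forall>a. E (D a) = D (E a)) \<and> (\<forall>x. E (u x) = P x)"
proof -
  interpret P: Vector_Spaces.linear scale dp_scale P by (rule P)
  obtain E where E: "algebra_derivation dp_scale E"
    and Ev: "\<And>i n. E (dp_var i n) = (D ^^ n) (P (e i))"
    using algebra_derivation_exists[of "\<lambda>(i, n). (D ^^ n) (P (e i))"] by auto
  note Er = algebra_derivation_dpD[OF E] and Dr = algebra_derivation_dpD[OF V.D_derivation]
  have "algebra_derivation dp_scale (\<lambda>p. E (D p) - D (E p))"
    unfolding algebra_derivation_def dp_module_hom_iff
    by (simp add: Er Dr dp.scale_right_diff_distrib algebra_simps)
  moreover have "algebra_derivation dp_scale (\<lambda>p :: ('i, 'f) diff_poly. 0)"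
    unfolding algebra_derivation_def dp_module_hom_iff by simp
  ultimately have "E (D p) - D (E p) = 0" for p
    by (rule algebra_derivation_eqI) (simp add: V.D_var Ev)
  moreover have "E (sum f S) = (\<Sum>x\<in>S. E (f x))" for f :: "'i \<Rightarrow> ('i, 'f) diff_poly" and S
    by (induction S rule: infinite_finite_induct) (simp_all add: Er)
  then have "E (u x) = P x" for x
    by (subst coord_expand[of x, symmetric]) (simp add: u_coord Er Ev P.sum P.scale)
  ultimately show ?thesis using E by auto
qed

subsection \<open>The Sugawara element\<close>

text \<open>The factor 1/2 compensates for the two equal contributions of the factors of
  \<open>u (e i) * u (ed i)\<close>, and 1/k for the level in the bracket. No dual Coxeter number is
  added to k because the Leibniz rule of a PVA has no correction term.\<close>

definition L :: "('i, 'f) diff_poly" where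
  "L = dp_scale (inverse (2 * k)) (\<Sum>i\<in>UNIV. u (e i) * u (ed i))"

text \<open>Order zero cancels by invariance of the dual bases. At order one x is paired with each
  of the two factors, and the dual expansions give k u(x) twice.\<close>

lemma np_u_L: "np br n (u x) L = (if n = 1 then u x else 0)"
proof -
  have np: "np br n (u x) L = dp_scale (inverse (2 * k))
      ((\<Sum>i\<in>UNIV. np br n (u x) (u (e i)) * u (ed i)) + (\<Sum>i\<in>UNIV. u (e i) * np br n (u x) (u (ed i))))"
    by (simp add: L_def V.np_scale_right V.np_sum_right V.np_leibniz sum.distrib)
  consider "n = 0" | "n = 1" | "n \<noteq> 0" "n \<noteq> 1" by blast
  then show ?thesis
  proof cases
    case 1
    have "(\<Sum>i\<in>UNIV. u (lie x (e i)) * u (ed i)) = - (\<Sum>i\<in>UNIV. u (e i) * u (lie x (ed i)))"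
      by (rule dual_basis_invariant[of dp_scale "\<lambda>a b. u a * u b"])
        (simp_all add: Vector_Spaces.linear_iff vector_space_axioms dp.vector_space_axioms u_add u_scale
          distrib_left distrib_right dp.scale_mult_left dp_scale_mult_right)
    then show ?thesis unfolding np by (simp add: np_u_u 1)
  next
    case 2
    have "(\<Sum>i\<in>UNIV. dp_const (k * form x (e i)) * u (ed i)) = dp_scale k (u (\<Sum>i\<in>UNIV. form x (e i) *s ed i))"
      by (simp add: dp_scale_def[symmetric] u.sum u.scale dp.scale_sum_right)
    moreover have "(\<Sum>i\<in>UNIV. u (e i) * dp_const (k * form x (ed i))) = dp_scale k (u (\<Sum>i\<in>UNIV. form x (ed i) *s e i))"
      by (simp add: mult.commute[of _ "dp_const _"] dp_scale_def[symmetric] u.sum u.scale dp.scale_sum_right)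
    ultimately have "np br n (u x) L = dp_scale (inverse (2 * k)) (dp_scale k (u x) + dp_scale k (u x))"
      unfolding np by (simp add: 2 np_u_u dual_expand dual_expand')
    also have "dp_scale k (u x) + dp_scale k (u x) = dp_scale (2 * k) (u x)"
      by (simp add: dp.scale_left_distrib[symmetric])
    finally show ?thesis using 2 k_nonzero by simp
  next
    case 3
    then show ?thesis unfolding np by (simp add: np_u_u)
  qed
qed

lemma np_L_u: "np br 0 L (u x) = D (u x)" "np br 1 L (u x) = u x"
proof -
  have "br (u x) L = [:0, u x:]"
    using np_u_L[of _ x] by (intro poly_eqI) (simp add: np_def coeff_pCons split: nat.split)
  then have "br L (u x) = lambda_plus D [:u x:]"
    using V.br_skew[of L "u x"] by (simp add: V.flip_D_pCons lambda_plus_def)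
  then show "np br 0 L (u x) = D (u x)" "np br 1 L (u x) = u x"
    by (simp_all add: np_def coeff_lambda_plus V.Dh.zero)
qed

lemma np_0_L: "np br 0 L p = D p"
  by (rule derivation_eq_if_eq_on_generators[OF np_derivation V.D_derivation])
    (simp_all add: np_L_u V.np_D_right)

text \<open>Both sides are derivations that agree on the underived variables; as the product of
  order 0 with L is D, sesquilinearity adds exactly 1 for each application of D.\<close>

lemma np_1_L: "np br 1 L p = weight_op p"
proof (rule algebra_derivation_eqI[OF np_derivation weight_op_derivation])
  fix i n
  show "np br 1 L (dp_var i n) = weight_op (dp_var i n)"
  proof (induction n)
    case 0
    then show ?case using np_L_u(2)[of "e i"] by (simp add: u_e weight_op_var)
  next
    case (Suc n)
    have "np br 1 L (D (dp_var i n)) = D (dp_var i n) + D (np br 1 L (dp_var i n))"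
      using V.np_D_right[of 1 L "dp_var i n"] np_0_L by simp
    then show ?case
      unfolding Suc weight_op_var V.Dh.scale V.D_var of_nat_Suc[of "Suc n"] dp.scale_left_distrib dp.scale_one .
  qed
qed

lemma weight_op_D: "weight_op (D p) = D p + D (weight_op p)"
  using V.np_D_right[of 1 L p] by (simp add: np_1_L[unfolded One_nat_def] np_0_L)

lemma wt_op_D: "wt_op h (D p) = D (wt_op (\<lambda>w. h (Suc w)) p)"
proof (induction p rule: dp_linear_induct)
  case (1 m)
  have "weight_op (D (dp_mono m)) = dp_scale (of_nat (Suc (wt m))) (D (dp_mono m))"
    by (simp add: weight_op_D wt_op_mono V.Dh.scale dp.scale_left_distrib)
  then have "wt_op h (D (dp_mono m)) = dp_scale (h (Suc (wt m))) (D (dp_mono m))"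
    by (rule wt_op_eigenvector)
  then show ?case by (simp add: wt_op_mono V.Dh.scale)
qed (simp_all add: V.Dh.add V.Dh.scale wt_op_add wt_op_scale)

text \<open>First-order Jacobi identity with L: for homogeneous a and b the product of order m has
  weight wt a + wt b - m - 1.\<close>

lemma weight_op_np: "weight_op (np br m a b)
    = np br m a (weight_op b) + np br m (weight_op a) b - of_nat (Suc m) * np br m a b"
  using V.np_jacobi_1[of L m a b] by (simp add: np_1_L[unfolded One_nat_def] np_0_L V.np_D_left algebra_simps)

text \<open>Sesquilinearity makes p central for the bracket, so its bracket with L is zero and p has
  weight zero.\<close>

lemma D_eq_0D:
  assumes "D p = 0"
  shows "\<exists>c. p = dp_const c"
proof -
  have "br p b = 0" for b
    using V.sesquilinear_left[of p b] assms by (simp add: V.brl.zero)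
  then have "br L p = 0" using V.br_skew[of L p] by simp
  then have "weight_op p = 0" using np_1_L[of p] by (simp add: np_def)
  then show ?thesis using weight_op_eq_0D by blast
qed

subsection \<open>Weight one\<close>

definition w1 :: "('i, 'f) diff_poly \<Rightarrow> ('i, 'f) diff_poly" where
  "w1 = wt_op (\<lambda>w. if w = 1 then 1 else 0)"

text \<open>The inverse of \<open>weight_op - 1\<close> off weight one, where \<open>inverse 0 = 0\<close> makes it vanish.\<close>
definition weight_homotopy :: "('i, 'f) diff_poly \<Rightarrow> ('i, 'f) diff_poly" where
  "weight_homotopy = wt_op (\<lambda>w. inverse (of_nat w - 1))"

lemma weight_op_weight_homotopy: "weight_op (weight_homotopy p) - weight_homotopy p = p - w1 p" (is ?A)
  and weight_homotopy_weight_op: "weight_homotopy (weight_op p - p) = p - w1 p" (is ?B)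
proof -
  have *: "(of_nat w - 1) * inverse (of_nat w - 1 :: 'f) = 1 - (if w = 1 then 1 else 0)" for w
    by (cases "w = 1") auto
  have "of_nat w * (inverse (of_nat w - 1) * x) - inverse (of_nat w - 1) * x
      = ((of_nat w - 1) * inverse (of_nat w - 1)) * x" for w and x :: 'f
    by (simp only: left_diff_distrib mult_1_left mult.assoc)
  then show ?A
    by (intro poly_mapping_eqI) (simp only: weight_homotopy_def w1_def lookup_minus lookup_wt_op *, simp add: left_diff_distrib)
  have "inverse (of_nat w - 1) * (of_nat w * x - x) = ((of_nat w - 1) * inverse (of_nat w - 1)) * x"
    for w and x :: 'f
    by (simp only: left_diff_distrib right_diff_distrib mult_1_left mult_ac)
  then show ?B
    by (intro poly_mapping_eqI) (simp only: weight_homotopy_def w1_def lookup_minus lookup_wt_op *, simp add: left_diff_distrib)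
qed

lemma weight_op_w1: "weight_op (w1 p) = w1 p"
  by (rule poly_mapping_eqI) (auto simp: w1_def)

lemma w1_eq_u: "w1 p = u (lin_part (w1 p))"
  using u_lin_part[OF weight_op_w1] by simp

text \<open>The operator weight + m - 1 is diagonal on monomials, so its image and its kernel meet
  in zero.\<close>

lemma weight_square_eq_0D:
  fixes p q :: "('i, 'f) diff_poly"
  assumes "q = weight_op p + dp_scale (of_nat m - 1) p" "weight_op q + dp_scale (of_nat m - 1) q = 0"
  shows "q = 0"
proof (rule poly_mapping_eqI)
  fix n :: "('i \<times> nat) \<Rightarrow>\<^sub>0 nat"
  let ?w = "of_nat (wt n) + (of_nat m - 1) :: 'f"
  have "lookup q n = ?w * lookup p n" by (subst assms(1)) (simp add: lookup_add distrib_right)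
  moreover have "lookup (weight_op q + dp_scale (of_nat m - 1) q) n = 0" by (simp only: assms(2) lookup_zero)
  then have "?w * lookup q n = 0" by (simp add: lookup_add distrib_right)
  ultimately show "lookup q n = lookup 0 n" by auto
qed

lemma center_trivial:
  assumes "\<And>y. lie x y = 0"
  shows "x = 0"
proof -
  obtain R where R: "Vector_Spaces.linear scale scale R" "\<And>x. R (casimir x) = x"
    "\<And>x y. R (lie x y) = lie x (R y)"
    using casimir_inverse by blast
  interpret R: Vector_Spaces.linear scale scale R by (rule R)
  have "lie (ed i) x = 0" for i
    using assms[of "ed i"] lie_skew[of "ed i" x] by simp
  then have "casimir x = 0" by (simp add: casimir_def lie_r.zero)
  then show ?thesis using R(2)[of x] by (simp add: R.zero)
qed

subsection \<open>Casimir elements\<close>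

text \<open>Pairing with L: the constant term of the bracket of a with L vanishes, so that of L with
  a is (\<lambda> + D) s. Comparing its first two coefficients with D a and the weight of a shows
  that (weight - 1) a is a constant plus a total derivative. The homotopy carries this over to a up
  to weight one, where the centre of g decides.\<close>

lemma casimir_element:
  assumes "\<And>b. np br 0 a b = 0"
  shows "\<exists>c v. a = dp_const c + D v"
proof -
  obtain q where q: "br a L = pCons 0 q"
    using assms[of L] by (cases "br a L") (simp add: np_def)
  define s where "s = flip D q"
  have "br L a = lambda_plus D s"
    using V.br_skew[of L a] q by (simp add: V.flip_D_pCons s_def)
  then have "D a = D (coeff s 0)" and W: "weight_op a = coeff s 0 + D (coeff s 1)"
    using np_0_L[of a] np_1_L[of a] by (simp_all add: np_def coeff_lambda_plus V.Dh.zero)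
  then have "D (a - coeff s 0) = 0" by (simp add: V.Dh.diff)
  then obtain c where "a - coeff s 0 = dp_const c" using D_eq_0D by blast
  then have "weight_op a - a = dp_const (- c) + D (coeff s 1)"
    using W by (simp add: dp_const_eq algebra_simps)
  then have "a - w1 a = weight_homotopy (dp_const (- c)) + weight_homotopy (D (coeff s 1))"
    using weight_homotopy_weight_op[of a] by (simp add: weight_homotopy_def wt_op_add)
  \<comment> \<open>Constants have weight 0, where the homotopy is multiplication by 1/(0 - 1) =
    -1.\<close>
  moreover have "weight_homotopy (dp_const (- c)) = dp_const c"
    by (rule poly_mapping_eqI)
      (auto simp: weight_homotopy_def dp_const_def lookup_single when_def wt_def)
  \<comment> \<open>D raises the weight by one, so an operator that scales by weight passes through
    D with a shifted factor, and total derivatives remain such.\<close>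
  moreover obtain v where "weight_homotopy (D (coeff s 1)) = D v"
    unfolding weight_homotopy_def wt_op_D by blast
  ultimately have "a = w1 a + dp_const c + D v" by (simp add: algebra_simps)
  then have v: "a = u (lin_part (w1 a)) + dp_const c + D v" using w1_eq_u[of a] by (simp only:)
  have "u (lie (lin_part (w1 a)) y) = 0" for y
  proof -
    have "0 = np br 0 (u (lin_part (w1 a)) + dp_const c + D v) (u y)" using assms v by simp
    then show ?thesis by (simp add: V.np_add_left V.np_D_left np_u_u)
  qed
  then have "u (lie (lin_part (w1 a)) y) = u 0" for y unfolding u.zero .
  then have "lin_part (w1 a) = 0" unfolding u_inject by (rule center_trivial)
  then show ?thesis using v by (auto simp: u.zero)
qed

subsection \<open>Derivations\<close>

lemma pva_derivationD:
  assumes "pva_derivation dp_scale D br E"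
  shows "algebra_derivation dp_scale E" "E (D a) = D (E a)"
    "E (np br n a b) = np br n (E a) b + np br n a (E b)"
proof -
  show E: "algebra_derivation dp_scale E" and "E (D a) = D (E a)"
    using assms by (simp_all add: pva_derivation_def)
  have "coeff (map_poly E (br a b)) n = coeff (br (E a) b + br a (E b)) n"
    using assms by (simp add: pva_derivation_def)
  then show "E (np br n a b) = np br n (E a) b + np br n a (E b)"
    by (simp add: np_def coeff_map_poly algebra_derivation_dpD(4)[OF E])
qed

text \<open>E commutes with D, the order zero product with L, so E L is a Casimir element: a
  constant plus D m. Applying E to the order one product of L with u(x) gives (weight - 1) E(u(x))
  as the order zero product of m with u(x). Subtracting the inner derivation of
  \<open>weight_homotopy m\<close> leaves G, which maps the copy of g to weight one and so restricts
  to a derivation of g.\<close>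

lemma pva_derivation_inner:
  assumes "pva_derivation dp_scale D br E"
  shows "\<exists>a. \<forall>b. E b = np br 0 a b"
proof -
  note E = pva_derivationD[OF assms] and Er = algebra_derivation_dpD[OF pva_derivationD(1)[OF assms]]
  have "np br 0 (E L) b = 0" for b
    using E(3)[of 0 L b] by (simp add: np_0_L E(2))
  then obtain c m where m: "E L = dp_const c + D m" using casimir_element by blast
  have E1: "weight_op (E (u x)) - E (u x) = np br 0 m (u x)" for x
    using E(3)[of 1 L "u x"] unfolding np_1_L m
    by (simp add: weight_op_u V.np_add_left V.np_D_left algebra_simps)
  define G where "G p = E p - np br 0 (weight_homotopy m) p" for p
  have G_add: "G (a + b) = G a + G b" and G_scale: "G (dp_scale r a) = dp_scale r (G a)" for a b r
    by (simp_all add: G_def Er V.np_add_right V.np_scale_right dp.scale_right_diff_distrib)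
  have G_np: "G (np br 0 a b) = np br 0 (G a) b + np br 0 a (G b)" for a b
    using V.np_jacobi_0[of "weight_homotopy m" 0 a b]
    by (simp add: G_def E(3) V.np_diff_left V.np_diff_right algebra_simps)
  have G1: "weight_op (G (u x)) = G (u x)" for x
  proof -
    have "weight_op (G (u x)) - G (u x) = np br 0 m (u x) - np br 0 (weight_op (weight_homotopy m) - weight_homotopy m) (u x)"
      using E1[of x]
      by (simp add: G_def algebra_derivation_dpD[OF weight_op_derivation] weight_op_np weight_op_u
          V.np_diff_left algebra_simps)
    also have "\<dots> = np br 0 (w1 m) (u x)"
      by (simp add: weight_op_weight_homotopy V.np_diff_left)
    also have "\<dots> = u (lie (lin_part (w1 m)) x)"
      by (subst w1_eq_u) (simp add: np_u_u)
    finally have *: "u (lie (lin_part (w1 m)) x) = weight_op (G (u x)) + dp_scale (of_nat 0 - 1) (G (u x))"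
      by simp
    \<comment> \<open>This weight-one element is also a value of weight - 1, hence zero.\<close>
    have "u (lie (lin_part (w1 m)) x) = 0"
      by (rule weight_square_eq_0D[OF *]) (simp add: weight_op_u)
    then show ?thesis using * by simp
  qed
  define \<phi> where "\<phi> x = lin_part (G (u x))" for x
  have \<phi>: "u (\<phi> x) = G (u x)" for x
    by (simp add: \<phi>_def u_lin_part G1)
  have "Vector_Spaces.linear scale scale \<phi>"
    unfolding Vector_Spaces.linear_iff u_inject[symmetric] u.add u.scale \<phi>
    by (simp add: vector_space_axioms u.add u.scale G_add G_scale)
  moreover have "\<phi> (lie x y) = lie (\<phi> x) y + lie x (\<phi> y)" for x y
  proof -
    have "G (np br 0 (u x) (u y)) = np br 0 (u (\<phi> x)) (u y) + np br 0 (u x) (u (\<phi> y))"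
      unfolding \<phi> by (rule G_np)
    then have "u (\<phi> (lie x y)) = u (lie (\<phi> x) y + lie x (\<phi> y))"
      unfolding np_u_u by (simp add: \<phi> u.add)
    then show ?thesis by (simp only: u_inject)
  qed
  ultimately obtain d where d: "\<And>y. \<phi> y = lie d y" using derivation_inner by blast
  have "E b = np br 0 (weight_homotopy m + u d) b" for b
  proof (rule derivation_eq_if_eq_on_generators[OF E(1) np_derivation])
    fix x
    have "G (u x) = np br 0 (u d) (u x)" by (simp add: np_u_u d flip: \<phi>)
    then show "E (u x) = np br 0 (weight_homotopy m + u d) (u x)"
      by (simp add: G_def V.np_add_left algebra_simps)
  qed (simp_all add: E(2) V.np_D_right)
  then show ?thesis by blast
qed

end

context affine_pva_simple
begin

subsection \<open>Deformations\<close>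

lemma cocycle_np_derivation:
  assumes "pva_cocycle dp_scale D br B"
  shows "algebra_derivation dp_scale (np B n a)"
proof -
  interpret B: pva_cocycle dp_scale D br B by fact
  show ?thesis
    unfolding algebra_derivation_def dp_module_hom_iff
    by (simp add: B.np_B_add_right B.np_B_scale_right B.np_B_leibniz)
qed

lemma zero_derivation: "algebra_derivation dp_scale (\<lambda>p :: ('i, 'f) diff_poly. 0)"
  unfolding algebra_derivation_def dp_module_hom_iff by simp

text \<open>The Leibniz rule is available in the right argument only, so the vanishing spreads in
  stages: over the right argument, to derivatives of generators on the left by sesquilinearity, and
  to arbitrary elements on the left by skewsymmetry.\<close>

lemma cocycle_eq_0_if_zero_on_generators:
  assumes "pva_cocycle dp_scale D br B" and zero: "\<And>n x y. np B n (u x) (u y) = 0"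
  shows "B a b = 0"
proof -
  interpret B: pva_cocycle dp_scale D br B by fact
  note der = cocycle_np_derivation[OF assms(1)]
  have 1: "np B n (u x) p = 0" for n x p
  proof (rule algebra_derivation_eqI[OF der zero_derivation])
    show "np B n (u x) (dp_var i j) = 0" for i j
    proof (induction j arbitrary: n)
      case 0
      then show ?case using zero[of n x "e i"] by (simp add: u_e)
    next
      case (Suc j)
      then show ?case
        using B.np_B_D_right[of n "u x" "dp_var i j"] by (simp add: V.D_var V.Dh.zero split: nat.splits)
    qed
  qed
  have 2: "np B n (dp_var i j) p = 0" for n i j p
  proof (induction j arbitrary: n)
    case 0
    then show ?case using 1[of n "e i" p] by (simp add: u_e)
  next
    case (Suc j)
    then show ?case
      using B.np_B_D_left[of n "dp_var i j" p] by (simp add: V.D_var split: nat.splits)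
  qed
  have 3: "np B n p (dp_var i j) = 0" for n p i j
  proof -
    have "B (dp_var i j) p = 0" using 2 by (simp add: poly_eq_iff np_def)
    then have "B p (dp_var i j) = 0" using B.B_skew[of p "dp_var i j"] by simp
    then show ?thesis by (simp add: np_def)
  qed
  have "np B n a b = 0" for n
    by (rule algebra_derivation_eqI[OF der zero_derivation 3])
  then show ?thesis by (simp add: poly_eq_iff np_def)
qed

lemma np_coboundary:
  assumes "algebra_derivation dp_scale E"
  shows "np (V.coboundary E) n a b = np br n (E a) b + np br n a (E b) - E (np br n a b)"
  by (simp add: np_def V.coboundary_def coeff_map_poly algebra_derivation_dpD[OF assms])

lemma np_diff_fun: "np (\<lambda>a b. B a b - B' a b) n a b = np B n a b - np B' n a b"
  by (simp add: np_def)

text \<open>The derivation is the contraction of the cocycle with the Sugawara element, corrected by an inner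
  derivation of the bracket so that it commutes with \<open>D\<close>.\<close>
lemma cocycle_weight_homotopy:
  assumes "pva_cocycle dp_scale D br B"
  shows "\<exists>E. algebra_derivation dp_scale E \<and> (\<forall>a. E (D a) = D (E a)) \<and>
    (\<forall>m x y. weight_op (np B m (u x) (u y)) + dp_scale (of_nat m - 1) (np B m (u x) (u y))
      = np (V.coboundary E) m (u x) (u y))"
proof -
  interpret B: pva_cocycle dp_scale D br B by fact
  \<comment> \<open>This is the order zero cocycle identity for L; the terms in which B meets
    \<open>np br 0 L\<close> = D cancel by sesquilinearity of B.\<close>
  have "pva_derivation dp_scale D br (np B 0 L)"
  proof -
    have "map_poly (np B 0 L) (br b c) = br (np B 0 L b) c + br b (np B 0 L c)" for b c
    proof (rule poly_eqI)
      fix m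
      have "np B 0 L (np br m b c) = np br m (np B 0 L b) c + np br m b (np B 0 L c)"
        using B.B_jacobi_0[of L m b c]
        by (simp add: np_0_L B.np_B_D_left B.np_B_D_right algebra_simps split: nat.splits)
      then show "coeff (map_poly (np B 0 L) (br b c)) m = coeff (br (np B 0 L b) c + br b (np B 0 L c)) m"
        by (simp add: coeff_map_poly np_def[of br])
    qed
    then show ?thesis
      by (simp add: pva_derivation_def cocycle_np_derivation[OF assms] B.np_B_D_right)
  qed
  then obtain f where f: "\<And>b. np B 0 L b = np br 0 f b" using pva_derivation_inner by blast
  \<comment> \<open>\<open>np B 1 L\<close> and \<open>np br 1 f\<close> have the same commutator
    with D, namely \<open>np B 0 L\<close> = \<open>np br 0 f\<close>.\<close>
  define E where "E p = np B 1 L p - np br 1 f p" for p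
  have E: "algebra_derivation dp_scale E"
    unfolding algebra_derivation_def dp_module_hom_iff E_def
    by (simp add: B.np_B_add_right B.np_B_scale_right B.np_B_leibniz V.np_add_right V.np_scale_right
        V.np_leibniz dp.scale_right_diff_distrib algebra_simps)
  have ED: "E (D p) = D (E p)" for p
    by (simp add: E_def B.np_B_D_right V.np_D_right f V.Dh.diff)
  have "weight_op (np B m (u x) (u y)) + dp_scale (of_nat m - 1) (np B m (u x) (u y))
      = np (V.coboundary E) m (u x) (u y)" for m x y
  proof -
    let ?a = "u x" and ?b = "u y"
    have 1: "weight_op (np B m ?a ?b) + np B 1 L (np br m ?a ?b) - (np br m ?a (np B 1 L ?b) + np B m ?a ?b)
        = of_nat (Suc m) * (np br (Suc m) (np br 0 f ?a) ?b - np B m ?a ?b)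
          + (np br m (np B 1 L ?a) ?b + np B m ?a ?b)"
      using B.B_jacobi_1[of L m ?a ?b] unfolding np_1_L np_0_L f weight_op_u
      by (simp only: B.np_B_D_left nat.case diff_conv_add_uminus)
    \<comment> \<open>Cancels the term of order m + 1 in f, which comes from the order zero
      contraction of B with L.\<close>
    have 2: "np br 1 f (np br m ?a ?b) - np br m ?a (np br 1 f ?b)
        = of_nat (Suc m) * np br (Suc m) (np br 0 f ?a) ?b + np br m (np br 1 f ?a) ?b"
      by (rule V.np_jacobi_1)
    show ?thesis
      using 1 2 unfolding dp_scale_of_nat_minus_one np_coboundary[OF E] E_def V.np_diff_left V.np_diff_right
      by (simp add: right_diff_distrib algebra_simps)
  qed
  then show ?thesis using E ED by blast
qed

text \<open>On generators, weight + m - 1 turns the coboundary of E' into the coboundary with values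
  (weight - 1) E'. Taking for E' the homotopy applied to E leaves the coboundary Z of the weight-one
  part of E. It lies in the image of weight + m - 1 and in its kernel, hence is zero.\<close>

lemma cocycle_weight_one:
  assumes "pva_cocycle dp_scale D br B"
  shows "\<exists>E. algebra_derivation dp_scale E \<and> (\<forall>a. E (D a) = D (E a)) \<and>
    (\<forall>m x y. weight_op (np B m (u x) (u y) - np (V.coboundary E) m (u x) (u y))
      + dp_scale (of_nat m - 1) (np B m (u x) (u y) - np (V.coboundary E) m (u x) (u y)) = 0)"
proof -
  obtain E where E: "algebra_derivation dp_scale E" "\<And>a. E (D a) = D (E a)"
    "\<And>m x y. weight_op (np B m (u x) (u y)) + dp_scale (of_nat m - 1) (np B m (u x) (u y))
      = np (V.coboundary E) m (u x) (u y)"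
    using cocycle_weight_homotopy[OF assms] by blast
  note Er = algebra_derivation_dpD[OF E(1)]
  have "Vector_Spaces.linear scale dp_scale (\<lambda>x. weight_homotopy (E (u x)))"
    unfolding Vector_Spaces.linear_iff
    by (simp add: vector_space_axioms dp.vector_space_axioms u_add u_scale Er weight_homotopy_def wt_op_add wt_op_scale)
  then obtain E' where E': "algebra_derivation dp_scale E'" "\<And>a. E' (D a) = D (E' a)"
    "\<And>x. E' (u x) = weight_homotopy (E (u x))"
    using derivation_with_values by blast
  note Er' = algebra_derivation_dpD[OF E'(1)] and Wr = algebra_derivation_dpD[OF weight_op_derivation]
  define \<psi> where "\<psi> x = lin_part (w1 (E (u x)))" for x
  have \<psi>: "u (\<psi> x) = w1 (E (u x))" for x unfolding \<psi>_def by (rule w1_eq_u[symmetric])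
  have W': "weight_op (E' (u x)) = E' (u x) + E (u x) - u (\<psi> x)" for x
    using weight_op_weight_homotopy[of "E (u x)"] by (simp add: E'(3) \<psi> algebra_simps)
  have "weight_op p + dp_scale (of_nat m - 1) p = 0"
    if p_def: "p = np B m (u x) (u y) - np (V.coboundary E') m (u x) (u y)" for p m x y
  proof -
    define Z where "Z = np br m (u (\<psi> x)) (u y) + np br m (u x) (u (\<psi> y))
      - (if m = 0 then u (\<psi> (lie x y)) else 0)"
    have l: "weight_op (np br m (E' (u x)) (u y)) + dp_scale (of_nat m - 1) (np br m (E' (u x)) (u y))
        = np br m (E (u x)) (u y) - np br m (u (\<psi> x)) (u y)"
      unfolding weight_op_np W' weight_op_u dp_scale_of_nat_minus_one
      by (simp add: V.np_add_left V.np_diff_left algebra_simps)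
    have r: "weight_op (np br m (u x) (E' (u y))) + dp_scale (of_nat m - 1) (np br m (u x) (E' (u y)))
        = np br m (u x) (E (u y)) - np br m (u x) (u (\<psi> y))"
      unfolding weight_op_np W' weight_op_u dp_scale_of_nat_minus_one
      by (simp add: V.np_add_right V.np_diff_right algebra_simps)
    have c: "weight_op (E' (np br m (u x) (u y))) + dp_scale (of_nat m - 1) (E' (np br m (u x) (u y)))
        = E (np br m (u x) (u y)) - (if m = 0 then u (\<psi> (lie x y)) else 0)"
      by (auto simp: np_u_u W' Er Er' Wr dp.scale_left_diff_distrib)
    have "weight_op p + dp_scale (of_nat m - 1) p
        = (weight_op (np B m (u x) (u y)) + dp_scale (of_nat m - 1) (np B m (u x) (u y)))
        - (weight_op (np br m (E' (u x)) (u y)) + dp_scale (of_nat m - 1) (np br m (E' (u x)) (u y)))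
        - (weight_op (np br m (u x) (E' (u y))) + dp_scale (of_nat m - 1) (np br m (u x) (E' (u y))))
        + (weight_op (E' (np br m (u x) (u y))) + dp_scale (of_nat m - 1) (E' (np br m (u x) (u y))))"
      unfolding p_def np_coboundary[OF E'(1)] Wr dp.scale_right_diff_distrib dp.scale_right_distrib
      by (simp only: algebra_simps)
    also have "\<dots> = Z"
      unfolding l r c E(3) np_coboundary[OF E(1)] Z_def by simp
    finally have Z: "Z = weight_op p + dp_scale (of_nat m - 1) p" ..
    \<comment> \<open>At order 0 the element Z lies in the copy of g, at order 1 it is a constant,
      and beyond that it vanishes.\<close>
    have "weight_op Z + dp_scale (of_nat m - 1) Z = 0"
    proof -
      have "weight_op (dp_const c) = 0" for c by (rule Wr)
      then show ?thesis
        unfolding Z_def np_u_u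
        by (cases "m = 0"; cases "m = 1")
          (simp_all add: Wr weight_op_u dp.scale_left_diff_distrib dp.scale_minus_left)
    qed
    then have "Z = 0" by (rule weight_square_eq_0D[OF Z])
    then show ?thesis using Z by simp
  qed
  then show ?thesis using E'(1,2) by blast
qed

text \<open>E counts the polynomial degree. On generators its coboundary is [x, y] + 2 k \<lambda>
  (x|y): two from the arguments, less the degree of each term of the bracket. Subtracting br leaves
  k \<lambda> (x|y), and the cocycle property on the whole algebra is inherited.\<close>

lemma standard_cocycle_exists:
  "\<exists>B. pva_cocycle dp_scale D br B \<and> (\<forall>x y. B (u x) (u y) = [:0, dp_const (form x y):])"
proof -
  obtain E where E: "algebra_derivation dp_scale E" "\<And>a. E (D a) = D (E a)" "\<And>x. E (u x) = u x"
    using derivation_with_values[OF linear_u] by blast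
  note Er = algebra_derivation_dpD[OF E(1)]
  define B where "B a b = map_poly (dp_scale (inverse k)) (V.coboundary E a b - br a b)" for a b
  have "pva_cocycle dp_scale D br B"
    unfolding B_def
    by (intro V.pva_cocycle_scale V.pva_cocycle_diff V.pva_cocycle_coboundary V.pva_cocycle_bracket E)
  moreover have "B (u x) (u y) = [:0, dp_const (form x y):]" for x y
  proof (rule poly_eqI)
    fix n
    have "coeff (B (u x) (u y)) n = dp_scale (inverse k) (np (V.coboundary E) n (u x) (u y) - np br n (u x) (u y))"
      by (simp add: B_def coeff_map_poly np_def)
    also have "\<dots> = (if n = 1 then dp_const (form x y) else 0)"
      using k_nonzero by (simp add: np_coboundary[OF E(1)] E(3) Er np_u_u) (simp add: dp_const_eq)
    also have "\<dots> = coeff [:0, dp_const (form x y):] n"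
      by (simp add: coeff_pCons split: nat.split)
    finally show "coeff (B (u x) (u y)) n = \<dots>" .
  qed
  ultimately show ?thesis by blast
qed

text \<open>Nondegeneracy writes \<sigma>(x, y) as (T x | y), and invariance of both forms puts T
  into the centroid.\<close>

lemma scalar_form:
  assumes centroid: "scalar_centroid scale lie"
    and l: "\<And>x y z. \<sigma> (x + y) z = \<sigma> x z + \<sigma> y z" "\<And>c x z. \<sigma> (c *s x) z = c * \<sigma> x z"
    and r: "\<And>x y z. \<sigma> x (y + z) = \<sigma> x y + \<sigma> x z" "\<And>c x z. \<sigma> x (c *s z) = c * \<sigma> x z"
    and inv: "\<And>x y z. \<sigma> (lie x y) z = - \<sigma> y (lie x z)"
  shows "\<exists>c. \<forall>x y. \<sigma> x y = c * form x y"
proof -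
  define T where "T x = (\<Sum>i\<in>UNIV. \<sigma> x (e i) *s ed i)" for x
  have T: "form (T x) y = \<sigma> x y" for x y
  proof -
    have "\<sigma> x 0 = 0" using r(1)[of x 0 0] by simp
    then have sum: "\<sigma> x (sum f S) = (\<Sum>i\<in>S. \<sigma> x (f i))" for f :: "'i \<Rightarrow> 'g" and S
      by (induction S rule: infinite_finite_induct) (simp_all add: r)
    have "form (T x) y = (\<Sum>i\<in>UNIV. form y (ed i) * \<sigma> x (e i))"
      by (simp add: T_def form_sum_left form_scale_left form_symmetric[of "ed _" y] mult.commute)
    also have "\<dots> = \<sigma> x (\<Sum>i\<in>UNIV. form y (ed i) *s e i)" by (simp add: sum r)
    finally show ?thesis by (simp add: dual_expand)
  qed
  have eqI: "a = b" if "\<And>y. form a y = form b y" for a b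
  proof -
    have "a - b = 0" by (rule form_nondegenerate) (simp add: form_diff_left that)
    then show ?thesis by simp
  qed
  have "Vector_Spaces.linear scale scale T"
    unfolding Vector_Spaces.linear_iff
    by (auto simp: vector_space_axioms form_add_left form_scale_left T l intro!: eqI)
  moreover have "T (lie x y) = lie x (T y)" for x y
    by (rule eqI) (simp add: T inv form_lie_swap)
  ultimately obtain c where "\<And>x. T x = c *s x"
    using centroid unfolding scalar_centroid_def by blast
  then have "\<sigma> x y = c * form x y" for x y using T[of x y] by (simp add: form_scale_left)
  then show ?thesis by blast
qed

lemma dp_const_inject: "dp_const a = dp_const b \<longleftrightarrow> a = b"
  unfolding dp_const_def by (metis lookup_single_eq)

text \<open>After \<open>cocycle_weight_one\<close>, the weights leave on generators only a bracket
  \<open>\<omega>\<close> of order 0 and a form \<open>\<sigma>\<close> of order 1. The order zero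
  cocycle identity makes \<open>\<omega>\<close> a 2-cocycle of g in the adjoint module, hence
  trivial; removing it changes \<open>\<sigma>\<close> into an invariant form.\<close>

lemma cocycle_classification:
  assumes centroid: "scalar_centroid scale lie"
    and B: "pva_cocycle dp_scale D br B"
    and B1: "pva_cocycle dp_scale D br B1" "\<And>x y. B1 (u x) (u y) = [:0, dp_const (form x y):]"
  shows "\<exists>c E. algebra_derivation dp_scale E \<and> (\<forall>a. E (D a) = D (E a)) \<and>
    (\<forall>a b. B a b = map_poly (dp_scale c) (B1 a b) + V.coboundary E a b)"
proof -
  obtain E where E: "algebra_derivation dp_scale E" "\<And>a. E (D a) = D (E a)"
    "\<And>m x y. weight_op (np B m (u x) (u y) - np (V.coboundary E) m (u x) (u y))
      + dp_scale (of_nat m - 1) (np B m (u x) (u y) - np (V.coboundary E) m (u x) (u y)) = 0"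
    using cocycle_weight_one[OF B] by blast
  define C where "C a b = B a b - V.coboundary E a b" for a b
  have C: "pva_cocycle dp_scale D br C"
    unfolding C_def by (intro V.pva_cocycle_diff B V.pva_cocycle_coboundary E)
  interpret C: pva_cocycle dp_scale D br C by (rule C)
  have W: "weight_op (np C m (u x) (u y)) + dp_scale (of_nat m - 1) (np C m (u x) (u y)) = 0" for m x y
    using E(3)[of m x y] unfolding C_def np_diff_fun .
  define \<omega> where "\<omega> x y = lin_part (np C 0 (u x) (u y))" for x y
  define \<sigma> where "\<sigma> x y = lookup (np C 1 (u x) (u y)) 0" for x y
  have \<omega>: "np C 0 (u x) (u y) = u (\<omega> x y)" for x y
    unfolding \<omega>_def by (rule u_lin_part[symmetric]) (use W[of 0 x y] in simp)
  have \<sigma>: "np C 1 (u x) (u y) = dp_const (\<sigma> x y)" for x y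
    unfolding \<sigma>_def by (rule weight_op_eq_0D) (use W[of 1 x y] in simp)
  \<comment> \<open>The factor weight + m - 1 is positive for m \<ge> 2.\<close>
  have C2: "np C m (u x) (u y) = 0" if "m \<ge> 2" for m x y
  proof (rule poly_mapping_eqI)
    fix n :: "('i \<times> nat) \<Rightarrow>\<^sub>0 nat"
    have "lookup (weight_op (np C m (u x) (u y)) + dp_scale (of_nat m - 1) (np C m (u x) (u y))) n = 0"
      unfolding W by simp
    then have "(of_nat (wt n) + of_nat (m - 1)) * lookup (np C m (u x) (u y)) n = 0"
      using that by (simp add: lookup_add distrib_right of_nat_diff)
    then have "of_nat (wt n + (m - 1)) * lookup (np C m (u x) (u y)) n = 0" by (simp only: of_nat_add)
    then show "lookup (np C m (u x) (u y)) n = lookup 0 n"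
      using that unfolding mult_eq_0_iff of_nat_eq_0_iff by auto
  qed
  have C_poly: "C (u x) (u y) = [:u (\<omega> x y), dp_const (\<sigma> x y):]" for x y
  proof (rule poly_eqI)
    fix n
    show "coeff (C (u x) (u y)) n = coeff [:u (\<omega> x y), dp_const (\<sigma> x y):] n"
      using \<omega>[of x y] \<sigma>[of x y] C2[of n x y]
      by (auto simp: np_def coeff_pCons numeral_2_eq_2 split: nat.split)
  qed
  have skew: "\<omega> x y = - \<omega> y x" for x y
  proof -
    have "C (u x) (u y) = - ([:u (\<omega> y x):] - lambda_plus D [:dp_const (\<sigma> y x):])"
      using C.B_skew[of "u x" "u y"] unfolding C_poly
      by (simp add: V.flip_D_pCons lambda_plus_def)
    then have "coeff (C (u x) (u y)) 0 = - u (\<omega> y x)"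
      by (simp add: coeff_lambda_plus V.Dh.zero)
    then have "u (\<omega> x y) = u (- \<omega> y x)" by (simp add: C_poly u.neg)
    then show ?thesis by (simp only: u_inject)
  qed
  have \<omega>_l: "Vector_Spaces.linear scale scale (\<lambda>x. \<omega> x y)" for y
    unfolding Vector_Spaces.linear_iff u_inject[symmetric] u_add u_scale \<omega>[symmetric]
    by (simp add: vector_space_axioms C.np_B_add_left C.np_B_scale_left)
  have \<omega>_r: "Vector_Spaces.linear scale scale (\<omega> x)" for x
    unfolding Vector_Spaces.linear_iff u_inject[symmetric] u_add u_scale \<omega>[symmetric]
    by (simp add: vector_space_axioms C.np_B_add_right C.np_B_scale_right)
  have coc: "lie x (\<omega> y z) + \<omega> x (lie y z) - lie y (\<omega> x z) - \<omega> y (lie x z) = \<omega> (lie x y) z + lie (\<omega> x y) z"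
    for x y z
  proof -
    have "u (lie x (\<omega> y z) + \<omega> x (lie y z) - lie y (\<omega> x z) - \<omega> y (lie x z)) = u (\<omega> (lie x y) z + lie (\<omega> x y) z)"
      using C.B_jacobi_0[of "u x" 0 "u y" "u z"]
      by (simp add: \<omega> np_u_u u.add u.diff algebra_simps)
    then show ?thesis by (simp only: u_inject)
  qed
  obtain \<phi> where \<phi>: "Vector_Spaces.linear scale scale \<phi>"
    "\<And>x y. \<omega> x y = lie (\<phi> x) y + lie x (\<phi> y) - \<phi> (lie x y)"
    using two_cocycle_trivial[OF \<omega>_l \<omega>_r skew coc] by blast
  have "Vector_Spaces.linear scale dp_scale (\<lambda>x. u (\<phi> x))"
    using Vector_Spaces.linear_compose[OF \<phi>(1) linear_u] by (simp add: o_def)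
  then obtain E' where E': "algebra_derivation dp_scale E'" "\<And>a. E' (D a) = D (E' a)"
    "\<And>x. E' (u x) = u (\<phi> x)"
    using derivation_with_values by blast
  note Er' = algebra_derivation_dpD[OF E'(1)]
  define F where "F a b = C a b - V.coboundary E' a b" for a b
  have F: "pva_cocycle dp_scale D br F"
    unfolding F_def by (intro V.pva_cocycle_diff C V.pva_cocycle_coboundary E')
  interpret F: pva_cocycle dp_scale D br F by (rule F)
  \<comment> \<open>Subtracting the coboundary of the derivation that extends \<open>\<phi>\<close>
    also alters the form, by k times its variation under \<open>\<phi>\<close>.\<close>
  define \<tau> where "\<tau> x y = \<sigma> x y - k * (form (\<phi> x) y + form x (\<phi> y))" for x y
  have np_F: "np F n (u x) (u y) = (if n = 1 then dp_const (\<tau> x y) else 0)" for n x y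
  proof -
    have *: "np F n (u x) (u y) = np C n (u x) (u y)
        - (np br n (u (\<phi> x)) (u y) + np br n (u x) (u (\<phi> y)) - E' (np br n (u x) (u y)))"
      unfolding F_def np_diff_fun np_coboundary[OF E'(1)] E'(3) ..
    consider "n = 0" | "n = 1" | "n \<ge> 2" by linarith
    then show ?thesis
    proof cases
      case 1
      then show ?thesis unfolding * by (simp add: \<omega> np_u_u E'(3) \<phi>(2) u.add u.diff)
    next
      case 2
      have "np F n (u x) (u y) = dp_const (\<sigma> x y) - (dp_const (k * form (\<phi> x) y) + dp_const (k * form x (\<phi> y)))"
        unfolding * unfolding 2 \<sigma> np_u_u by (simp add: Er')
      also have "\<dots> = dp_const (\<tau> x y)"
        by (simp add: \<tau>_def dp_const_eq dp.scale_left_diff_distrib dp.scale_left_distrib algebra_simps)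
      finally show ?thesis using 2 by simp
    next
      case 3
      then show ?thesis unfolding * by (simp add: C2 np_u_u Er')
    qed
  qed
  have np_F_const: "np F n a (dp_const c) = 0" for n a c
    by (rule algebra_derivation_dpD(6)[OF cocycle_np_derivation[OF F]])
  have "\<exists>c. \<forall>x y. \<tau> x y = c * form x y"
  proof (rule scalar_form[OF centroid])
    \<comment> \<open>Coefficient of \<open>\<lambda>\<^sup>0 \<mu>\<^sup>1\<close> in the cocycle
      identity: F has no order zero part on generators, and terms with a constant argument
      vanish.\<close>
    show "\<tau> (lie x y) z = - \<tau> y (lie x z)" for x y z
    proof -
      have "- dp_const (\<tau> y (lie x z)) = (dp_const (\<tau> (lie x y) z) :: ('i, 'f) diff_poly)"
        using F.B_jacobi_0[of "u x" 1 "u y" "u z"] by (simp add: np_F np_u_u np_F_const)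
      then have "dp_const (\<tau> (lie x y) z) = (dp_const (- \<tau> y (lie x z)) :: ('i, 'f) diff_poly)"
        by (simp add: dp_const_eq)
      then show ?thesis by (simp only: dp_const_inject)
    qed
    have inject: "a = b \<longleftrightarrow> dp_const a = (dp_const b :: ('i, 'f) diff_poly)" for a b
      by (simp only: dp_const_inject)
    have np1: "dp_const (\<tau> x y) = np F 1 (u x) (u y)" for x y by (simp add: np_F)
    have c_add: "dp_const a + dp_const b = (dp_const (a + b) :: ('i, 'f) diff_poly)"
      and c_scale: "dp_scale a (dp_const b) = (dp_const (a * b) :: ('i, 'f) diff_poly)" for a b
      by (simp_all add: dp_const_eq dp.scale_left_distrib)
    show "\<tau> (x + y) z = \<tau> x z + \<tau> y z" "\<tau> z (x + y) = \<tau> z x + \<tau> z y" for x y z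
      unfolding inject c_add[symmetric] np1 u_add
      by (rule F.np_B_add_left F.np_B_add_right)+
    show "\<tau> (c *s x) z = c * \<tau> x z" "\<tau> z (c *s x) = c * \<tau> z x" for c x z
      unfolding inject c_scale[symmetric] np1 u_scale
      by (rule F.np_B_scale_left F.np_B_scale_right)+
  qed
  then obtain c where c: "\<And>x y. \<tau> x y = c * form x y" by blast
  have "F a b - map_poly (dp_scale c) (B1 a b) = 0" for a b
  proof (rule cocycle_eq_0_if_zero_on_generators)
    show "pva_cocycle dp_scale D br (\<lambda>a b. F a b - map_poly (dp_scale c) (B1 a b))"
      by (intro V.pva_cocycle_diff F V.pva_cocycle_scale B1)
    fix n x y
    have "np (\<lambda>a b. map_poly (dp_scale c) (B1 a b)) n (u x) (u y) = (if n = 1 then dp_const (c * form x y) else 0)"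
      by (simp add: np_def B1(2) coeff_map_poly coeff_pCons dp_const_eq split: nat.split)
    then show "np (\<lambda>a b. F a b - map_poly (dp_scale c) (B1 a b)) n (u x) (u y) = 0"
      unfolding np_diff_fun np_F c by simp
  qed
  then have "B a b = map_poly (dp_scale c) (B1 a b) + V.coboundary E a b + V.coboundary E' a b" for a b
    by (simp add: F_def C_def algebra_simps eq_diff_eq)
  moreover have "V.coboundary E a b + V.coboundary E' a b = V.coboundary (\<lambda>p. E p + E' p) a b" for a b
    by (simp add: V.coboundary_def V.brl.add V.brr.add poly_eq_iff coeff_map_poly Er'
        algebra_derivation_dpD[OF E(1)])
  moreover have "algebra_derivation dp_scale (\<lambda>p. E p + E' p)"
    unfolding algebra_derivation_def dp_module_hom_iff
    by (simp add: Er' algebra_derivation_dpD[OF E(1)] dp.scale_right_distrib algebra_simps)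
  ultimately show ?thesis
    using E(2) E'(2) by (intro exI[of _ c] exI[of _ "\<lambda>p. E p + E' p"]) (simp add: V.Dh.add add.assoc)
qed

end

theorem corollary4p15:
  fixes scale :: "'f::field_char_0 \<Rightarrow> 'g::ab_group_add \<Rightarrow> 'g"
    and lie :: "'g \<Rightarrow> 'g \<Rightarrow> 'g"
    and form :: "'g \<Rightarrow> 'g \<Rightarrow> 'f"
    and k :: 'f
    and e :: "'i::finite \<Rightarrow> 'g"
    and D :: "('i, 'f) diff_poly \<Rightarrow> ('i, 'f) diff_poly"
    and br :: "('i, 'f) diff_poly \<Rightarrow> ('i, 'f) diff_poly \<Rightarrow> ('i, 'f) diff_poly poly"
  assumes simple: "simple_lie_algebra scale lie"
    and form: "nondegenerate_invariant_form scale lie form"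
    and k: "k \<noteq> 0"
    and basis: "inj e" "finite_dimensional_vector_space scale (range e)"
    and affine: "affine_pva D br scale lie form k e"
  shows
    "(\<forall>C \<in> casimir_elements D br. \<exists>c. C = lint D (dp_scale c 1)) \<and>
     (\<forall>E. pva_derivation dp_scale D br E \<longrightarrow> inner_derivation br E) \<and>
     (scalar_centroid scale lie \<longrightarrow>
       (\<exists>Y. two_cocycle dp_scale D br Y \<and>
         (\<forall>a b. cong_total D (Y (dp_incl scale e a) (dp_incl scale e b))
                             [:[:0, dp_const (form a b):]:]) \<and>
         (\<forall>B. first_order_deformation dp_scale D br B \<longrightarrow>
           (\<exists>c. equivalent_deformations dp_scale D br B
                  (cochain_bracket D (\<lambda>a b. smult [:dp_const c:] (Y a b)))))))"
proof -
  interpret S: simple_lie_algebra scale lie by (rule simple)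
  interpret affine_pva_simple D br scale lie form k e
    by (intro affine_pva_simple.intro affine_pva_simple_axioms.intro affine k
        simple_lie_algebra_with_form.intro simple form
        based_lie_algebra.intro based_lie_algebra_axioms.intro S.lie_algebra_axioms basis)
  show ?thesis
  proof (intro conjI ballI allI impI)
    fix C
    assume "C \<in> casimir_elements D br"
    then obtain a where a: "C = lint D a" "\<And>b. np br 0 a b = 0"
      by (auto simp: casimir_elements_def np_def poly_0_coeff_0)
    obtain c v where cv: "a = dp_const c + D v" using casimir_element[OF a(2)] by blast
    have "lint D a = lint D (dp_const c)"
    proof -
      have "a + D w = dp_const c + D (v + w)" "dp_const c + D w = a + D (w - v)" for w
        by (simp_all add: cv V.Dh.add V.Dh.diff)
      then show ?thesis unfolding lint_def by blast
    qed
    then show "\<exists>c. C = lint D (dp_scale c 1)" using a(1) by (metis dp_const_eq)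
  next
    fix E
    assume "pva_derivation dp_scale D br E"
    then show "inner_derivation br E"
      using pva_derivation_inner by (simp add: inner_derivation_def np_def poly_0_coeff_0)
  next
    assume centroid: "scalar_centroid scale lie"
    obtain B1 where B1: "pva_cocycle dp_scale D br B1" "\<And>x y. B1 (u x) (u y) = [:0, dp_const (form x y):]"
      using standard_cocycle_exists by blast
    \<comment> \<open>A representative without the second variable is unaffected by the substitution
      of -\<lambda>-D for \<open>\<lambda>\<^sub>2\<close>, so every bracket is the bracket of a
      cochain.\<close>
    have bracket: "cochain_bracket D (\<lambda>a b. [:P a b:]) = P" for P
      by (simp add: cochain_bracket_def subst_second_def fun_eq_iff)
    have cong: "cong_total D [:B1 (u a) (u b):] [:[:0, dp_const (form a b):]:]" for a b
    proof -
      have "total_op D 0 = 0" by (simp add: total_op_def)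
      then show ?thesis unfolding cong_total_def B1(2) by (metis diff_self rangeI)
    qed
    have scaled: "(\<lambda>a b. smult [:dp_const c:] [:B1 a b:]) = (\<lambda>a b. [:map_poly (dp_scale c) (B1 a b):])" for c
      by (intro ext) (simp add: poly_eq_iff coeff_map_poly dp_scale_def coeff_pCons split: nat.split)
    show "\<exists>Y. two_cocycle dp_scale D br Y \<and>
         (\<forall>a b. cong_total D (Y (u a) (u b)) [:[:0, dp_const (form a b):]:]) \<and>
         (\<forall>B. first_order_deformation dp_scale D br B \<longrightarrow>
           (\<exists>c. equivalent_deformations dp_scale D br B
                  (cochain_bracket D (\<lambda>a b. smult [:dp_const c:] (Y a b)))))"
    proof (intro exI[of _ "\<lambda>a b. [:B1 a b:]"] conjI allI impI cong)
      show "two_cocycle dp_scale D br (\<lambda>a b. [:B1 a b:])"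
        unfolding two_cocycle_def bracket by (rule V.first_order_deformation_if_cocycle[OF B1(1)])
    next
      fix B
      assume "first_order_deformation dp_scale D br B"
      then have "pva_cocycle dp_scale D br B" by (rule V.cocycle_if_first_order_deformation)
      then obtain c E where E: "algebra_derivation dp_scale E" "\<And>a. E (D a) = D (E a)"
        "\<And>a b. B a b = map_poly (dp_scale c) (B1 a b) + V.coboundary E a b"
        using cocycle_classification[OF centroid _ B1] by blast
      show "\<exists>c. equivalent_deformations dp_scale D br B
          (cochain_bracket D (\<lambda>a b. smult [:dp_const c:] [:B1 a b:]))"
        unfolding scaled bracket by (intro exI[of _ c]) (rule V.equivalent_if_coboundary[OF E])
    qed
  qed
qed

end
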